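(* Let $(X,0)$ be a quotient symplectic singularity with a holomorphic symplectic form $\omega$; here $(X,0)$ is the germ at the image of the origin of $\mathbf{C}^{2n}/G$ for a finite group $G \subset Sp(2n,\mathbf{C})$. Then any holomorphic symplectic form $\omega'$ on $(X,0)$ is equivalent to $\omega$, i.e. there is an automorphism $\varphi$ of the germ $(X,0)$ such that $\varphi^*(\omega') = \omega$.
   Context: A holomorphic symplectic form on a germ $(X,0)$ of a normal complex space is a $d$-closed, everywhere non-degenerate holomorphic 2-form on the regular locus $X_{reg}$ (of a representative of the germ). Two pairs $(X,\omega)$ and $(X',\omega')$ are equivalent if there is an isomorphism of germs $\phi: X \to X'$ with $\omega = \phi^*(\omega')$. *)

theory Defs
  imports "HOL-Analysis.Analysis" "HOL-Algebra.Group"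
begin

(* Holomorphy in several variables is complex Frechet differentiability on an open set. *)
definition holomorphic_fun :: "(complex ^ 'm) set \<Rightarrow> (complex ^ 'm \<Rightarrow> complex) \<Rightarrow> bool" where
  "holomorphic_fun U f \<longleftrightarrow> open U \<and>
     (\<forall>z\<in>U. \<exists>D. (f has_derivative D) (at z) \<and> Vector_Spaces.linear (*s) (*) D)"

(* A reduced complex space is determined by its topology and its sheaf of holomorphic functions,
   viewed as complex-valued functions: sheaf X U f says that f restricted to the open set U is a
   section over U (values of f outside U do not matter). Being a complex space is not built into
   the record; the theorem only uses it for quotient_space below. *)
record 'a cspace =
  topol :: "'a topology"
  sheaf :: "'a set \<Rightarrow> ('a \<Rightarrow> complex) \<Rightarrow> bool"

definition affine_cspace :: "(complex ^ 'm) cspace" where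
  "affine_cspace = \<lparr>topol = euclidean, sheaf = holomorphic_fun\<rparr>"

(* Morphisms of reduced complex spaces are the continuous maps that pull back holomorphic
   functions to holomorphic functions. *)
definition holomorphic_map ::
  "'a cspace \<Rightarrow> 'a set \<Rightarrow> 'b cspace \<Rightarrow> 'b set \<Rightarrow> ('a \<Rightarrow> 'b) \<Rightarrow> bool" where
  "holomorphic_map X U Y V \<phi> \<longleftrightarrow>
     openin (topol X) U \<and> openin (topol Y) V \<and>
     continuous_map (subtopology (topol X) U) (subtopology (topol Y) V) \<phi> \<and>
     (\<forall>W f. openin (topol Y) W \<longrightarrow> W \<subseteq> V \<longrightarrow> sheaf Y W f \<longrightarrow>
        sheaf X (U \<inter> \<phi> -` W) (f \<circ> \<phi>))"

definition biholomorphic_map ::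
  "'a cspace \<Rightarrow> 'a set \<Rightarrow> 'b cspace \<Rightarrow> 'b set \<Rightarrow> ('a \<Rightarrow> 'b) \<Rightarrow> bool" where
  "biholomorphic_map X U Y V \<phi> \<longleftrightarrow> bij_betw \<phi> U V \<and>
     holomorphic_map X U Y V \<phi> \<and> holomorphic_map Y V X U (the_inv_into U \<phi>)"

definition chart :: "'a cspace \<Rightarrow> 'a set \<Rightarrow> ('a \<Rightarrow> complex ^ 'm) \<Rightarrow> bool" where
  "chart X U c \<longleftrightarrow> biholomorphic_map X U affine_cspace (c ` U) c"

(* The regular locus of a space of pure dimension CARD('m) is the union of the domains of its
   charts with values in complex ^ 'm. Accordingly, a 2-form on the regular locus is a compatible
   family of 2-forms in charts: \<omega> U c z is the bilinear form on complex ^ 'm which expresses the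
   form in the chart c of domain U at the coordinate point z in c ` U. Values at arguments that
   are not charts of the space, or at other points, carry no meaning. *)
type_synonym ('a, 'm) two_form =
  "'a set \<Rightarrow> ('a \<Rightarrow> complex ^ 'm) \<Rightarrow> complex ^ 'm \<Rightarrow> complex ^ 'm \<Rightarrow> complex ^ 'm \<Rightarrow> complex"

(* B at b (\<phi> x) is pulled back along \<phi>, read in the charts (S, a) and b, to A at a x. *)
definition pullback_at ::
  "('a \<Rightarrow> 'b) \<Rightarrow> 'a set \<Rightarrow> ('a \<Rightarrow> complex ^ 'm) \<Rightarrow> ('b \<Rightarrow> complex ^ 'm) \<Rightarrow> 'a \<Rightarrow>
   (complex ^ 'm \<Rightarrow> complex ^ 'm \<Rightarrow> complex) \<Rightarrow>
   (complex ^ 'm \<Rightarrow> complex ^ 'm \<Rightarrow> complex)" where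
  "pullback_at \<phi> S a b x B =
     (let D = frechet_derivative (b \<circ> \<phi> \<circ> the_inv_into S a) (at (a x))
      in (\<lambda>u v. B (D u) (D v)))"

definition holomorphic_two_form ::
  "'a cspace \<Rightarrow> 'a set \<Rightarrow> ('a, 'm::finite) two_form \<Rightarrow> bool" where
  "holomorphic_two_form X W \<omega> \<longleftrightarrow>
     (\<forall>U c. chart X U c \<longrightarrow> U \<subseteq> W \<longrightarrow>
        (\<forall>z\<in>c ` U.
           (\<forall>u. Vector_Spaces.linear (*s) (*) (\<lambda>v. \<omega> U c z u v)) \<and>
           (\<forall>v. Vector_Spaces.linear (*s) (*) (\<lambda>u. \<omega> U c z u v)) \<and>
           (\<forall>u. \<omega> U c z u u = 0)) \<and>
        (\<forall>u v. holomorphic_fun (c ` U) (\<lambda>z. \<omega> U c z u v))) \<and>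
     (\<forall>U c U' c'. chart X U c \<longrightarrow> U \<subseteq> W \<longrightarrow> chart X U' c' \<longrightarrow> U' \<subseteq> W \<longrightarrow>
        (\<forall>x\<in>U \<inter> U'. \<omega> U c (c x) = pullback_at id U c c' x (\<omega> U' c' (c' x))))"

definition d_closed :: "'a cspace \<Rightarrow> 'a set \<Rightarrow> ('a, 'm::finite) two_form \<Rightarrow> bool" where
  "d_closed X W \<omega> \<longleftrightarrow>
     (\<forall>U c. chart X U c \<longrightarrow> U \<subseteq> W \<longrightarrow> (\<forall>z\<in>c ` U. \<forall>u v w.
        frechet_derivative (\<lambda>y. \<omega> U c y v w) (at z) u
      - frechet_derivative (\<lambda>y. \<omega> U c y u w) (at z) v
      + frechet_derivative (\<lambda>y. \<omega> U c y u v) (at z) w = 0))"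

definition nondegenerate :: "'a cspace \<Rightarrow> 'a set \<Rightarrow> ('a, 'm::finite) two_form \<Rightarrow> bool" where
  "nondegenerate X W \<omega> \<longleftrightarrow>
     (\<forall>U c. chart X U c \<longrightarrow> U \<subseteq> W \<longrightarrow> (\<forall>z\<in>c ` U. \<forall>u. (\<forall>v. \<omega> U c z u v = 0) \<longrightarrow> u = 0))"

(* A symplectic form on the germ (X, p), given on the regular locus of the representative W. *)
definition germ_symplectic_form ::
  "'a cspace \<Rightarrow> 'a \<Rightarrow> 'a set \<Rightarrow> ('a, 'm::finite) two_form \<Rightarrow> bool" where
  "germ_symplectic_form X p W \<omega> \<longleftrightarrow> openin (topol X) W \<and> p \<in> W \<and>
     holomorphic_two_form X W \<omega> \<and> d_closed X W \<omega> \<and> nondegenerate X W \<omega>"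

(* \<omega> = \<phi>^* \<omega>' on the regular locus of U, for a biholomorphic map \<phi> from U to V. *)
definition eq_pullback ::
  "'a cspace \<Rightarrow> 'a set \<Rightarrow> 'b cspace \<Rightarrow> 'b set \<Rightarrow> ('a \<Rightarrow> 'b) \<Rightarrow>
   ('a, 'm::finite) two_form \<Rightarrow> ('b, 'm) two_form \<Rightarrow> bool" where
  "eq_pullback X U Y V \<phi> \<omega> \<omega>' \<longleftrightarrow>
     (\<forall>A a B b. chart X A a \<longrightarrow> A \<subseteq> U \<longrightarrow> chart Y B b \<longrightarrow> B \<subseteq> V \<longrightarrow>
        (\<forall>x\<in>A. \<phi> x \<in> B \<longrightarrow> \<omega> A a (a x) = pullback_at \<phi> A a b x (\<omega>' B b (b (\<phi> x)))))"

(* The isomorphism of germs is represented by a biholomorphic map between open neighbourhoods of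
   the base points, small enough for both forms to be defined there. *)
definition germ_equivalent ::
  "'a cspace \<Rightarrow> 'a \<Rightarrow> 'a set \<Rightarrow> ('a, 'm::finite) two_form \<Rightarrow>
   'b cspace \<Rightarrow> 'b \<Rightarrow> 'b set \<Rightarrow> ('b, 'm) two_form \<Rightarrow> bool" where
  "germ_equivalent X p W \<omega> Y q W' \<omega>' \<longleftrightarrow>
     (\<exists>U V \<phi>. U \<subseteq> W \<and> p \<in> U \<and> V \<subseteq> W' \<and> q \<in> V \<and>
        biholomorphic_map X U Y V \<phi> \<and> \<phi> p = q \<and> eq_pullback X U Y V \<phi> \<omega> \<omega>')"

definition sympl_matrix :: "complex ^ ('n + 'n) ^ ('n::finite + 'n)" where
  "sympl_matrix = (\<chi> i j. case (i, j) of
       (Inl k, Inr l) \<Rightarrow> if k = l then 1 else 0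
     | (Inr k, Inl l) \<Rightarrow> if k = l then -1 else 0
     | _ \<Rightarrow> 0)"

definition Sp :: "(complex ^ ('n + 'n) ^ ('n::finite + 'n)) monoid" where
  "Sp = \<lparr>carrier = {A. transpose A ** sympl_matrix ** A = sympl_matrix},
         monoid.mult = (**), one = mat 1\<rparr>"

lemma sympl_matrix_square:
  "sympl_matrix ** sympl_matrix = - (mat 1 :: complex ^ ('n + 'n) ^ ('n::finite + 'n))"
proof -
  have split: "(\<Sum>k\<in>UNIV. f k) = (\<Sum>k\<in>UNIV. f (Inl k)) + (\<Sum>k\<in>UNIV. f (Inr k))"
    for f :: "'n + 'n \<Rightarrow> complex"
    unfolding UNIV_Plus_UNIV [symmetric] by (subst sum.Plus) (simp_all add: o_def)
  have "(\<Sum>k\<in>UNIV. (sympl_matrix :: complex ^ ('n + 'n) ^ ('n + 'n)) $ i $ k * sympl_matrix $ k $ j)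
      = - (if i = j then 1 else 0)" for i j
    unfolding split
    by (cases i; cases j)
       (simp_all add: sympl_matrix_def if_distrib [of "\<lambda>x. x * _"] sum_negf cong: if_cong)
  then show ?thesis
    by (simp add: vec_eq_iff matrix_matrix_mult_def mat_def)
qed

lemma group_Sp: "group (Sp :: (complex ^ ('n + 'n) ^ ('n::finite + 'n)) monoid)"
proof -
  let ?J = "sympl_matrix :: complex ^ ('n + 'n) ^ ('n + 'n)"
  have mult: "transpose (A ** B) ** ?J ** (A ** B) = ?J"
    if "transpose A ** ?J ** A = ?J" "transpose B ** ?J ** B = ?J" for A B
  proof -
    have "transpose (A ** B) ** ?J ** (A ** B) = transpose B ** (transpose A ** ?J ** A) ** B"
      by (simp only: matrix_transpose_mul matrix_mul_assoc)
    then show ?thesis by (simp only: that)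
  qed
  have inv: "\<exists>L. transpose L ** ?J ** L = ?J \<and> L ** A = mat 1"
    if A: "transpose A ** ?J ** A = ?J" for A
  proof -
    define L where "L = (- ?J) ** transpose A ** ?J"
    have "L ** A = (- ?J) ** (transpose A ** ?J ** A)"
      by (simp only: L_def matrix_mul_assoc)
    also have "\<dots> = - (?J ** ?J)"
      unfolding A by (simp add: vec_eq_iff matrix_matrix_mult_def sum_negf)
    also have "\<dots> = mat 1"
      by (simp add: sympl_matrix_square)
    finally have left: "L ** A = mat 1" .
    then have right: "A ** L = mat 1"
      using matrix_left_right_inverse by blast
    have "transpose L ** ?J ** L = transpose L ** (transpose A ** ?J ** A) ** L"
      by (simp only: A)
    also have "\<dots> = transpose (A ** L) ** ?J ** (A ** L)"
      by (simp only: matrix_transpose_mul matrix_mul_assoc)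
    also have "\<dots> = ?J"
      by (simp add: right transpose_mat)
    finally show ?thesis
      using left by blast
  qed
  let ?S = "Sp :: (complex ^ ('n + 'n) ^ ('n + 'n)) monoid"
  have closed: "A \<otimes>\<^bsub>?S\<^esub> B \<in> carrier ?S" if "A \<in> carrier ?S" "B \<in> carrier ?S" for A B
    using that mult [of A B] unfolding Sp_def by simp
  have one: "\<one>\<^bsub>?S\<^esub> \<in> carrier ?S"
    unfolding Sp_def by (simp add: transpose_mat)
  have assoc: "A \<otimes>\<^bsub>?S\<^esub> B \<otimes>\<^bsub>?S\<^esub> C = A \<otimes>\<^bsub>?S\<^esub> (B \<otimes>\<^bsub>?S\<^esub> C)" for A B C
    unfolding Sp_def by (simp add: matrix_mul_assoc)
  have l_one: "\<one>\<^bsub>?S\<^esub> \<otimes>\<^bsub>?S\<^esub> A = A" for A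
    unfolding Sp_def by simp
  have l_inv: "\<exists>L\<in>carrier ?S. L \<otimes>\<^bsub>?S\<^esub> A = \<one>\<^bsub>?S\<^esub>" if "A \<in> carrier ?S" for A
    using that inv [of A] unfolding Sp_def by auto
  show ?thesis
    using closed one assoc l_one l_inv by (rule groupI)
qed

definition orbit :: "(complex ^ 'm ^ 'm) set \<Rightarrow> complex ^ 'm \<Rightarrow> (complex ^ 'm) set" where
  "orbit G z = (\<lambda>A. A *v z) ` G"

definition quotient_topol :: "(complex ^ 'm ^ 'm::finite) set \<Rightarrow> (complex ^ 'm) set topology" where
  "quotient_topol G = topology (\<lambda>U. U \<subseteq> range (orbit G) \<and> open (orbit G -` U))"

lemma openin_quotient_topol:
  "openin (quotient_topol G) U \<longleftrightarrow> U \<subseteq> range (orbit G) \<and> open (orbit G -` U)"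
proof -
  have "istopology (\<lambda>U. U \<subseteq> range (orbit G) \<and> open (orbit G -` U))"
    unfolding istopology_def
    by (intro conjI allI impI) (auto simp only: vimage_Int vimage_Union open_Int open_UN)
  then show ?thesis
    by (simp add: quotient_topol_def)
qed

lemma quotient_map_orbit: "quotient_map euclidean (quotient_topol G) (orbit G)"
proof -
  have "openin (quotient_topol G) (range (orbit G))"
    unfolding openin_quotient_topol vimage_def by simp
  then have "range (orbit G) \<subseteq> topspace (quotient_topol G)"
    by (rule openin_subset)
  moreover have "topspace (quotient_topol G) \<subseteq> range (orbit G)"
    using openin_topspace [of "quotient_topol G"] by (simp only: openin_quotient_topol)
  ultimately have "topspace (quotient_topol G) = range (orbit G)"
    by (rule equalityI [rotated])
  then show ?thesis
    unfolding quotient_map_def openin_quotient_topol vimage_def by simp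
qed

(* Holomorphic functions on an open set of the quotient are the invariant holomorphic functions
   on its preimage. *)
definition quotient_space :: "(complex ^ 'm ^ 'm::finite) set \<Rightarrow> (complex ^ 'm) set cspace" where
  "quotient_space G = \<lparr>topol = quotient_topol G,
     sheaf = (\<lambda>U f. openin (quotient_topol G) U \<and> holomorphic_fun (orbit G -` U) (f \<circ> orbit G))\<rparr>"

end

theory Submission
  imports Defs "HOL-Complex_Analysis.Cauchy_Integral_Formula"
    "HOL-Computational_Algebra.Fundamental_Theorem_Algebra"
begin

text \<open>
  Pulled back along the orbit map, both forms become invariant closed forms on the points with trivial
  stabilizer. Since \<^term>\<open>G\<close> is a finite group of symplectic matrices, the other points form a finite
  union of subspaces of codimension at least two, so the coefficients extend to a neighbourhood of
  the origin by Hartogs' theorem (a mean value over a circle in a generic direction suffices); as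
  the inverse of the determinant extends as well, the extended forms are nondegenerate at the origin.
  The two forms at the origin are related by a linear map which commutes with the group, namely a
  square root, polynomial in the matrix, of the endomorphism comparing them. After this
  linear change Moser's argument applies: the radial primitive of the difference is invariant and
  vanishes to second order at the origin, so the corresponding time dependent vector field is
  equivariant and has a small Lipschitz constant near the origin. Picard iteration converges
  uniformly there and yields a holomorphic equivariant flow up to time one, which carries one form
  to the other and descends to the quotient.
\<close>

section \<open>Complex vectors\<close>

text \<open>The linear change has to come before Moser's argument because a segment between two
  nondegenerate skew matrices may pass through a degenerate one; once the forms agree at the origin,
  the interpolating form is constant there, and one radius serves for all times in the unit
  interval. Every construction must also respect the group. Darboux coordinates chosen for each form
  separately would normalize the forms but need not be compatible with the action, whereas a
  polynomial in the comparing endomorphism commutes with whatever commutes with that endomorphism.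
  The forms are given only in charts of the quotient, and the proof does not determine which orbits
  lie in a chart. Orbits with trivial stabilizer have an explicit one, a local inverse of the orbit
  map; should a chart contain further orbits, the equality of the forms there follows by density. On
  the analytic side, Cauchy's formula on complex lines expresses directional derivatives through
  values. It supplies the continuity of derivatives, differentiation under the integral and the
  holomorphy of uniform limits, so that no power series occur.\<close>

lemma linear_cvec_iff:
  "Vector_Spaces.linear (*s) (*) (D :: complex ^ 'm \<Rightarrow> complex) \<longleftrightarrow>
     (\<forall>x y. D (x + y) = D x + D y) \<and> (\<forall>c x. D (c *s x) = c * D x)"
proof -
  have "vector_space ((*s) :: complex \<Rightarrow> complex ^ 'm \<Rightarrow> _)" by unfold_locales
  moreover have "vector_space ((*) :: complex \<Rightarrow> complex \<Rightarrow> _)"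
    by unfold_locales (simp_all add: algebra_simps)
  ultimately show ?thesis
    unfolding Vector_Spaces.linear_def module_hom_def module_hom_axioms_def module_iff_vector_space
    by auto
qed

lemmas complex_scaleR = scaleR_conv_of_real [where ?'a = complex]

lemma scaleR_eq_vscale: "r *\<^sub>R (x :: complex ^ 'm) = of_real r *s x"
  by (simp add: vec_eq_iff complex_scaleR)

lemma bounded_bilinear_vscale: "bounded_bilinear ((*s) :: complex \<Rightarrow> complex ^ 'm::finite \<Rightarrow> _)"
  unfolding bilinear_conv_bounded_bilinear[symmetric] bilinear_def
  by (auto intro!: linearI simp: vec_eq_iff algebra_simps complex_scaleR)

lemma bounded_bilinear_matvec:
  "bounded_bilinear ((*v) :: complex ^ 'm::finite ^ 'k::finite \<Rightarrow> complex ^ 'm \<Rightarrow> _)"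
  unfolding bilinear_conv_bounded_bilinear[symmetric] bilinear_def
  by (auto intro!: linearI simp: vec_eq_iff algebra_simps complex_scaleR
      matrix_vector_mult_def sum.distrib sum_distrib_left)

text \<open>Without conjugation, so that it is complex linear in both arguments; the inner product
  of the type is real-valued and only real bilinear.\<close>

definition dotc :: "complex ^ 'm::finite \<Rightarrow> complex ^ 'm \<Rightarrow> complex" where
  "dotc u v = (\<Sum>i\<in>UNIV. u $ i * v $ i)"

lemma bounded_bilinear_dotc: "bounded_bilinear (dotc :: complex ^ 'm::finite \<Rightarrow> _)"
  unfolding bilinear_conv_bounded_bilinear[symmetric] bilinear_def
  by (auto intro!: linearI simp: dotc_def algebra_simps complex_scaleR
      sum.distrib sum_distrib_left)

lemmas has_derivative_vscale [derivative_intros] =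
  bounded_bilinear.FDERIV [OF bounded_bilinear_vscale]
lemmas has_derivative_matvec [derivative_intros] =
  bounded_bilinear.FDERIV [OF bounded_bilinear_matvec]
lemmas has_derivative_dotc [derivative_intros] =
  bounded_bilinear.FDERIV [OF bounded_bilinear_dotc]
lemmas continuous_on_vscale [continuous_intros] =
  bounded_bilinear.continuous_on [OF bounded_bilinear_vscale]
lemmas continuous_on_matvec [continuous_intros] =
  bounded_bilinear.continuous_on [OF bounded_bilinear_matvec]
lemmas continuous_on_dotc [continuous_intros] =
  bounded_bilinear.continuous_on [OF bounded_bilinear_dotc]

lemma norm_vscale: "norm (c *s (v :: complex ^ 'm::finite)) = cmod c * norm v"
  by (simp add: norm_vec_def norm_mult L2_set_right_distrib)

lemma has_derivative_vec_iff:
  fixes f :: "'a::real_normed_vector \<Rightarrow> 'b::euclidean_space ^ 'k::finite"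
  shows "(f has_derivative D) F \<longleftrightarrow> (\<forall>i. ((\<lambda>z. f z $ i) has_derivative (\<lambda>h. D h $ i)) F)"
proof
  assume "(f has_derivative D) F"
  then show "\<forall>i. ((\<lambda>z. f z $ i) has_derivative (\<lambda>h. D h $ i)) F"
    using bounded_linear.has_derivative[OF bounded_linear_vec_nth] by blast
next
  assume r: "\<forall>i. ((\<lambda>z. f z $ i) has_derivative (\<lambda>h. D h $ i)) F"
  then have b: "bounded_linear (\<lambda>h. D h $ i)" for i by (blast dest: has_derivative_bounded_linear)
  have "bounded_linear D"
    unfolding bounded_linear_componentwise_iff[of D]
    using b by (auto simp: Basis_vec_def inner_axis intro!: bounded_linear_inner_left_comp)
  moreover have "((\<lambda>y. ((f y - f (Lim F (\<lambda>x. x))) - D (y - Lim F (\<lambda>x. x))) /\<^sub>R norm (y - Lim F (\<lambda>x. x))) \<longlongrightarrow> 0) F"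
    using r by (intro vec_tendstoI) (simp add: has_derivative_def)
  ultimately show "(f has_derivative D) F"
    by (simp add: has_derivative_def)
qed

section \<open>Holomorphic functions of several variables\<close>

abbreviation fd :: "('a::real_normed_vector \<Rightarrow> 'b::real_normed_vector) \<Rightarrow> 'a \<Rightarrow> 'a \<Rightarrow> 'b" where
  "fd f z \<equiv> frechet_derivative f (at z)"

lemma fd_eq: "(f has_derivative D) (at z) \<Longrightarrow> fd f z = D"
  using frechet_derivative_at by metis

text \<open>A Frechet derivative is additive already, so complex homogeneity is all that remains of
  complex linearity.\<close>

lemma holomorphic_fun_iff:
  "holomorphic_fun U f \<longleftrightarrow> open U \<and>
     (\<forall>z\<in>U. \<exists>D. (f has_derivative D) (at z) \<and> (\<forall>c v. D (c *s v) = c * D v))"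
  unfolding holomorphic_fun_def linear_cvec_iff
  by (meson has_derivative_bounded_linear bounded_linear.axioms(1) linear_add)

lemma holomorphic_funI:
  assumes "open U" "\<And>z. z \<in> U \<Longrightarrow> (f has_derivative D z) (at z)"
    "\<And>z c v. z \<in> U \<Longrightarrow> D z (c *s v) = c * D z v"
  shows "holomorphic_fun U f"
  using assms unfolding holomorphic_fun_iff by blast

lemma holomorphic_fun_open: "holomorphic_fun U f \<Longrightarrow> open U"
  by (simp add: holomorphic_fun_def)

lemma holomorphic_fun_has_derivative:
  assumes "holomorphic_fun U f" "z \<in> U"
  shows "(f has_derivative fd f z) (at z)"
  using assms unfolding holomorphic_fun_iff by (metis frechet_derivative_at)

lemma holomorphic_fun_fd_vscale:
  assumes "holomorphic_fun U f" "z \<in> U"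
  shows "fd f z (c *s v) = c * fd f z v"
  using assms unfolding holomorphic_fun_iff by (metis frechet_derivative_at)

lemma holomorphic_fun_continuous_on:
  assumes "holomorphic_fun U f" shows "continuous_on U f"
  using assms holomorphic_fun_has_derivative
  by (metis continuous_at_imp_continuous_on has_derivative_continuous)

lemma holomorphic_fun_subset:
  "holomorphic_fun U f \<Longrightarrow> V \<subseteq> U \<Longrightarrow> open V \<Longrightarrow> holomorphic_fun V f"
  unfolding holomorphic_fun_def by blast

lemma has_derivative_cong_open:
  assumes "(f has_derivative D) (at z)" "open U" "z \<in> U" "\<And>x. x \<in> U \<Longrightarrow> f x = g x"
  shows "(g has_derivative D) (at z)"
  using has_derivative_transform_within_open[OF assms(1-3)] assms(4) by blast

lemma fd_cong_open:
  assumes "open U" "z \<in> U" "\<And>x. x \<in> U \<Longrightarrow> f x = g x"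
  shows "fd f z = fd g z"
proof -
  have "(f has_derivative D) (at z) \<longleftrightarrow> (g has_derivative D) (at z)" for D
    using assms has_derivative_cong_open[of f D z U g] has_derivative_cong_open[of g D z U f] by metis
  then show ?thesis by (simp add: frechet_derivative_def)
qed

lemma holomorphic_fun_cong:
  assumes "holomorphic_fun U f" "\<And>x. x \<in> U \<Longrightarrow> f x = g x"
  shows "holomorphic_fun U g"
  unfolding holomorphic_fun_iff
proof (intro conjI ballI)
  show "open U" using assms(1) by (rule holomorphic_fun_open)
  fix z assume z: "z \<in> U"
  then obtain D where D: "(f has_derivative D) (at z)" "\<forall>c v. D (c *s v) = c * D v"
    using assms(1) unfolding holomorphic_fun_iff by blast
  show "\<exists>D. (g has_derivative D) (at z) \<and> (\<forall>c v. D (c *s v) = c * D v)"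
    using has_derivative_cong_open[OF D(1) \<open>open U\<close> z] assms(2) D(2) by metis
qed

lemma holomorphic_fun_Union:
  assumes "\<And>z. z \<in> U \<Longrightarrow> \<exists>V. z \<in> V \<and> V \<subseteq> U \<and> holomorphic_fun V f"
  shows "holomorphic_fun U f"
  unfolding holomorphic_fun_iff
proof (intro conjI ballI)
  show "open U"
  proof (subst open_subopen, intro ballI)
    fix x assume "x \<in> U"
    from assms[OF this] show "\<exists>T. open T \<and> x \<in> T \<and> T \<subseteq> U"
      using holomorphic_fun_open by blast
  qed
  fix z assume "z \<in> U"
  then obtain V where "z \<in> V" "holomorphic_fun V f" using assms by blast
  then show "\<exists>D. (f has_derivative D) (at z) \<and> (\<forall>c v. D (c *s v) = c * D v)"
    unfolding holomorphic_fun_iff by blast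
qed

lemma holomorphic_fun_const [simp]: "holomorphic_fun U (\<lambda>z. c) \<longleftrightarrow> open U"
  unfolding holomorphic_fun_iff by (auto intro!: exI[of _ "\<lambda>_. 0"] derivative_eq_intros)

lemma holomorphic_fun_nth [simp]: "holomorphic_fun U (\<lambda>z. z $ i) \<longleftrightarrow> open U"
  unfolding holomorphic_fun_iff
  by (auto intro!: exI[of _ "\<lambda>v. v $ i"] bounded_linear_imp_has_derivative bounded_linear_vec_nth)

lemma holomorphic_fun_add:
  assumes "holomorphic_fun U f" "holomorphic_fun U g" shows "holomorphic_fun U (\<lambda>z. f z + g z)"
  using assms by (intro holomorphic_funI[where D = "\<lambda>z v. fd f z v + fd g z v"])
    (auto intro!: derivative_eq_intros holomorphic_fun_has_derivative holomorphic_fun_open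
      simp: holomorphic_fun_fd_vscale algebra_simps)

lemma holomorphic_fun_mult:
  assumes "holomorphic_fun U f" "holomorphic_fun U g" shows "holomorphic_fun U (\<lambda>z. f z * g z)"
  using assms by (intro holomorphic_funI[where D = "\<lambda>z v. f z * fd g z v + fd f z v * g z"])
    (auto intro!: derivative_eq_intros holomorphic_fun_has_derivative holomorphic_fun_open
      simp: holomorphic_fun_fd_vscale algebra_simps)

lemma holomorphic_fun_minus:
  assumes "holomorphic_fun U f" shows "holomorphic_fun U (\<lambda>z. - f z)"
  using assms by (intro holomorphic_funI[where D = "\<lambda>z v. - fd f z v"])
    (auto intro!: derivative_eq_intros holomorphic_fun_has_derivative holomorphic_fun_open
      simp: holomorphic_fun_fd_vscale algebra_simps)

lemma holomorphic_fun_inverse: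
  assumes "holomorphic_fun U f" "\<And>z. z \<in> U \<Longrightarrow> f z \<noteq> 0" shows "holomorphic_fun U (\<lambda>z. inverse (f z))"
  using assms by (intro holomorphic_funI[where D = "\<lambda>z v. - (inverse (f z) * fd f z v * inverse (f z))"])
    (auto intro!: derivative_eq_intros holomorphic_fun_has_derivative holomorphic_fun_open
      simp: holomorphic_fun_fd_vscale algebra_simps)

lemma holomorphic_fun_divide:
  assumes "holomorphic_fun U f" "holomorphic_fun U g" "\<And>z. z \<in> U \<Longrightarrow> g z \<noteq> 0"
  shows "holomorphic_fun U (\<lambda>z. f z / g z)"
  unfolding divide_inverse by (intro holomorphic_fun_mult holomorphic_fun_inverse assms)

lemma holomorphic_fun_sum:
  assumes "open U" "\<And>i. i \<in> I \<Longrightarrow> holomorphic_fun U (f i)"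
  shows "holomorphic_fun U (\<lambda>z. \<Sum>i\<in>I. f i z)"
  using assms(2)
  by (induction I rule: infinite_finite_induct) (auto simp: assms(1) intro: holomorphic_fun_add)

lemma holomorphic_fun_prod:
  assumes "open U" "\<And>i. i \<in> I \<Longrightarrow> holomorphic_fun U (f i)"
  shows "holomorphic_fun U (\<lambda>z. \<Prod>i\<in>I. f i z)"
  using assms(2)
  by (induction I rule: infinite_finite_induct) (auto simp: assms(1) intro: holomorphic_fun_mult)

lemma holomorphic_fun_det:
  assumes "open U" "\<And>i j. holomorphic_fun U (\<lambda>z. M z $ i $ j)"
  shows "holomorphic_fun U (\<lambda>z. det (M z :: complex ^ 'k::finite ^ 'k))"
  unfolding det_def
  by (intro holomorphic_fun_sum holomorphic_fun_mult holomorphic_fun_prod assms)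
    (simp_all add: assms)

section \<open>Vector-valued holomorphic maps\<close>

definition holomorphic_vec :: "(complex ^ 'm) set \<Rightarrow> (complex ^ 'm \<Rightarrow> complex ^ 'k) \<Rightarrow> bool" where
  "holomorphic_vec U f \<longleftrightarrow> open U \<and> (\<forall>i. holomorphic_fun U (\<lambda>z. f z $ i))"

lemma holomorphic_vec_open: "holomorphic_vec U f \<Longrightarrow> open U"
  by (simp add: holomorphic_vec_def)

lemma holomorphic_vec_nth: "holomorphic_vec U f \<Longrightarrow> holomorphic_fun U (\<lambda>z. f z $ i)"
  by (simp add: holomorphic_vec_def)

lemma holomorphic_vec_iff:
  fixes f :: "complex ^ 'm::finite \<Rightarrow> complex ^ 'k::finite"
  shows "holomorphic_vec U f \<longleftrightarrow> open U \<and>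
     (\<forall>z\<in>U. \<exists>D. (f has_derivative D) (at z) \<and> (\<forall>c v. D (c *s v) = c *s D v))"
    (is "_ \<longleftrightarrow> _ \<and> ?R")
proof (cases "open U")
  case True
  show ?thesis
  proof
    assume f: "holomorphic_vec U f"
    have "?R"
    proof (intro ballI exI conjI allI)
      fix z assume z: "z \<in> U"
      show "(f has_derivative (\<lambda>v. \<chi> i. fd (\<lambda>z. f z $ i) z v)) (at z)"
        unfolding has_derivative_vec_iff
        using holomorphic_fun_has_derivative[OF holomorphic_vec_nth[OF f] z] by simp
      show "(\<chi> i. fd (\<lambda>z. f z $ i) z (c *s v)) = c *s (\<chi> i. fd (\<lambda>z. f z $ i) z v)" for c v
        by (simp add: vec_eq_iff holomorphic_fun_fd_vscale[OF holomorphic_vec_nth[OF f] z])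
    qed
    then show "open U \<and> ?R" using True by simp
  next
    assume R: "open U \<and> ?R"
    show "holomorphic_vec U f"
      unfolding holomorphic_vec_def holomorphic_fun_iff
    proof (intro conjI allI ballI True)
      fix i z assume "z \<in> U"
      then obtain D where "(f has_derivative D) (at z)" "\<forall>c v. D (c *s v) = c *s D v"
        using R by blast
      then show "\<exists>D. ((\<lambda>z. f z $ i) has_derivative D) (at z) \<and> (\<forall>c v. D (c *s v) = c * D v)"
        by (intro exI[of _ "\<lambda>h. D h $ i"]) (simp add: has_derivative_vec_iff)
    qed
  qed
qed (simp add: holomorphic_vec_def)

lemma holomorphic_vec_has_derivative:
  fixes f :: "complex ^ 'm::finite \<Rightarrow> complex ^ 'k::finite"
  assumes "holomorphic_vec U f" "z \<in> U"
  shows "(f has_derivative fd f z) (at z)"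
  using assms unfolding holomorphic_vec_iff by (metis frechet_derivative_at)

lemma holomorphic_vec_fd_vscale:
  fixes f :: "complex ^ 'm::finite \<Rightarrow> complex ^ 'k::finite"
  assumes "holomorphic_vec U f" "z \<in> U"
  shows "fd f z (c *s v) = c *s fd f z v"
  using assms unfolding holomorphic_vec_iff by (metis frechet_derivative_at)

lemma holomorphic_vec_fd_nth:
  fixes f :: "complex ^ 'm::finite \<Rightarrow> complex ^ 'k::finite"
  assumes "holomorphic_vec U f" "z \<in> U"
  shows "fd f z v $ i = fd (\<lambda>z. f z $ i) z v"
  using holomorphic_vec_has_derivative[OF assms] unfolding has_derivative_vec_iff
  by (metis fd_eq)

lemma holomorphic_vec_continuous_on:
  fixes f :: "complex ^ 'm::finite \<Rightarrow> complex ^ 'k::finite"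
  assumes "holomorphic_vec U f" shows "continuous_on U f"
  using assms holomorphic_vec_has_derivative
  by (metis continuous_at_imp_continuous_on has_derivative_continuous)

lemma holomorphic_vec_subset:
  "holomorphic_vec U f \<Longrightarrow> V \<subseteq> U \<Longrightarrow> open V \<Longrightarrow> holomorphic_vec V f"
  unfolding holomorphic_vec_def using holomorphic_fun_subset by blast

lemma holomorphic_vec_cong:
  assumes "holomorphic_vec U f" "\<And>x. x \<in> U \<Longrightarrow> f x = g x"
  shows "holomorphic_vec U g"
  unfolding holomorphic_vec_def
proof (intro conjI allI)
  show "open U" using assms(1) by (rule holomorphic_vec_open)
  show "holomorphic_fun U (\<lambda>z. g z $ i)" for i
    by (rule holomorphic_fun_cong[OF holomorphic_vec_nth[OF assms(1)]]) (simp add: assms(2))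
qed

lemma holomorphic_vec_matvec:
  fixes A :: "complex ^ 'm::finite ^ 'k::finite"
  shows "open U \<Longrightarrow> holomorphic_vec U ((*v) A)"
  unfolding holomorphic_vec_iff
  by (auto intro!: exI[of _ "(*v) A"] bounded_linear_imp_has_derivative
      bounded_bilinear.bounded_linear_right[OF bounded_bilinear_matvec]
      simp: vector_scalar_commute)

lemma holomorphic_fun_compose:
  fixes g :: "complex ^ 'm::finite \<Rightarrow> complex ^ 'k::finite"
  assumes f: "holomorphic_fun V f" and g: "holomorphic_vec U g" and "g ` U \<subseteq> V"
  shows "holomorphic_fun U (\<lambda>z. f (g z))"
proof (rule holomorphic_funI[where D = "\<lambda>z v. fd f (g z) (fd g z v)"])
  show "open U" using g by (rule holomorphic_vec_open)
  fix z assume z: "z \<in> U"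
  then have gz: "g z \<in> V" using assms(3) by blast
  show "((\<lambda>z. f (g z)) has_derivative (\<lambda>v. fd f (g z) (fd g z v))) (at z)"
    using diff_chain_at[OF holomorphic_vec_has_derivative[OF g z]
        holomorphic_fun_has_derivative[OF f gz]] by (simp add: o_def)
  show "fd f (g z) (fd g z (c *s v)) = c * fd f (g z) (fd g z v)" for c v
    by (simp add: holomorphic_vec_fd_vscale[OF g z] holomorphic_fun_fd_vscale[OF f gz])
qed

lemma holomorphic_vec_compose:
  fixes g :: "complex ^ 'm::finite \<Rightarrow> complex ^ 'k::finite"
  assumes "holomorphic_vec V f" and "holomorphic_vec U g" and "g ` U \<subseteq> V"
  shows "holomorphic_vec U (\<lambda>z. f (g z))"
  unfolding holomorphic_vec_def
  using assms holomorphic_vec_open holomorphic_fun_compose[OF holomorphic_vec_nth] by blast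

lemma holomorphic_vec_id: "open U \<Longrightarrow> holomorphic_vec U (\<lambda>z. z)"
  by (simp add: holomorphic_vec_def)

lemma holomorphic_vec_add:
  "holomorphic_vec U f \<Longrightarrow> holomorphic_vec U g \<Longrightarrow> holomorphic_vec U (\<lambda>z. f z + g z)"
  by (simp add: holomorphic_vec_def holomorphic_fun_add)

section \<open>Cauchy's formula on complex lines\<close>

text \<open>On a circle around 0 the derivative of the parametrization is
  \<open>2 * pi * \<i>\<close> times the point itself, so Cauchy's contour integrals for the value
  and the first derivative become plain integrals over \<open>{0..1}\<close>. In this form the
  theorems on parameter integrals over real intervals apply.\<close>

lemma Cauchy_circle:
  assumes "g holomorphic_on S" "open S" "cball 0 \<rho> \<subseteq> S" "\<rho> > 0"
  shows "g 0 = integral {0..1} (\<lambda>x. g (circlepath 0 \<rho> x))"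
    and "deriv g 0 = integral {0..1} (\<lambda>x. g (circlepath 0 \<rho> x) / circlepath 0 \<rho> x)"
proof -
  have hol: "g holomorphic_on ball 0 \<rho>" and cont: "continuous_on (cball 0 \<rho>) g"
    using assms holomorphic_on_subset ball_subset_cball
    by (blast, metis holomorphic_on_imp_continuous_on holomorphic_on_subset)
  have C: "circlepath 0 \<rho> x \<noteq> 0" for x using assms by (simp add: circlepath)
  have d: "vector_derivative (circlepath 0 \<rho>) (at x) = 2 * pi * \<i> * circlepath 0 \<rho> x" for x
    unfolding vector_derivative_circlepath by (simp add: circlepath mult_ac)
  have 1: "contour_integral (circlepath 0 \<rho>) (\<lambda>u. g u / (u - 0) ^ Suc k) =
    (2 * pi * \<i>) * integral {0..1} (\<lambda>x. g (circlepath 0 \<rho> x) / circlepath 0 \<rho> x ^ k)" for k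
    unfolding contour_integral_integral d using C
    by (simp flip: integral_mult_right add: mult_ac)
  have 2: "contour_integral (circlepath 0 \<rho>) (\<lambda>u. g u / (u - 0) ^ Suc k) =
     (2 * pi * \<i>) * (deriv ^^ k) g 0 / (fact k)" for k
    by (rule Cauchy_contour_integral_circlepath[OF cont hol]) (use assms in simp)
  from 1[of 0] 2[of 0] show "g 0 = integral {0..1} (\<lambda>x. g (circlepath 0 \<rho> x))" by simp
  from 1[of 1] 2[of 1] show "deriv g 0 = integral {0..1} (\<lambda>x. g (circlepath 0 \<rho> x) / circlepath 0 \<rho> x)"
    by simp
qed

lemma has_field_derivative_line:
  fixes v :: "complex ^ 'm::finite"
  assumes "holomorphic_fun U f" "z + \<zeta> *s v \<in> U"
  shows "((\<lambda>\<zeta>. f (z + \<zeta> *s v)) has_field_derivative fd f (z + \<zeta> *s v) v) (at \<zeta>)"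
proof -
  have "((\<lambda>\<zeta>. z + \<zeta> *s v) has_derivative (\<lambda>h. h *s v)) (at \<zeta>)"
    by (auto intro!: derivative_eq_intros)
  from diff_chain_at[OF this holomorphic_fun_has_derivative[OF assms]]
  show ?thesis
    unfolding has_field_derivative_def
    by (simp add: o_def holomorphic_fun_fd_vscale[OF assms] mult_commute_abs)
qed

text \<open>Restriction to the complex line through \<open>z\<close> in direction \<open>v\<close>
  reduces both formulas to one variable. The second one expresses a directional derivative through
  values of \<open>f\<close>.\<close>

lemma Cauchy_line:
  fixes v :: "complex ^ 'm::finite"
  assumes f: "holomorphic_fun U f" and "\<rho> > 0" and disc: "\<And>\<zeta>. cmod \<zeta> \<le> \<rho> \<Longrightarrow> z + \<zeta> *s v \<in> U"
  shows "f z = integral {0..1} (\<lambda>x. f (z + circlepath 0 \<rho> x *s v))"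
    and "fd f z v = integral {0..1} (\<lambda>x. f (z + circlepath 0 \<rho> x *s v) / circlepath 0 \<rho> x)"
proof -
  define S where "S = (\<lambda>\<zeta>. z + \<zeta> *s v) -` U"
  have "open S" unfolding S_def
    using holomorphic_fun_open[OF f] by (intro open_vimage) (auto intro!: continuous_intros)
  moreover have "(\<lambda>\<zeta>. f (z + \<zeta> *s v)) holomorphic_on S"
    unfolding holomorphic_on_def S_def
    using has_field_derivative_line[OF f] field_differentiable_at_within field_differentiable_def by blast
  moreover have "cball 0 \<rho> \<subseteq> S" using disc by (auto simp: S_def)
  ultimately have *: "f (z + 0 *s v) = integral {0..1} (\<lambda>x. f (z + circlepath 0 \<rho> x *s v))"
    "deriv (\<lambda>\<zeta>. f (z + \<zeta> *s v)) 0
      = integral {0..1} (\<lambda>x. f (z + circlepath 0 \<rho> x *s v) / circlepath 0 \<rho> x)"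
    using Cauchy_circle[of "\<lambda>\<zeta>. f (z + \<zeta> *s v)" S \<rho>] \<open>\<rho> > 0\<close> by auto
  from *(1) show "f z = integral {0..1} (\<lambda>x. f (z + circlepath 0 \<rho> x *s v))" by simp
  have "deriv (\<lambda>\<zeta>. f (z + \<zeta> *s v)) 0 = fd f (z + 0 *s v) v"
    using has_field_derivative_line[OF f, of z 0 v] disc[of 0] \<open>\<rho> > 0\<close> by (intro DERIV_imp_deriv) auto
  with *(2) show "fd f z v = integral {0..1} (\<lambda>x. f (z + circlepath 0 \<rho> x *s v) / circlepath 0 \<rho> x)"
    by simp
qed

section \<open>Parameter integrals and uniform limits\<close>

lemma continuous_on_Times_local:
  fixes g :: "'p::t2_space \<times> 'q::t2_space \<Rightarrow> 'r::topological_space"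
  assumes "\<And>z. z \<in> U \<Longrightarrow> \<exists>V. open V \<and> z \<in> V \<and> V \<subseteq> U \<and> continuous_on (K \<times> V) g"
  shows "continuous_on (K \<times> U) g"
  unfolding continuous_on_eq_continuous_within
proof safe
  fix t z assume "t \<in> K" "z \<in> U"
  then obtain V where V: "open V" "z \<in> V" "V \<subseteq> U" "continuous_on (K \<times> V) g"
    using assms by blast
  have "at (t, z) within K \<times> V = at (t, z) within K \<times> U"
    by (rule at_within_nhd[of _ "UNIV \<times> V"]) (use V in \<open>auto intro: open_Times\<close>)
  moreover have "continuous (at (t, z) within K \<times> V) g"
    using V \<open>t \<in> K\<close> by (auto simp: continuous_on_eq_continuous_within)
  ultimately show "continuous (at (t, z) within K \<times> U) g" by (simp add: continuous_within)
qed

lemma disc_in_cball: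
  fixes v :: "complex ^ 'm::finite"
  assumes "z \<in> ball z0 (e / 2)" "cmod \<zeta> * norm v \<le> e / 2"
  shows "z + \<zeta> *s v \<in> cball z0 e"
proof -
  have "norm (\<zeta> *s v) \<le> e / 2" using assms by (simp add: norm_vscale)
  moreover have "norm (z - z0) < e / 2" using assms by (simp add: dist_norm norm_minus_commute)
  ultimately have "norm ((z - z0) + \<zeta> *s v) \<le> e"
    using norm_triangle_ineq[of "z - z0" "\<zeta> *s v"] by linarith
  then show ?thesis by (simp add: dist_norm norm_minus_commute algebra_simps)
qed

lemma continuous_circlepath: "continuous_on X (circlepath z r)"
  unfolding circlepath by (intro continuous_intros)

lemma circlepath_nonzero: "\<rho> > 0 \<Longrightarrow> circlepath 0 \<rho> x \<noteq> 0"
  by (simp add: circlepath)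

lemma norm_circlepath: "\<rho> \<ge> 0 \<Longrightarrow> cmod (circlepath 0 \<rho> x) = \<rho>"
  by (simp add: circlepath norm_mult)

text \<open>Near a given point one radius serves for all base points and all parameters, so the
  derivative is a Cauchy integral over a fixed interval and inherits joint continuity from
  \<open>F\<close>.\<close>

lemma continuous_on_fd_fun:
  fixes F :: "'p::t2_space \<Rightarrow> complex ^ 'm::finite \<Rightarrow> complex"
  assumes cont: "continuous_on (K \<times> U) (\<lambda>(t, z). F t z)"
    and hol: "\<And>t. t \<in> K \<Longrightarrow> holomorphic_fun U (F t)" and "open U"
  shows "continuous_on (K \<times> U) (\<lambda>(t, z). fd (F t) z v)"
proof (rule continuous_on_Times_local)
  fix z0 assume "z0 \<in> U"
  then obtain e where e: "e > 0" "cball z0 e \<subseteq> U"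
    using \<open>open U\<close> open_contains_cball by blast
  \<comment> \<open>The summand 1 keeps the radius meaningful for \<open>v = 0\<close>; the discs
    use half of \<open>e\<close>, the other half is left for the base point.\<close>
  define \<rho> where "\<rho> = e / (2 * (norm v + 1))"
  have "\<rho> > 0" using e by (simp add: \<rho>_def add_nonneg_pos)
  have "norm v / (norm v + 1) \<le> 1"
    by (subst divide_le_eq_1_pos) (auto simp: add_nonneg_pos)
  then have "\<rho> * norm v \<le> e / 2"
    using mult_left_mono[of "norm v / (norm v + 1)" 1 "e / 2"] e by (simp add: \<rho>_def)
  then have disc: "z + \<zeta> *s v \<in> U" if "z \<in> ball z0 (e / 2)" "cmod \<zeta> \<le> \<rho>" for z \<zeta>
    using disc_in_cball[OF that(1), of \<zeta> v] that(2) e(2)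
    by (meson mult_right_mono norm_ge_zero order_trans subsetD)
  let ?C = "circlepath 0 \<rho>" and ?B = "ball z0 (e / 2)"
  have "continuous_on (K \<times> ?B)
      (\<lambda>p. integral (cbox 0 1) (\<lambda>x. F (fst p) (snd p + ?C x *s v) / ?C x))"
  proof (rule integral_continuous_on_param)
    have "continuous_on ((K \<times> ?B) \<times> cbox 0 1) (\<lambda>q. F (fst (fst q)) (snd (fst q) + ?C (snd q) *s v) / ?C (snd q))"
    proof (intro continuous_intros continuous_on_compose2[OF continuous_circlepath]
        continuous_on_compose2[OF cont, of _ "\<lambda>q. (fst (fst q), snd (fst q) + ?C (snd q) *s v)", simplified])
      show "(\<lambda>q. (fst (fst q), snd (fst q) + ?C (snd q) *s v)) ` ((K \<times> ?B) \<times> cbox 0 1) \<subseteq> K \<times> U"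
        using disc norm_circlepath[of \<rho>] \<open>\<rho> > 0\<close> by auto
    qed (use circlepath_nonzero \<open>\<rho> > 0\<close> in auto)
    then show "continuous_on ((K \<times> ?B) \<times> cbox 0 1) (\<lambda>(p, x). F (fst p) (snd p + ?C x *s v) / ?C x)"
      by (simp add: case_prod_beta)
  qed
  then have "continuous_on (K \<times> ?B) (\<lambda>(t, z). fd (F t) z v)"
    by (rule continuous_on_eq)
      (use Cauchy_line(2)[OF hol \<open>\<rho> > 0\<close> disc] in auto)
  moreover have "?B \<subseteq> U" using e by (auto simp: subset_eq)
  ultimately show "\<exists>V. open V \<and> z0 \<in> V \<and> V \<subseteq> U \<and> continuous_on (K \<times> V) (\<lambda>(t, z). fd (F t) z v)"
    using e by (intro exI[of _ ?B]) auto
qed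

text \<open>The Leibniz rule asks for the derivative as a continuous family of bounded linear maps.
  In finite dimension this may be checked one vector at a time, which is what
  \<open>continuous_on_fd_fun\<close> provides.\<close>

lemma has_derivative_integral_param:
  fixes F :: "real \<Rightarrow> complex ^ 'm::finite \<Rightarrow> complex"
  assumes cont: "continuous_on ({a..b} \<times> U) (\<lambda>(t, z). F t z)"
    and hol: "\<And>t. t \<in> {a..b} \<Longrightarrow> holomorphic_fun U (F t)" and "open U" "z0 \<in> U"
  shows "((\<lambda>z. integral {a..b} (\<lambda>t. F t z)) has_derivative
      (\<lambda>v. integral {a..b} (\<lambda>t. fd (F t) z0 v))) (at z0)"
proof -
  obtain e where e: "e > 0" "ball z0 e \<subseteq> U"
    using \<open>open U\<close> \<open>z0 \<in> U\<close> openE by blast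
  let ?B = "ball z0 e"
  define fx where "fx x t = Blinfun (fd (F t) x)" for x t
  have fx: "blinfun_apply (fx x t) = fd (F t) x" if "x \<in> U" "t \<in> {a..b}" for x t
    unfolding fx_def
    by (rule bounded_linear_Blinfun_apply, rule has_derivative_bounded_linear,
        rule holomorphic_fun_has_derivative[OF hol]) (use that in auto)
  have swap: "continuous_on (?B \<times> {a..b}) (\<lambda>(x, t). g t x)"
    if "continuous_on ({a..b} \<times> U) (\<lambda>(t, x). g t x)" for g :: "real \<Rightarrow> complex ^ 'm \<Rightarrow> complex"
    unfolding case_prod_beta
    by (rule continuous_on_compose2[OF that, of _ "\<lambda>p. (snd p, fst p)", simplified])
      (use e(2) in \<open>auto intro!: continuous_intros\<close>)
  have cfx: "continuous_on (?B \<times> cbox a b) (\<lambda>(x, t). fx x t)"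
  proof (rule continuous_on_blinfun_componentwise)
    fix i :: "complex ^ 'm"
    have "continuous_on (?B \<times> {a..b}) (\<lambda>(x, t). fd (F t) x i)"
      by (rule swap[OF continuous_on_fd_fun[OF cont hol \<open>open U\<close>]])
    then show "continuous_on (?B \<times> cbox a b) (\<lambda>x. blinfun_apply (case x of (x, t) \<Rightarrow> fx x t) i)"
      unfolding cbox_interval by (rule continuous_on_eq[OF _]) (use fx e in \<open>auto\<close>)
  qed
  have slice: "continuous_on {a..b} (\<lambda>t. F t x)" if "x \<in> U" for x
    using that by (intro continuous_on_compose2[OF cont, of "{a..b}" "\<lambda>t. (t, x)", simplified])
      (auto intro!: continuous_intros)
  have "((\<lambda>x. integral (cbox a b) (\<lambda>t. F t x)) has_derivative integral (cbox a b) (fx z0)) (at z0 within ?B)"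
  proof (rule leibniz_rule[OF _ _ cfx])
    fix x t assume x: "x \<in> ?B" "t \<in> cbox a b"
    then have "x \<in> U" "t \<in> {a..b}" using e by auto
    then show "((\<lambda>x. F t x) has_derivative blinfun_apply (fx x t)) (at x within ?B)"
      using holomorphic_fun_has_derivative[OF hol] fx by (auto intro: has_derivative_at_withinI)
  next
    fix x assume "x \<in> ?B"
    then show "(\<lambda>t. F t x) integrable_on cbox a b"
      using slice e(2) by (auto intro!: integrable_continuous_real)
  qed (use e in auto)
  then have D: "((\<lambda>x. integral {a..b} (\<lambda>t. F t x)) has_derivative integral {a..b} (fx z0)) (at z0)"
    using at_within_open[of z0 ?B] e(1) unfolding cbox_interval by auto
  have "continuous_on {a..b} (fx z0)"
    using e by (intro continuous_on_compose2[OF cfx, of "{a..b}" "\<lambda>t. (z0, t)", simplified])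
      (auto intro!: continuous_intros)
  then have int: "fx z0 integrable_on {a..b}" by (rule integrable_continuous_real)
  have "blinfun_apply (integral {a..b} (fx z0)) v = integral {a..b} (\<lambda>t. fd (F t) z0 v)" for v
  proof -
    have "blinfun_apply (integral {a..b} (fx z0)) v = integral {a..b} (\<lambda>t. blinfun_apply (fx z0 t) v)"
      by (rule blinfun_apply_integral[OF int])
    also have "\<dots> = integral {a..b} (\<lambda>t. fd (F t) z0 v)"
      by (rule integral_cong) (simp add: fx \<open>z0 \<in> U\<close>)
    finally show ?thesis .
  qed
  then have "blinfun_apply (integral {a..b} (fx z0)) = (\<lambda>v. integral {a..b} (\<lambda>t. fd (F t) z0 v))" by blast
  with D show ?thesis by simp
qed

lemma holomorphic_fun_integral_param:
  fixes F :: "real \<Rightarrow> complex ^ 'm::finite \<Rightarrow> complex"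
  assumes cont: "continuous_on ({a..b} \<times> U) (\<lambda>(t, z). F t z)"
    and hol: "\<And>t. t \<in> {a..b} \<Longrightarrow> holomorphic_fun U (F t)" and "open U"
  shows "holomorphic_fun U (\<lambda>z. integral {a..b} (\<lambda>t. F t z))"
proof (rule holomorphic_funI[OF \<open>open U\<close> has_derivative_integral_param[OF assms]])
  fix z c v assume "z \<in> U"
  then have "integral {a..b} (\<lambda>t. fd (F t) z (c *s v)) = integral {a..b} (\<lambda>t. c * fd (F t) z v)"
    by (intro integral_cong) (simp add: holomorphic_fun_fd_vscale[OF hol])
  then show "integral {a..b} (\<lambda>t. fd (F t) z (c *s v)) = c * integral {a..b} (\<lambda>t. fd (F t) z v)"
    by simp
qed simp_all

text \<open>Cauchy's formula turns uniform closeness of values into closeness of derivatives, with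
  an error proportional to the length of the direction; this is the hypothesis of
  \<open>has_derivative_sequence\<close>.\<close>

lemma holomorphic_fun_uniform_limit:
  fixes f :: "nat \<Rightarrow> complex ^ 'm::finite \<Rightarrow> complex"
  assumes hol: "\<And>n. holomorphic_fun U (f n)" and lim: "uniform_limit U f g sequentially"
  shows "holomorphic_fun U g"
proof (rule holomorphic_fun_Union)
  have "open U" using hol holomorphic_fun_open by blast
  have contf: "continuous_on U (f n)" for n by (rule holomorphic_fun_continuous_on[OF hol])
  have contg: "continuous_on U g"
    by (rule uniform_limit_theorem[OF _ lim]) (auto simp: contf)
  fix z0 assume "z0 \<in> U"
  then obtain e where e: "e > 0" "cball z0 e \<subseteq> U"
    using \<open>open U\<close> open_contains_cball by blast
  let ?B = "ball z0 (e / 2)"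
  have "?B \<subseteq> U" using e by (auto simp: subset_eq)
  \<comment> \<open>A disc of this radius in direction \<open>h\<close> has size
    \<open>e / 2\<close> whatever \<open>h\<close> is; dividing an error by \<open>\<rho> h\<close>
    then produces the factor \<open>norm h\<close>.\<close>
  define \<rho> where "\<rho> h = e / (2 * norm h)" for h :: "complex ^ 'm"
  \<comment> \<open>The Cauchy integral of \<open>g\<close> is the candidate derivative. The
    direction 0 is set apart because \<open>\<rho> 0\<close> is 0 there by the convention on
    division.\<close>
  define G where "G x h = (if h = 0 then 0
      else integral {0..1} (\<lambda>s. g (x + circlepath 0 (\<rho> h) s *s h) / circlepath 0 (\<rho> h) s))"
    for x h :: "complex ^ 'm"
  have est: "norm (fd (f n) x h - G x h) \<le> \<delta> * norm h"
    if n: "\<And>y. y \<in> U \<Longrightarrow> norm (f n y - g y) \<le> \<delta> * (e / 2)" and x: "x \<in> ?B" for n x h \<delta>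
  proof (cases "h = 0")
    case True
    have "fd (f n) x 0 = 0"
      using holomorphic_fun_has_derivative[OF hol, of x n] x \<open>?B \<subseteq> U\<close>
      by (blast intro: linear_0 bounded_linear.linear has_derivative_bounded_linear)
    then show ?thesis using True by (simp add: G_def)
  next
    case False
    let ?C = "circlepath 0 (\<rho> h)"
    have "\<rho> h > 0" using e False by (simp add: \<rho>_def)
    have disc: "x + \<zeta> *s h \<in> U" if "cmod \<zeta> \<le> \<rho> h" for \<zeta>
    proof -
      have "cmod \<zeta> * norm h \<le> e / 2" using that False by (simp add: \<rho>_def field_simps)
      then show ?thesis using disc_in_cball[OF x] e(2) by blast
    qed
    have C: "x + ?C s *s h \<in> U" "?C s \<noteq> 0" "cmod (?C s) = \<rho> h" for s
      using disc norm_circlepath[of "\<rho> h"] circlepath_nonzero \<open>\<rho> h > 0\<close> by auto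
    have contk: "continuous_on {0..1} (\<lambda>s. k (x + ?C s *s h) / ?C s)"
      if "continuous_on U k" for k :: "complex ^ 'm \<Rightarrow> complex"
      using C by (intro continuous_intros continuous_circlepath continuous_on_compose2[OF that]) auto
    have "fd (f n) x h - G x h = integral {0..1} (\<lambda>s. f n (x + ?C s *s h) / ?C s - g (x + ?C s *s h) / ?C s)"
      using Cauchy_line(2)[OF hol \<open>\<rho> h > 0\<close> disc] False
      by (simp add: G_def integral_diff integrable_continuous_real contk contf contg)
    also have "norm \<dots> \<le> \<delta> * norm h * (1 - 0)"
    proof (rule integral_bound)
      show "continuous_on {0..1} (\<lambda>s. f n (x + ?C s *s h) / ?C s - g (x + ?C s *s h) / ?C s)"
        by (intro continuous_intros contk contf contg)
      fix s :: real
      have "norm (f n (x + ?C s *s h) / ?C s - g (x + ?C s *s h) / ?C s)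
          = norm (f n (x + ?C s *s h) - g (x + ?C s *s h)) / \<rho> h"
        using C(3) by (simp flip: diff_divide_distrib add: norm_divide)
      also have "\<dots> \<le> \<delta> * (e / 2) / \<rho> h"
        by (intro divide_right_mono n C(1)) (use \<open>\<rho> h > 0\<close> in simp)
      also have "\<dots> = \<delta> * norm h" using e False by (simp add: \<rho>_def)
      finally show "norm (f n (x + ?C s *s h) / ?C s - g (x + ?C s *s h) / ?C s) \<le> \<delta> * norm h" .
    qed simp
    finally show ?thesis by simp
  qed
  have ev: "\<forall>\<^sub>F n in sequentially. \<forall>x\<in>?B. \<forall>h. norm (fd (f n) x h - G x h) \<le> \<delta> * norm h" if "\<delta> > 0" for \<delta>
    using uniform_limitD[OF lim, of "\<delta> * (e / 2)"] that e
    by (auto elim!: eventually_mono intro!: est simp: dist_norm intro: less_imp_le)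
  have lim_pt: "(\<lambda>n. f n x) \<longlonglongrightarrow> g x" if "x \<in> U" for x
    using tendsto_uniform_limitI[OF lim that] .
  have "\<exists>g2. \<forall>x\<in>?B. (\<lambda>n. f n x) \<longlonglongrightarrow> g2 x \<and> (g2 has_derivative G x) (at x within ?B)"
  proof (rule has_derivative_sequence[where f' = "\<lambda>n. fd (f n)"])
    show "(f n has_derivative fd (f n) x) (at x within ?B)" if "x \<in> ?B" for n x
      using holomorphic_fun_has_derivative[OF hol subsetD[OF \<open>?B \<subseteq> U\<close> that]]
      by (rule has_derivative_at_withinI)
    show "\<forall>\<^sub>F n in sequentially. \<forall>x\<in>?B. \<forall>h. norm (fd (f n) x h - G x h) \<le> \<delta> * norm h"
      if "\<delta> > 0" for \<delta> by (rule ev[OF that])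
  qed (use e lim_pt[OF \<open>z0 \<in> U\<close>] in auto)
  then obtain g2 where g2: "\<And>x. x \<in> ?B \<Longrightarrow> (\<lambda>n. f n x) \<longlonglongrightarrow> g2 x"
    and "\<And>x. x \<in> ?B \<Longrightarrow> (g2 has_derivative G x) (at x within ?B)"
    by blast
  then have g2': "(g2 has_derivative G x) (at x)" if "x \<in> ?B" for x
    using at_within_open[OF that open_ball] that by metis
  have eq: "g2 x = g x" if "x \<in> ?B" for x
    using LIMSEQ_unique[OF g2(1)[OF that] lim_pt] that \<open>?B \<subseteq> U\<close> by blast
  have "holomorphic_fun ?B g2"
  proof (rule holomorphic_funI[OF _ g2'])
    fix x c v assume x: "x \<in> ?B"
    \<comment> \<open>\<open>has_derivative_sequence\<close> yields only a real derivative; complex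
      homogeneity is recovered from the derivatives of \<open>f n\<close>, which converge to
      \<open>G x\<close> in every direction.\<close>
    have l: "(\<lambda>n. fd (f n) x h) \<longlonglongrightarrow> G x h" for h
    proof (rule LIMSEQ_I)
      fix r :: real assume "r > 0"
      then have "r / (norm h + 1) > 0" by (simp add: add_nonneg_pos)
      from ev[OF this] have "\<forall>\<^sub>F n in sequentially. norm (fd (f n) x h - G x h) < r"
      proof (rule eventually_mono)
        fix n assume "\<forall>x\<in>?B. \<forall>h'. norm (fd (f n) x h' - G x h') \<le> r / (norm h + 1) * norm h'"
        then have "norm (fd (f n) x h - G x h) \<le> r / (norm h + 1) * norm h" using x by blast
        also have "\<dots> < r"
          using \<open>r > 0\<close> add_nonneg_pos[of "norm h" 1] by (simp add: divide_less_eq algebra_simps)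
        finally show "norm (fd (f n) x h - G x h) < r" .
      qed
      then show "\<exists>no. \<forall>n\<ge>no. norm (fd (f n) x h - G x h) < r"
        by (simp add: eventually_sequentially)
    qed
    have "(\<lambda>n. fd (f n) x (c *s v)) \<longlonglongrightarrow> c * G x v"
      using tendsto_mult_left[OF l[of v], of c] x \<open>?B \<subseteq> U\<close>
      by (simp add: holomorphic_fun_fd_vscale[OF hol] subset_iff)
    then show "G x (c *s v) = c * G x v"
      using LIMSEQ_unique l by blast
  qed auto
  then have "holomorphic_fun ?B g" by (rule holomorphic_fun_cong) (rule eq)
  then show "\<exists>V. z0 \<in> V \<and> V \<subseteq> U \<and> holomorphic_fun V g"
    using e \<open>?B \<subseteq> U\<close> by (intro exI[of _ ?B]) auto
qed

lemma vec_nth_integral: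
  fixes f :: "real \<Rightarrow> complex ^ 'k::finite"
  assumes "f integrable_on S"
  shows "integral S f $ i = integral S (\<lambda>t. f t $ i)"
  using integral_linear[OF assms bounded_linear_vec_nth, of i] by (simp add: o_def)

lemma continuous_on_vec_nth_iff:
  fixes f :: "'p::t2_space \<Rightarrow> 'b::euclidean_space ^ 'k::finite"
  shows "continuous_on S f \<longleftrightarrow> (\<forall>i. continuous_on S (\<lambda>x. f x $ i))"
proof
  assume "\<forall>i. continuous_on S (\<lambda>x. f x $ i)"
  then have "continuous_on S (\<lambda>x. \<chi> i. f x $ i)" by (intro continuous_on_vec_lambda) auto
  then show "continuous_on S f" by simp
qed (auto intro: continuous_intros)

lemma continuous_on_slice:
  assumes "continuous_on (K \<times> U) (\<lambda>(t, z). F t z)" "z \<in> U" "L \<subseteq> K"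
  shows "continuous_on L (\<lambda>t. F t z)"
  using assms by (intro continuous_on_compose2[OF assms(1), of L "\<lambda>t. (t, z)", simplified])
    (auto intro!: continuous_intros)

lemma continuous_on_fd_vec:
  fixes F :: "'p::t2_space \<Rightarrow> complex ^ 'm::finite \<Rightarrow> complex ^ 'k::finite"
  assumes cont: "continuous_on (K \<times> U) (\<lambda>(t, z). F t z)"
    and hol: "\<And>t. t \<in> K \<Longrightarrow> holomorphic_vec U (F t)" and "open U"
  shows "continuous_on (K \<times> U) (\<lambda>(t, z). fd (F t) z v)"
  unfolding continuous_on_vec_nth_iff
proof
  fix i
  have "continuous_on (K \<times> U) (\<lambda>(t, z). fd (\<lambda>z. F t z $ i) z v)"
    using cont hol \<open>open U\<close>
    by (intro continuous_on_fd_fun holomorphic_vec_nth)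
      (auto simp: continuous_on_vec_nth_iff case_prod_beta)
  then show "continuous_on (K \<times> U) (\<lambda>x. (case x of (t, z) \<Rightarrow> fd (F t) z v) $ i)"
    by (rule continuous_on_eq) (use holomorphic_vec_fd_nth[OF hol] in auto)
qed

lemma holomorphic_vec_integral_param:
  fixes F :: "real \<Rightarrow> complex ^ 'm::finite \<Rightarrow> complex ^ 'k::finite"
  assumes cont: "continuous_on ({a..b} \<times> U) (\<lambda>(t, z). F t z)"
    and hol: "\<And>t. t \<in> {a..b} \<Longrightarrow> holomorphic_vec U (F t)" and "open U"
  shows "holomorphic_vec U (\<lambda>z. integral {a..b} (\<lambda>t. F t z))" (is ?A)
    and "z \<in> U \<Longrightarrow> fd (\<lambda>z. integral {a..b} (\<lambda>t. F t z)) z v = integral {a..b} (\<lambda>t. fd (F t) z v)"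
      (is "_ \<Longrightarrow> ?B")
proof -
  have int: "(\<lambda>t. F t z) integrable_on {a..b}" if "z \<in> U" for z
    using continuous_on_slice[OF cont that] by (intro integrable_continuous_real) auto
  have c: "continuous_on ({a..b} \<times> U) (\<lambda>(t, z). F t z $ i)" for i
    using cont by (auto simp: continuous_on_vec_nth_iff case_prod_beta)
  show ?A
    unfolding holomorphic_vec_def
  proof (intro conjI allI \<open>open U\<close>)
    fix i
    show "holomorphic_fun U (\<lambda>z. integral {a..b} (\<lambda>t. F t z) $ i)"
      using holomorphic_fun_integral_param[OF c holomorphic_vec_nth[OF hol] \<open>open U\<close>]
      by (rule holomorphic_fun_cong) (simp_all add: vec_nth_integral int)
  qed
  show ?B if "z \<in> U"
  proof (subst vec_eq_iff, rule)
    fix i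
    have "continuous_on ({a..b} \<times> U) (\<lambda>(t, z). fd (F t) z v)"
      by (rule continuous_on_fd_vec[OF cont hol \<open>open U\<close>])
    from continuous_on_slice[OF this that]
    have int2: "(\<lambda>t. fd (F t) z v) integrable_on {a..b}"
      by (intro integrable_continuous_real) auto
    have "fd (\<lambda>z. integral {a..b} (\<lambda>t. F t z)) z v $ i
        = fd (\<lambda>z. integral {a..b} (\<lambda>t. F t z) $ i) z v"
      by (rule holomorphic_vec_fd_nth[OF \<open>?A\<close> that])
    also have "\<dots> = fd (\<lambda>z. integral {a..b} (\<lambda>t. F t z $ i)) z v"
      by (rule arg_cong[where f = "\<lambda>D. D v"], rule fd_cong_open[OF \<open>open U\<close> that])
        (simp add: vec_nth_integral int)
    also have "\<dots> = integral {a..b} (\<lambda>t. fd (\<lambda>z. F t z $ i) z v)"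
      using fd_eq[OF has_derivative_integral_param[OF c holomorphic_vec_nth[OF hol] \<open>open U\<close> that]]
      by simp
    also have "\<dots> = integral {a..b} (\<lambda>t. fd (F t) z v $ i)"
      by (rule integral_cong) (simp add: holomorphic_vec_fd_nth[OF hol that])
    also have "\<dots> = integral {a..b} (\<lambda>t. fd (F t) z v) $ i"
      by (simp add: vec_nth_integral int2)
    finally show "fd (\<lambda>z. integral {a..b} (\<lambda>t. F t z)) z v $ i = integral {a..b} (\<lambda>t. fd (F t) z v) $ i" .
  qed
qed

lemma holomorphic_vec_uniform_limit:
  fixes f :: "nat \<Rightarrow> complex ^ 'm::finite \<Rightarrow> complex ^ 'k::finite"
  assumes hol: "\<And>n. holomorphic_vec U (f n)" and lim: "uniform_limit U f g sequentially"
  shows "holomorphic_vec U g"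
  unfolding holomorphic_vec_def
proof (intro conjI allI)
  show "open U" using hol holomorphic_vec_open by blast
  fix i
  have "uniform_limit U (\<lambda>n x. f n x $ i) (\<lambda>x. g x $ i) sequentially"
    by (rule bounded_linear.uniform_limit[OF bounded_linear_vec_nth lim])
  then show "holomorphic_fun U (\<lambda>z. g z $ i)"
    by (rule holomorphic_fun_uniform_limit[OF holomorphic_vec_nth[OF hol]])
qed

text \<open>The substitution \<open>s = t * u\<close> moves the variable upper limit into the
  integrand, so that continuity of parameter integrals over a fixed interval applies.\<close>

lemma continuous_on_integral_upto:
  fixes g :: "real \<Rightarrow> 'p::t2_space \<Rightarrow> 'b::euclidean_space"
  assumes cont: "continuous_on ({0..1} \<times> U) (\<lambda>(t, z). g t z)"
  shows "continuous_on ({0..1} \<times> U) (\<lambda>(t, z). integral {0..t} (\<lambda>s. g s z))"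
proof -
  have "continuous_on ({0..1} \<times> U) (\<lambda>p. integral (cbox 0 1) (\<lambda>u. fst p *\<^sub>R g (fst p * u) (snd p)))"
  proof (rule integral_continuous_on_param)
    have "continuous_on (({0..1} \<times> U) \<times> cbox 0 1)
       (\<lambda>q. fst (fst q) *\<^sub>R g (fst (fst q) * snd q) (snd (fst q)))"
      by (intro continuous_intros
          continuous_on_compose2[OF cont, of _ "\<lambda>q. (fst (fst q) * snd q, snd (fst q))", simplified])
        (auto simp: mult_le_one)
    then show "continuous_on (({0..1} \<times> U) \<times> cbox 0 1) (\<lambda>(p, u). fst p *\<^sub>R g (fst p * u) (snd p))"
      by (simp add: case_prod_beta)
  qed
  then show ?thesis
  proof (rule continuous_on_eq, safe)
    fix t :: real and z assume t: "t \<in> {0..1}" and z: "z \<in> U"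
    have "((\<lambda>u. t *\<^sub>R g (t * u) z) has_integral (integral {t * 0..t * 1} (\<lambda>s. g s z))) {0..1}"
    proof (rule has_integral_substitution[where c = 0 and d = 1])
      show "continuous_on {0..1} (\<lambda>s. g s z)" by (rule continuous_on_slice[OF cont z]) simp
    qed (use t in \<open>auto intro!: derivative_eq_intros simp: mult_le_one\<close>)
    from integral_unique[OF this]
    show "integral (cbox 0 1) (\<lambda>u. fst (t, z) *\<^sub>R g (fst (t, z) * u) (snd (t, z))) = integral {0..t} (\<lambda>s. g s z)"
      by simp
  qed
qed

section \<open>Holomorphic flows\<close>

context
  fixes X :: "real \<Rightarrow> complex ^ 'm::finite \<Rightarrow> complex ^ 'm" and R :: real
  assumes X_cont: "continuous_on ({0..1} \<times> ball 0 R) (\<lambda>(t, z). X t z)"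
    and X_hol: "\<And>t. t \<in> {0..1} \<Longrightarrow> holomorphic_vec (ball 0 R) (X t)"
    and X_0: "\<And>t. t \<in> {0..1} \<Longrightarrow> X t 0 = 0"
    and X_lip: "\<And>t z w. t \<in> {0..1} \<Longrightarrow> z \<in> ball 0 R \<Longrightarrow> w \<in> ball 0 R \<Longrightarrow>
      norm (X t z - X t w) \<le> norm (z - w) / 4"
    and R_pos: "R > 0"
begin

primrec picard :: "nat \<Rightarrow> real \<Rightarrow> complex ^ 'm \<Rightarrow> complex ^ 'm" where
  "picard 0 t z = z"
| "picard (Suc n) t z = z + integral {0..t} (\<lambda>s. X s (picard n s z))"

text \<open>The telescoping series form lets the Weierstrass test give convergence that is uniform
  in time and space at once.\<close>

definition picard_lim :: "real \<Rightarrow> complex ^ 'm \<Rightarrow> complex ^ 'm" where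
  "picard_lim t z = z + (\<Sum>k. picard (Suc k) t z - picard k t z)"

text \<open>Within unit time a point moves by at most its own norm, so iterates starting here stay
  in the ball of radius \<open>R\<close>, where \<open>X\<close> is controlled.\<close>

abbreviation "halfball \<equiv> ball 0 (R / 2) :: (complex ^ 'm) set"

lemma X_bound:
  assumes "t \<in> {0..1}" "z \<in> ball 0 R" shows "norm (X t z) \<le> norm z / 4"
  using X_lip[OF assms, of 0] X_0[OF assms(1)] R_pos by simp

lemma X_curve_continuous:
  assumes "continuous_on ({0..1} \<times> halfball) (\<lambda>(t, z). p t z)"
    and "\<And>t z. t \<in> {0..1} \<Longrightarrow> z \<in> halfball \<Longrightarrow> p t z \<in> ball 0 R"
  shows "continuous_on ({0..1} \<times> halfball) (\<lambda>(t, z). X t (p t z))"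
  unfolding case_prod_beta
  by (rule continuous_on_compose2[OF X_cont, of _ "\<lambda>q. (fst q, p (fst q) (snd q))", simplified])
    (use assms in \<open>auto simp: case_prod_beta intro!: continuous_intros\<close>)

lemma halfball_nearby:
  assumes "z \<in> halfball" "norm (w - z) \<le> norm z" shows "w \<in> ball 0 R"
  using assms norm_triangle_ineq[of "w - z" z] by (simp add: dist_norm)

text \<open>If an iterate has norm at most \<open>2 * norm z\<close>, the field there has norm at
  most \<open>norm z\<close>, and integration over a time of at most 1 reproduces the displacement
  bound. Continuity and the bound go through one induction because composing with \<open>X\<close>
  needs the iterates to stay in its domain.\<close>

lemma picard_invariants:
  "continuous_on ({0..1} \<times> halfball) (\<lambda>(t, z). picard n t z)" (is "?C n")
  "\<And>t z. t \<in> {0..1} \<Longrightarrow> z \<in> halfball \<Longrightarrow> norm (picard n t z - z) \<le> norm z"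
proof (induction n)
  case 0
  { case 1 show ?case by (auto simp: case_prod_beta intro!: continuous_intros)
  next
    case 2 then show ?case by simp }
next
  case (Suc n)
  have ball: "picard n t z \<in> ball 0 R" if "t \<in> {0..1}" "z \<in> halfball" for t z
    using halfball_nearby that Suc.IH(2) by blast
  have c: "continuous_on ({0..1} \<times> halfball) (\<lambda>(t, z). X t (picard n t z))"
    by (rule X_curve_continuous[OF Suc.IH(1) ball])
  { case 1
    show ?case
      using continuous_on_integral_upto[OF c]
      by (auto simp: case_prod_beta intro!: continuous_intros)
  next
    case 2
    have "norm (integral {0..t} (\<lambda>s. X s (picard n s z))) \<le> norm z * (t - 0)"
    proof (rule integral_bound)
      show "continuous_on {0..t} (\<lambda>s. X s (picard n s z))"
        by (rule continuous_on_slice[OF c 2(2)]) (use 2 in auto)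
      fix s assume "s \<in> {0..t}"
      then have s: "s \<in> {0..1}" using 2 by auto
      have "norm (picard n s z) \<le> 2 * norm z"
        using Suc.IH(2)[OF s 2(2)] norm_triangle_ineq[of "picard n s z - z" z] by simp
      then show "norm (X s (picard n s z)) \<le> norm z"
        using X_bound[OF s ball[OF s 2(2)]] norm_ge_zero[of z] by linarith
    qed (use 2 in auto)
    also have "\<dots> \<le> norm z" using 2 by (simp add: mult_left_le)
    finally show ?case by simp }
qed

lemma picard_ball: "t \<in> {0..1} \<Longrightarrow> z \<in> halfball \<Longrightarrow> picard n t z \<in> ball 0 R"
  using halfball_nearby picard_invariants(2) by blast

lemma X_picard_continuous: "continuous_on ({0..1} \<times> halfball) (\<lambda>(t, z). X t (picard n t z))"
  by (rule X_curve_continuous[OF picard_invariants(1) picard_ball])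

lemma X_picard_slice:
  "z \<in> halfball \<Longrightarrow> t \<in> {0..1} \<Longrightarrow> continuous_on {0..t} (\<lambda>s. X s (picard n s z))"
  by (rule continuous_on_slice[OF X_picard_continuous]) auto

lemma picard_hol: "t \<in> {0..1} \<Longrightarrow> holomorphic_vec halfball (picard n t)"
proof (induction n arbitrary: t)
  case 0
  show ?case by (simp add: holomorphic_vec_id)
next
  case (Suc n)
  have "holomorphic_vec halfball (\<lambda>z. integral {0..t} (\<lambda>s. X s (picard n s z)))"
  proof (rule holomorphic_vec_integral_param(1))
    show "continuous_on ({0..t} \<times> halfball) (\<lambda>(s, z). X s (picard n s z))"
      by (rule continuous_on_subset[OF X_picard_continuous]) (use Suc in auto)
    fix s assume "s \<in> {0..t}"
    then have s: "s \<in> {0..1}" using Suc by auto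
    show "holomorphic_vec halfball (\<lambda>z. X s (picard n s z))"
      by (rule holomorphic_vec_compose[OF X_hol[OF s] Suc.IH[OF s]]) (use picard_ball s in auto)
  qed simp
  then show ?case by (simp add: holomorphic_vec_add holomorphic_vec_id)
qed

text \<open>If the displacement has Lipschitz constant 1/2, the iterate has 3/2, and the field along
  it has 3/8, below 1/2 again. Bounding the displacement rather than the iterate is what later
  yields injectivity of the flow.\<close>

lemma picard_lip:
  "t \<in> {0..1} \<Longrightarrow> z \<in> halfball \<Longrightarrow> w \<in> halfball \<Longrightarrow>
     norm ((picard n t z - z) - (picard n t w - w)) \<le> norm (z - w) / 2"
proof (induction n arbitrary: t)
  case (Suc n)
  have "(picard (Suc n) t z - z) - (picard (Suc n) t w - w)
      = integral {0..t} (\<lambda>s. X s (picard n s z) - X s (picard n s w))"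
    using Suc.prems by (simp add: integral_diff integrable_continuous_real X_picard_slice)
  also have "norm \<dots> \<le> norm (z - w) / 2 * (t - 0)"
  proof (rule integral_bound)
    show "continuous_on {0..t} (\<lambda>s. X s (picard n s z) - X s (picard n s w))"
      using Suc.prems by (intro continuous_intros X_picard_slice)
    fix s assume "s \<in> {0..t}"
    then have s: "s \<in> {0..1}" using Suc.prems by auto
    have "norm (X s (picard n s z) - X s (picard n s w)) \<le> norm (picard n s z - picard n s w) / 4"
      using X_lip s picard_ball Suc.prems by blast
    moreover have "norm (picard n s z - picard n s w) \<le> norm (z - w) / 2 + norm (z - w)"
      using Suc.IH[OF s Suc.prems(2,3)]
        norm_triangle_ineq[of "(picard n s z - z) - (picard n s w - w)" "z - w"]
      by (simp add: algebra_simps)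
    ultimately show "norm (X s (picard n s z) - X s (picard n s w)) \<le> norm (z - w) / 2"
      using norm_ge_zero[of "z - w"] by linarith
  qed (use Suc.prems in auto)
  also have "\<dots> \<le> norm (z - w) / 2" using Suc.prems by (simp add: mult_left_le)
  finally show ?case .
qed simp

lemma picard_diff:
  "t \<in> {0..1} \<Longrightarrow> z \<in> halfball \<Longrightarrow> norm (picard (Suc n) t z - picard n t z) \<le> R * (1 / 4) ^ n"
proof (induction n arbitrary: t)
  case 0
  have "norm (picard 1 t z - z) \<le> norm z" by (rule picard_invariants(2)[OF 0])
  also have "norm z \<le> R" using 0 R_pos by simp
  finally show ?case by simp
next
  case (Suc n)
  have "picard (Suc (Suc n)) t z - picard (Suc n) t z
      = integral {0..t} (\<lambda>s. X s (picard (Suc n) s z) - X s (picard n s z))"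
    using Suc.prems X_picard_slice[OF Suc.prems(2,1), of "Suc n"] X_picard_slice[OF Suc.prems(2,1), of n]
    by (simp add: integral_diff integrable_continuous_real)
  also have "norm \<dots> \<le> R * (1 / 4) ^ Suc n * (t - 0)"
  proof (rule integral_bound)
    show "continuous_on {0..t} (\<lambda>s. X s (picard (Suc n) s z) - X s (picard n s z))"
      using X_picard_slice Suc.prems by (intro continuous_intros) blast+
    fix s assume "s \<in> {0..t}"
    then have s: "s \<in> {0..1}" using Suc.prems by auto
    have "norm (X s (picard (Suc n) s z) - X s (picard n s z))
        \<le> norm (picard (Suc n) s z - picard n s z) / 4"
      using X_lip s picard_ball Suc.prems(2) by blast
    also have "\<dots> \<le> R * (1 / 4) ^ Suc n" using Suc.IH[OF s Suc.prems(2)] by simp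
    finally show "norm (X s (picard (Suc n) s z) - X s (picard n s z)) \<le> R * (1 / 4) ^ Suc n" .
  qed (use Suc.prems in auto)
  also have "\<dots> \<le> R * (1 / 4) ^ Suc n" using Suc.prems R_pos by (simp add: mult_left_le)
  finally show ?case .
qed

lemma picard_uniform:
  "uniform_limit ({0..1} \<times> halfball) (\<lambda>n (t, z). picard n t z) (\<lambda>(t, z). picard_lim t z) sequentially"
proof -
  have "uniform_limit ({0..1} \<times> halfball)
      (\<lambda>n p. \<Sum>k<n. picard (Suc k) (fst p) (snd p) - picard k (fst p) (snd p))
      (\<lambda>p. \<Sum>k. picard (Suc k) (fst p) (snd p) - picard k (fst p) (snd p)) sequentially"
    by (rule Weierstrass_m_test[where M = "\<lambda>n. R * (1 / 4) ^ n"])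
      (auto simp del: picard.simps intro!: picard_diff summable_mult summable_geometric)
  then have "uniform_limit ({0..1} \<times> halfball)
      (\<lambda>n p. snd p + (\<Sum>k<n. picard (Suc k) (fst p) (snd p) - picard k (fst p) (snd p)))
      (\<lambda>p. snd p + (\<Sum>k. picard (Suc k) (fst p) (snd p) - picard k (fst p) (snd p))) sequentially"
    by (intro uniform_limit_intros)
  moreover have "snd p + (\<Sum>k<n. picard (Suc k) (fst p) (snd p) - picard k (fst p) (snd p))
      = picard n (fst p) (snd p)" for n p
    by (simp only: sum_lessThan_telescope[of "\<lambda>k. picard k (fst p) (snd p)"] picard.simps(1)) simp
  ultimately show ?thesis
    by (simp only: picard_lim_def case_prod_unfold)
qed

lemma picard_uniform_slice:
  assumes "t \<in> {0..1}"
  shows "uniform_limit halfball (\<lambda>n. picard n t) (picard_lim t) sequentially"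
proof (rule uniform_limitI)
  fix e :: real assume "e > 0"
  from uniform_limitD[OF picard_uniform this]
  show "\<forall>\<^sub>F n in sequentially. \<forall>z\<in>halfball. dist (picard n t z) (picard_lim t z) < e"
    by (rule eventually_mono) (use assms in auto)
qed

lemma picard_tendsto:
  assumes "t \<in> {0..1}" "z \<in> halfball"
  shows "(\<lambda>n. picard n t z) \<longlonglongrightarrow> picard_lim t z"
  by (rule tendsto_uniform_limitI[OF picard_uniform_slice]) (use assms in auto)

lemma flow_continuous: "continuous_on ({0..1} \<times> halfball) (\<lambda>(t, z). picard_lim t z)"
  by (rule uniform_limit_theorem[OF always_eventually picard_uniform])
    (simp_all add: picard_invariants(1))

lemma flow_near:
  assumes "t \<in> {0..1}" "z \<in> halfball"
  shows "norm (picard_lim t z - z) \<le> norm z"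
  by (rule Lim_bounded[of "\<lambda>n. norm (picard n t z - z)"])
    (use assms picard_invariants(2) in \<open>auto intro!: tendsto_intros picard_tendsto\<close>)

lemma flow_ball: "t \<in> {0..1} \<Longrightarrow> z \<in> halfball \<Longrightarrow> picard_lim t z \<in> ball 0 R"
  using halfball_nearby flow_near by blast

lemma flow_lip:
  assumes "t \<in> {0..1}" "z \<in> halfball" "w \<in> halfball"
  shows "norm ((picard_lim t z - z) - (picard_lim t w - w)) \<le> norm (z - w) / 2"
  by (rule Lim_bounded[of "\<lambda>n. norm ((picard n t z - z) - (picard n t w - w))"])
    (use assms picard_lip in \<open>auto intro!: tendsto_intros picard_tendsto\<close>)

lemma flow_hol: "t \<in> {0..1} \<Longrightarrow> holomorphic_vec halfball (picard_lim t)"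
  by (rule holomorphic_vec_uniform_limit[OF picard_hol picard_uniform_slice])

text \<open>Since \<open>X\<close> is Lipschitz, the integrands of the Picard recursion converge
  uniformly on \<open>{0..t}\<close>, and both sides of the recursion pass to the limit.\<close>

lemma flow_equation:
  assumes t: "t \<in> {0..1}" and z: "z \<in> halfball"
  shows "picard_lim t z = z + integral {0..t} (\<lambda>s. X s (picard_lim s z))"
proof -
  have "uniform_limit {0..t} (\<lambda>n s. X s (picard n s z)) (\<lambda>s. X s (picard_lim s z)) sequentially"
  proof (rule uniform_limitI)
    fix e :: real assume "e > 0"
    from uniform_limitD[OF picard_uniform this]
    show "\<forall>\<^sub>F n in sequentially. \<forall>s\<in>{0..t}. dist (X s (picard n s z)) (X s (picard_lim s z)) < e"
    proof (rule eventually_mono, intro ballI)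
      fix n s assume *: "\<forall>p\<in>{0..1} \<times> halfball. dist (case p of (t, z) \<Rightarrow> picard n t z) (case p of (t, z) \<Rightarrow> picard_lim t z) < e"
        and "s \<in> {0..t}"
      then have s: "s \<in> {0..1}" using t by auto
      have "norm (X s (picard n s z) - X s (picard_lim s z)) \<le> norm (picard n s z - picard_lim s z) / 4"
        using X_lip s picard_ball flow_ball z by blast
      moreover have "norm (picard n s z - picard_lim s z) < e"
        using * s z by (auto simp: dist_norm)
      ultimately show "dist (X s (picard n s z)) (X s (picard_lim s z)) < e"
        using norm_ge_zero[of "picard n s z - picard_lim s z"] unfolding dist_norm by linarith
    qed
  qed
  from uniform_limit_integral[OF this X_picard_slice[OF z t]] obtain I J where
    IJ: "\<And>n. ((\<lambda>s. X s (picard n s z)) has_integral I n) {0..t}"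
    "((\<lambda>s. X s (picard_lim s z)) has_integral J) {0..t}" "I \<longlonglongrightarrow> J"
    by auto
  then have "(\<lambda>n. integral {0..t} (\<lambda>s. X s (picard n s z))) \<longlonglongrightarrow> integral {0..t} (\<lambda>s. X s (picard_lim s z))"
    using integral_unique[OF IJ(1)] integral_unique[OF IJ(2)] by simp
  then have "(\<lambda>n. picard (Suc n) t z) \<longlonglongrightarrow> z + integral {0..t} (\<lambda>s. X s (picard_lim s z))"
    by (auto intro!: tendsto_intros)
  moreover have "(\<lambda>n. picard (Suc n) t z) \<longlonglongrightarrow> picard_lim t z"
    by (rule LIMSEQ_Suc[OF picard_tendsto[OF t z]])
  ultimately show ?thesis using LIMSEQ_unique by blast
qed

text \<open>Each Picard iterate is equivariant because a linear map passes through the integral. The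
  limit inherits this without an appeal to uniqueness of solutions.\<close>

lemma flow_equivariant:
  assumes A: "\<And>t w. t \<in> {0..1} \<Longrightarrow> w \<in> ball 0 R \<Longrightarrow> A *v w \<in> ball 0 R \<Longrightarrow> X t (A *v w) = A *v X t w"
    and t: "t \<in> {0..1}" and z: "z \<in> halfball" "A *v z \<in> halfball"
  shows "picard_lim t (A *v z) = A *v picard_lim t z"
proof -
  have eq: "picard n t (A *v z) = A *v picard n t z" if "t \<in> {0..1}" for n t
    using that
  proof (induction n arbitrary: t)
    case (Suc n)
    have "integral {0..t} (\<lambda>s. X s (picard n s (A *v z))) = integral {0..t} (\<lambda>s. A *v X s (picard n s z))"
    proof (rule integral_cong)
      fix s assume "s \<in> {0..t}"
      then have s: "s \<in> {0..1}" using Suc.prems by auto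
      show "X s (picard n s (A *v z)) = A *v X s (picard n s z)"
        using Suc.IH[OF s] A[OF s] picard_ball[OF s z(1)] picard_ball[OF s z(2)] by metis
    qed
    also have "\<dots> = A *v integral {0..t} (\<lambda>s. X s (picard n s z))"
      using integral_linear[OF integrable_continuous_real[OF X_picard_slice[OF z(1) Suc.prems]]
          bounded_bilinear.bounded_linear_right[OF bounded_bilinear_matvec]]
      by (simp add: o_def)
    finally show ?case by (simp add: matrix_vector_right_distrib)
  qed simp
  have "(\<lambda>n. A *v picard n t z) \<longlonglongrightarrow> A *v picard_lim t z"
    by (rule bounded_linear.tendsto[OF bounded_bilinear.bounded_linear_right[OF bounded_bilinear_matvec]
          picard_tendsto[OF t z(1)]])
  then show ?thesis
    using LIMSEQ_unique[OF picard_tendsto[OF t z(2)]] eq[OF t] by simp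
qed

text \<open>The equation of first variation in integral form: differentiating the integral equation
  in the initial point avoids interchanging a time derivative with a space derivative.\<close>

lemma flow_fd_equation:
  assumes t: "t \<in> {0..1}" and z: "z \<in> halfball"
  shows "fd (picard_lim t) z v
     = v + integral {0..t} (\<lambda>s. fd (X s) (picard_lim s z) (fd (picard_lim s) z v))"
proof -
  have c: "continuous_on ({0..t} \<times> halfball) (\<lambda>(s, z). X s (picard_lim s z))"
    by (rule continuous_on_subset[OF X_curve_continuous[OF flow_continuous flow_ball]]) (use t in auto)
  have h: "holomorphic_vec halfball (\<lambda>z. X s (picard_lim s z))" if "s \<in> {0..t}" for s
    by (rule holomorphic_vec_compose[OF X_hol flow_hol]) (use that t flow_ball in auto)
  note I = holomorphic_vec_integral_param[OF c h open_ball]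
  let ?I = "\<lambda>z. integral {0..t} (\<lambda>s. X s (picard_lim s z))"
  have "((\<lambda>z. z + ?I z) has_derivative (\<lambda>v. v + fd ?I z v)) (at z)"
    by (intro derivative_intros holomorphic_vec_has_derivative[OF I(1)] z)
  then have "(picard_lim t has_derivative (\<lambda>v. v + fd ?I z v)) (at z)"
    by (rule has_derivative_cong_open[OF _ open_ball z]) (rule flow_equation[OF t, symmetric])
  then have "fd (picard_lim t) z v = v + fd ?I z v" by (simp add: fd_eq)
  also have "fd ?I z v = integral {0..t} (\<lambda>s. fd (\<lambda>z. X s (picard_lim s z)) z v)"
    by (rule I(2)[OF _ z])
  also have "\<dots> = integral {0..t} (\<lambda>s. fd (X s) (picard_lim s z) (fd (picard_lim s) z v))"
  proof (rule integral_cong)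
    fix s assume "s \<in> {0..t}"
    then have s: "s \<in> {0..1}" using t by auto
    show "fd (\<lambda>z. X s (picard_lim s z)) z v = fd (X s) (picard_lim s z) (fd (picard_lim s) z v)"
      using fd_eq[OF diff_chain_at[OF holomorphic_vec_has_derivative[OF flow_hol[OF s] z]
          holomorphic_vec_has_derivative[OF X_hol[OF s] flow_ball[OF s z]]]]
      unfolding comp_def by simp
  qed
  finally show ?thesis .
qed

end

section \<open>Closed holomorphic two-forms\<close>

interpretation dotc: bounded_bilinear dotc by (rule bounded_bilinear_dotc)
interpretation matvec: bounded_bilinear "(*v) :: complex ^ 'm::finite ^ 'k::finite \<Rightarrow> _"
  by (rule bounded_bilinear_matvec)

abbreviation bil :: "complex ^ 'm ^ 'm \<Rightarrow> complex ^ 'm \<Rightarrow> complex ^ 'm::finite \<Rightarrow> complex" where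
  "bil M u v \<equiv> dotc u (M *v v)"

lemma transpose_add: "transpose (A + B) = transpose A + transpose B"
  by (simp add: transpose_def vec_eq_iff)

definition skew :: "complex ^ 'm ^ 'm \<Rightarrow> bool" where
  "skew M \<longleftrightarrow> transpose M = - M"

lemma dotc_commute: "dotc u v = dotc v u"
  by (simp add: dotc_def mult.commute)

lemma dotc_transpose: "dotc (transpose A *v u) v = dotc u (A *v v)"
proof -
  have "dotc (transpose A *v u) v = (\<Sum>i\<in>UNIV. \<Sum>j\<in>UNIV. u $ j * (A $ j $ i * v $ i))"
    by (simp add: dotc_def matrix_vector_mult_def transpose_def sum_distrib_left sum_distrib_right mult_ac
        del: transpose_matrix_vector)
  also have "\<dots> = dotc u (A *v v)"
    by (subst sum.swap) (simp add: dotc_def matrix_vector_mult_def sum_distrib_left mult_ac)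
  finally show ?thesis .
qed

lemma skewD: "skew M \<Longrightarrow> dotc (M *v u) v = - bil M u v"
  using dotc_transpose[of M u v] unfolding skew_def
  by (simp add: matvec.minus_left dotc.minus_left minus_equation_iff del: transpose_matrix_vector)

lemma skew_bil: "skew M \<Longrightarrow> bil M v u = - bil M u v"
  using skewD[of M u v] dotc_commute by metis

lemma dotc_axis: "dotc (axis i 1) v = v $ i"
  by (simp add: dotc_def axis_def if_distrib[of "\<lambda>x. x * _"] cong: if_cong)

lemma dotc_eqI: "(\<And>u. dotc u v = dotc u w) \<Longrightarrow> v = w"
  by (metis dotc_axis vec_eq_iff)

lemma bil_axis: "bil M (axis i 1) (axis j 1) = M $ i $ j"
  unfolding dotc_axis by (simp add: matrix_vector_mult_def axis_def if_distrib[of "\<lambda>x. _ * x"] cong: if_cong)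

lemma bil_eqI:
  assumes "\<And>u v. bil M u v = bil N u v" shows "M = N"
  using assms by (metis bil_axis vec_eq_iff)

lemma bil_mult: "bil M (A *v u) (A *v v) = bil (transpose A ** M ** A) u v"
proof -
  have "dotc (A *v u) w = dotc u (transpose A *v w)" for w
    using dotc_transpose[of "transpose A" u w] by (simp del: transpose_matrix_vector)
  then show ?thesis
    by (simp del: transpose_matrix_vector add: matrix_vector_mul_assoc matrix_mul_assoc)
qed

lemma vscale_right: "A *v (c *s v) = c *s (A *v v)" for A :: "complex ^ 'm::finite ^ 'k::finite"
  by (simp add: vector_scalar_commute)

lemma dotc_vscale: "dotc (c *s u) v = c * dotc u v" "dotc u (c *s v) = c * dotc u v"
  by (simp_all add: dotc_def sum_distrib_left mult_ac)

section \<open>Two-forms as matrix-valued functions\<close>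

definition holomorphic_mat ::
  "(complex ^ 'm) set \<Rightarrow> (complex ^ 'm \<Rightarrow> complex ^ 'k ^ 'l) \<Rightarrow> bool" where
  "holomorphic_mat U M \<longleftrightarrow> open U \<and> (\<forall>i. holomorphic_vec U (\<lambda>z. M z $ i))"

lemma holomorphic_mat_iff:
  "holomorphic_mat U M \<longleftrightarrow> open U \<and> (\<forall>i j. holomorphic_fun U (\<lambda>z. M z $ i $ j))"
  unfolding holomorphic_mat_def holomorphic_vec_def by auto

lemma holomorphic_mat_subset:
  "holomorphic_mat U M \<Longrightarrow> V \<subseteq> U \<Longrightarrow> open V \<Longrightarrow> holomorphic_mat V M"
  unfolding holomorphic_mat_iff using holomorphic_fun_subset by blast

lemma holomorphic_mat_has_derivative:
  fixes M :: "complex ^ 'm::finite \<Rightarrow> complex ^ 'k::finite ^ 'l::finite"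
  assumes M: "holomorphic_mat U M" and z: "z \<in> U"
  shows "(M has_derivative fd M z) (at z)"
proof -
  have "(M has_derivative (\<lambda>h. \<chi> i. fd (\<lambda>z. M z $ i) z h)) (at z)"
    unfolding has_derivative_vec_iff[of M]
    using M z by (auto intro!: holomorphic_vec_has_derivative simp: holomorphic_mat_def)
  then show ?thesis by (simp add: fd_eq)
qed

lemma holomorphic_mat_continuous_on:
  fixes M :: "complex ^ 'm::finite \<Rightarrow> complex ^ 'k::finite ^ 'l::finite"
  assumes "holomorphic_mat U M" shows "continuous_on U M"
  using assms holomorphic_mat_has_derivative
  by (metis continuous_at_imp_continuous_on has_derivative_continuous)

lemma holomorphic_mat_compose:
  fixes g :: "complex ^ 'm::finite \<Rightarrow> complex ^ 'n::finite"
  assumes "holomorphic_mat V M" "holomorphic_vec U g" "g ` U \<subseteq> V"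
  shows "holomorphic_mat U (\<lambda>z. M (g z))"
  unfolding holomorphic_mat_iff
  using assms holomorphic_vec_open holomorphic_fun_compose[of V _ U g] holomorphic_mat_iff by blast

lemma holomorphic_vec_scaleR: "open U \<Longrightarrow> holomorphic_vec U (\<lambda>z. s *\<^sub>R z)"
  by (simp add: holomorphic_vec_def scaleR_conv_of_real holomorphic_fun_mult)

lemma holomorphic_vec_matvec_mult:
  fixes M :: "complex ^ 'm::finite \<Rightarrow> complex ^ 'k::finite ^ 'l::finite"
  assumes "holomorphic_mat U M" "holomorphic_vec U f"
  shows "holomorphic_vec U (\<lambda>z. M z *v f z)"
  using assms unfolding holomorphic_vec_def holomorphic_mat_iff
  by (auto simp: matrix_vector_mult_def intro!: holomorphic_fun_sum holomorphic_fun_mult)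

lemma holomorphic_mat_add:
  "holomorphic_mat U M \<Longrightarrow> holomorphic_mat U N \<Longrightarrow> holomorphic_mat U (\<lambda>z. M z + N z)"
  by (simp add: holomorphic_mat_iff holomorphic_fun_add)

lemma holomorphic_mat_scaleR:
  "holomorphic_mat U M \<Longrightarrow> holomorphic_mat U (\<lambda>z. s *\<^sub>R M z)"
  by (simp add: holomorphic_mat_iff scaleR_conv_of_real holomorphic_fun_mult)

text \<open>The last clause is the exterior derivative evaluated on constant vector fields, whose
  Lie brackets vanish.\<close>

definition closed_form :: "(complex ^ 'm::finite) set \<Rightarrow> (complex ^ 'm \<Rightarrow> complex ^ 'm ^ 'm) \<Rightarrow> bool" where
  "closed_form U M \<longleftrightarrow> holomorphic_mat U M \<and> (\<forall>z\<in>U. skew (M z)) \<and>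
     (\<forall>z\<in>U. \<forall>u v w. bil (fd M z u) v w - bil (fd M z v) u w + bil (fd M z w) u v = 0)"

lemma closed_form_mat: "closed_form U M \<Longrightarrow> holomorphic_mat U M"
  and closed_form_skew: "closed_form U M \<Longrightarrow> z \<in> U \<Longrightarrow> skew (M z)"
  and closed_form_closed: "closed_form U M \<Longrightarrow> z \<in> U \<Longrightarrow>
    bil (fd M z u) v w - bil (fd M z v) u w + bil (fd M z w) u v = 0"
  by (simp_all add: closed_form_def)

lemma closed_form_subset: "closed_form U M \<Longrightarrow> V \<subseteq> U \<Longrightarrow> open V \<Longrightarrow> closed_form V M"
  unfolding closed_form_def using holomorphic_mat_subset by blast

lemma closed_form_lincomb:
  assumes M: "closed_form U M" and N: "closed_form U N"
  shows "closed_form U (\<lambda>z. M z + s *\<^sub>R N z)"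
    and "z \<in> U \<Longrightarrow> fd (\<lambda>z. M z + s *\<^sub>R N z) z v = fd M z v + s *\<^sub>R fd N z v"
proof -
  have d: "fd (\<lambda>z. M z + s *\<^sub>R N z) z v = fd M z v + s *\<^sub>R fd N z v" if "z \<in> U" for z v
  proof -
    have "((\<lambda>z. M z + s *\<^sub>R N z) has_derivative (\<lambda>v. fd M z v + s *\<^sub>R fd N z v)) (at z)"
      by (intro derivative_intros holomorphic_mat_has_derivative[OF _ that] closed_form_mat M N)
    then show ?thesis by (simp add: fd_eq)
  qed
  show "fd (\<lambda>z. M z + s *\<^sub>R N z) z v = fd M z v + s *\<^sub>R fd N z v" if "z \<in> U" by (rule d[OF that])
  show "closed_form U (\<lambda>z. M z + s *\<^sub>R N z)"
    unfolding closed_form_def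
  proof (intro conjI ballI allI)
    show "holomorphic_mat U (\<lambda>z. M z + s *\<^sub>R N z)"
      using M N by (simp add: closed_form_mat holomorphic_mat_add holomorphic_mat_scaleR)
    fix z assume z: "z \<in> U"
    show "skew (M z + s *\<^sub>R N z)"
      using closed_form_skew[OF M z] closed_form_skew[OF N z] unfolding skew_def
      by (simp add: transpose_add transpose_scalar)
    fix u v w
    have "bil (fd (\<lambda>z. M z + s *\<^sub>R N z) z u) v w - bil (fd (\<lambda>z. M z + s *\<^sub>R N z) z v) u w
        + bil (fd (\<lambda>z. M z + s *\<^sub>R N z) z w) u v
      = (bil (fd M z u) v w - bil (fd M z v) u w + bil (fd M z w) u v)
       + s *\<^sub>R (bil (fd N z u) v w - bil (fd N z v) u w + bil (fd N z w) u v)"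
      unfolding d[OF z] matvec.add_left matvec.scaleR_left dotc.add_right dotc.scaleR_right complex_scaleR
      by (simp add: algebra_simps)
    then show "bil (fd (\<lambda>z. M z + s *\<^sub>R N z) z u) v w - bil (fd (\<lambda>z. M z + s *\<^sub>R N z) z v) u w
        + bil (fd (\<lambda>z. M z + s *\<^sub>R N z) z w) u v = 0"
      using closed_form_closed[OF M z] closed_form_closed[OF N z] by simp
  qed
qed

text \<open>The radial primitive: up to sign, \<^term>\<open>dotc (radial_primitive \<sigma> z) v\<close> is the integral of
  the contraction of \<^term>\<open>\<sigma>\<close> with the Euler vector field along the segment from \<^term>\<open>0\<close> to \<^term>\<open>z\<close>.\<close>

definition radial_primitive ::
  "(complex ^ 'm \<Rightarrow> complex ^ 'm ^ 'm) \<Rightarrow> complex ^ 'm \<Rightarrow> complex ^ 'm::finite" where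
  "radial_primitive \<sigma> z = integral {0..1} (\<lambda>s. s *\<^sub>R (\<sigma> (s *\<^sub>R z) *v z))"

lemma scaleR_in_ball: "z \<in> ball 0 R \<Longrightarrow> s \<in> {0..1} \<Longrightarrow> s *\<^sub>R z \<in> ball 0 R"
  for z :: "'a::real_normed_vector"
  using mult_left_le_one_le[of "norm z" "\<bar>s\<bar>"] by simp

context
  fixes \<sigma> :: "complex ^ 'm::finite \<Rightarrow> complex ^ 'm ^ 'm" and R :: real
  assumes \<sigma>: "closed_form (ball 0 R) \<sigma>"
begin

lemma radial_fd:
  assumes s: "s \<in> {0..1}" and z: "z \<in> ball 0 R"
  shows "fd (\<lambda>z. s *\<^sub>R (\<sigma> (s *\<^sub>R z) *v z)) z u
    = s *\<^sub>R (\<sigma> (s *\<^sub>R z) *v u + s *\<^sub>R (fd \<sigma> (s *\<^sub>R z) u *v z))"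
proof -
  note d = holomorphic_mat_has_derivative[OF closed_form_mat[OF \<sigma>] scaleR_in_ball[OF z s]]
  have "((\<lambda>z. s *\<^sub>R z) has_derivative (\<lambda>h. s *\<^sub>R h)) (at z)"
    by (auto intro!: derivative_eq_intros)
  from diff_chain_at[OF this d]
  have "((\<lambda>z. \<sigma> (s *\<^sub>R z)) has_derivative (\<lambda>h. s *\<^sub>R fd \<sigma> (s *\<^sub>R z) h)) (at z)"
    by (simp add: o_def linear_scale[OF bounded_linear.linear[OF has_derivative_bounded_linear[OF d]]])
  then have "((\<lambda>z. s *\<^sub>R (\<sigma> (s *\<^sub>R z) *v z)) has_derivative
      (\<lambda>u. s *\<^sub>R (\<sigma> (s *\<^sub>R z) *v u + s *\<^sub>R (fd \<sigma> (s *\<^sub>R z) u *v z)))) (at z)"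
    by (auto intro!: derivative_eq_intros simp: matvec.scaleR_left)
  then show ?thesis by (simp add: fd_eq)
qed

lemma radial_continuous:
  "continuous_on ({0..1} \<times> ball 0 R) (\<lambda>(s, z). s *\<^sub>R (\<sigma> (s *\<^sub>R z) *v z))"
  unfolding case_prod_beta
  by (intro continuous_intros continuous_on_compose2[OF holomorphic_mat_continuous_on[OF closed_form_mat[OF \<sigma>]],
        of _ "\<lambda>p. fst p *\<^sub>R snd p"])
    (use scaleR_in_ball[where 'a = "complex ^ 'm"] in auto)

lemma radial_hol:
  assumes "s \<in> {0..1}" shows "holomorphic_vec (ball 0 R) (\<lambda>z. s *\<^sub>R (\<sigma> (s *\<^sub>R z) *v z))"
proof -
  have "holomorphic_mat (ball 0 R) (\<lambda>z. s *\<^sub>R \<sigma> (s *\<^sub>R z))"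
    by (rule holomorphic_mat_scaleR, rule holomorphic_mat_compose[OF closed_form_mat[OF \<sigma>]])
      (use scaleR_in_ball[where 'a = "complex ^ 'm"] assms in \<open>auto intro: holomorphic_vec_scaleR\<close>)
  from holomorphic_vec_matvec_mult[OF this holomorphic_vec_id]
  show ?thesis by (simp add: matvec.scaleR_left)
qed

lemma radial_primitive_hol: "holomorphic_vec (ball 0 R) (radial_primitive \<sigma>)"
  unfolding radial_primitive_def[abs_def]
  by (rule holomorphic_vec_integral_param(1)[OF radial_continuous radial_hol]) auto

lemma radial_primitive_fd:
  assumes z: "z \<in> ball 0 R"
  shows "dotc (fd (radial_primitive \<sigma>) z u) v
     = integral {0..1} (\<lambda>s. s *\<^sub>R (dotc (\<sigma> (s *\<^sub>R z) *v u) v) + s\<^sup>2 *\<^sub>R dotc (fd \<sigma> (s *\<^sub>R z) u *v z) v)" (is ?A)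
    and "(\<lambda>s. s *\<^sub>R (dotc (\<sigma> (s *\<^sub>R z) *v u) v) + s\<^sup>2 *\<^sub>R dotc (fd \<sigma> (s *\<^sub>R z) u *v z) v) integrable_on {0..1}" (is ?B)
proof -
  let ?F = "\<lambda>s z. s *\<^sub>R (\<sigma> (s *\<^sub>R z) *v z)"
  have "continuous_on {0..1} (\<lambda>s. fd (?F s) z u)"
    by (rule continuous_on_slice[OF continuous_on_fd_vec[OF radial_continuous radial_hol]])
      (use z in auto)
  then have int: "(\<lambda>s. fd (?F s) z u) integrable_on {0..1}" by (rule integrable_continuous_real)
  have eq: "dotc (fd (?F s) z u) v
      = s *\<^sub>R (dotc (\<sigma> (s *\<^sub>R z) *v u) v) + s\<^sup>2 *\<^sub>R dotc (fd \<sigma> (s *\<^sub>R z) u *v z) v" if "s \<in> {0..1}" for s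
    unfolding radial_fd[OF that z]
    by (simp add: dotc.add_left dotc.scaleR_left scaleR_add_right power2_eq_square)
  have fdp: "fd (radial_primitive \<sigma>) z u = integral {0..1} (\<lambda>s. fd (?F s) z u)"
    unfolding radial_primitive_def[abs_def]
    by (rule holomorphic_vec_integral_param(2)[OF radial_continuous radial_hol]) (use z in auto)
  show ?A
    unfolding fdp integral_linear[OF int dotc.bounded_linear_left, symmetric, unfolded o_def]
    by (rule integral_cong) (rule eq)
  show ?B
    using integrable_linear[OF int dotc.bounded_linear_left[of v]] eq
    by (subst integrable_cong[OF eq[symmetric]]) (simp_all add: o_def)
qed

text \<open>The Poincare lemma along rays: the antisymmetrized derivative of the integrand is minus
  the derivative in \<open>s\<close> of
  \<open>s\<^sup>2 *\<^sub>R bil (\<sigma> (s *\<^sub>R z)) u v\<close>, so that only the boundary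
  term at \<open>s = 1\<close> survives.\<close>

lemma radial_primitive_closed:
  assumes z: "z \<in> ball 0 R"
  shows "dotc (fd (radial_primitive \<sigma>) z u) v - dotc (fd (radial_primitive \<sigma>) z v) u = - bil (\<sigma> z) u v"
proof -
  have FTC: "((\<lambda>s. s\<^sup>2 *\<^sub>R bil (fd \<sigma> (s *\<^sub>R z) z) u v + (2 * s) *\<^sub>R bil (\<sigma> (s *\<^sub>R z)) u v) has_integral
      (1\<^sup>2 *\<^sub>R bil (\<sigma> (1 *\<^sub>R z)) u v - 0\<^sup>2 *\<^sub>R bil (\<sigma> (0 *\<^sub>R z)) u v)) {0..1::real}"
  proof (rule fundamental_theorem_of_calculus)
    fix s :: real assume s: "s \<in> {0..1}"
    note d = holomorphic_mat_has_derivative[OF closed_form_mat[OF \<sigma>] scaleR_in_ball[OF z s]]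
    have "((\<lambda>s. s *\<^sub>R z) has_derivative (\<lambda>h. h *\<^sub>R z)) (at s within {0..1})"
      by (auto intro!: derivative_eq_intros)
    from has_derivative_compose[OF this d]
    have "((\<lambda>s. \<sigma> (s *\<^sub>R z)) has_derivative (\<lambda>h. h *\<^sub>R fd \<sigma> (s *\<^sub>R z) z)) (at s within {0..1})"
      by (simp add: linear_scale[OF bounded_linear.linear[OF has_derivative_bounded_linear[OF d]]])
    then show "((\<lambda>s. s\<^sup>2 *\<^sub>R bil (\<sigma> (s *\<^sub>R z)) u v) has_vector_derivative
       s\<^sup>2 *\<^sub>R bil (fd \<sigma> (s *\<^sub>R z) z) u v + (2 * s) *\<^sub>R bil (\<sigma> (s *\<^sub>R z)) u v) (at s within {0..1})"
      unfolding has_vector_derivative_def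
      by (auto intro!: derivative_eq_intros simp: matvec.scaleR_left dotc.scaleR_right algebra_simps
          power2_eq_square matvec.zero_right dotc.zero_left)
  qed simp
  note P = radial_primitive_fd[OF z]
  have "dotc (fd (radial_primitive \<sigma>) z u) v - dotc (fd (radial_primitive \<sigma>) z v) u
    = integral {0..1} (\<lambda>s. (s *\<^sub>R (dotc (\<sigma> (s *\<^sub>R z) *v u) v) + s\<^sup>2 *\<^sub>R dotc (fd \<sigma> (s *\<^sub>R z) u *v z) v)
        - (s *\<^sub>R (dotc (\<sigma> (s *\<^sub>R z) *v v) u) + s\<^sup>2 *\<^sub>R dotc (fd \<sigma> (s *\<^sub>R z) v *v z) u))"
    unfolding P(1) by (rule integral_diff[symmetric, OF P(2) P(2)])
  also have "\<dots> = integral {0..1} (\<lambda>s. - (s\<^sup>2 *\<^sub>R bil (fd \<sigma> (s *\<^sub>R z) z) u v + (2 * s) *\<^sub>R bil (\<sigma> (s *\<^sub>R z)) u v))"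
  proof (rule integral_cong)
    fix s :: real assume s: "s \<in> {0..1}"
    note sz = scaleR_in_ball[OF z s]
    \<comment> \<open>Closedness with the radial vector in the third place trades the derivatives
      along \<open>u\<close> and \<open>v\<close> for the derivative along the ray.\<close>
    have 1: "dotc (fd \<sigma> (s *\<^sub>R z) u *v z) v - dotc (fd \<sigma> (s *\<^sub>R z) v *v z) u = - bil (fd \<sigma> (s *\<^sub>R z) z) u v"
      using closed_form_closed[OF \<sigma> sz, where u = u and v = v and w = z]
        dotc_commute[of "fd \<sigma> (s *\<^sub>R z) u *v z" v] dotc_commute[of "fd \<sigma> (s *\<^sub>R z) v *v z" u]
      by (simp add: eq_neg_iff_add_eq_0)
    have 2: "dotc (\<sigma> (s *\<^sub>R z) *v u) v - dotc (\<sigma> (s *\<^sub>R z) *v v) u = - 2 * bil (\<sigma> (s *\<^sub>R z)) u v"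
      using closed_form_skew[OF \<sigma> sz] skewD skew_bil by (simp add: skewD skew_bil[of _ v u])
    have "(s *\<^sub>R (dotc (\<sigma> (s *\<^sub>R z) *v u) v) + s\<^sup>2 *\<^sub>R dotc (fd \<sigma> (s *\<^sub>R z) u *v z) v)
        - (s *\<^sub>R (dotc (\<sigma> (s *\<^sub>R z) *v v) u) + s\<^sup>2 *\<^sub>R dotc (fd \<sigma> (s *\<^sub>R z) v *v z) u)
      = s *\<^sub>R (dotc (\<sigma> (s *\<^sub>R z) *v u) v - dotc (\<sigma> (s *\<^sub>R z) *v v) u)
       + s\<^sup>2 *\<^sub>R (dotc (fd \<sigma> (s *\<^sub>R z) u *v z) v - dotc (fd \<sigma> (s *\<^sub>R z) v *v z) u)"
      by (simp add: algebra_simps)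
    also have "\<dots> = - (s\<^sup>2 *\<^sub>R bil (fd \<sigma> (s *\<^sub>R z) z) u v + (2 * s) *\<^sub>R bil (\<sigma> (s *\<^sub>R z)) u v)"
      unfolding 1 2 by (simp add: scaleR_conv_of_real algebra_simps)
    finally show "(s *\<^sub>R (dotc (\<sigma> (s *\<^sub>R z) *v u) v) + s\<^sup>2 *\<^sub>R dotc (fd \<sigma> (s *\<^sub>R z) u *v z) v)
        - (s *\<^sub>R (dotc (\<sigma> (s *\<^sub>R z) *v v) u) + s\<^sup>2 *\<^sub>R dotc (fd \<sigma> (s *\<^sub>R z) v *v z) u)
      = - (s\<^sup>2 *\<^sub>R bil (fd \<sigma> (s *\<^sub>R z) z) u v + (2 * s) *\<^sub>R bil (\<sigma> (s *\<^sub>R z)) u v)" .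
  qed
  also have "\<dots> = - bil (\<sigma> z) u v"
    using integral_unique[OF has_integral_neg[OF FTC]] by simp
  finally show ?thesis .
qed

lemma radial_primitive_0: "radial_primitive \<sigma> 0 = 0"
  by (simp add: radial_primitive_def matvec.zero_right)

text \<open>Of the two terms of the differentiated integrand, one vanishes with the form at the
  origin and the other with the position vector.\<close>

lemma radial_primitive_fd_0:
  assumes "\<sigma> 0 = 0" "R > 0" shows "fd (radial_primitive \<sigma>) 0 u = 0"
proof (rule dotc_eqI)
  fix v
  have "dotc (fd (radial_primitive \<sigma>) 0 u) v = 0"
    by (subst radial_primitive_fd(1))
      (use assms in \<open>simp_all add: matvec.zero_right matvec.zero_left dotc.zero_left\<close>)
  then show "dotc v (fd (radial_primitive \<sigma>) 0 u) = dotc v 0"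
    by (simp add: dotc_commute dotc.zero_left)
qed

text \<open>The primitive is a covector field, hence the transpose. The integral along a ray is
  respected because a linear map sends rays to rays.\<close>

lemma radial_primitive_equivariant:
  assumes A: "\<And>w. w \<in> ball 0 R \<Longrightarrow> A *v w \<in> ball 0 R \<Longrightarrow> transpose A ** \<sigma> (A *v w) ** A = \<sigma> w"
    and z: "z \<in> ball 0 R" "A *v z \<in> ball 0 R"
  shows "transpose A *v radial_primitive \<sigma> (A *v z) = radial_primitive \<sigma> z"
proof -
  have "(\<lambda>s. s *\<^sub>R (\<sigma> (s *\<^sub>R (A *v z)) *v (A *v z))) integrable_on {0..1}"
    using continuous_on_slice[OF radial_continuous z(2)] by (intro integrable_continuous_real) simp
  from integral_linear[OF this matvec.bounded_linear_right[of "transpose A"]]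
  have "transpose A *v radial_primitive \<sigma> (A *v z)
      = integral {0..1} (\<lambda>s. transpose A *v (s *\<^sub>R (\<sigma> (s *\<^sub>R (A *v z)) *v (A *v z))))"
    unfolding radial_primitive_def by (simp add: o_def)
  also have "\<dots> = integral {0..1} (\<lambda>s. s *\<^sub>R (\<sigma> (s *\<^sub>R z) *v z))"
  proof (rule integral_cong)
    fix s :: real assume s: "s \<in> {0..1}"
    have "s *\<^sub>R (A *v z) = A *v (s *\<^sub>R z)" by (simp add: matvec.scaleR_right)
    then have "transpose A ** \<sigma> (s *\<^sub>R (A *v z)) ** A = \<sigma> (s *\<^sub>R z)"
      using A[OF scaleR_in_ball[OF z(1) s]] scaleR_in_ball[OF z(2) s] by simp
    then show "transpose A *v (s *\<^sub>R (\<sigma> (s *\<^sub>R (A *v z)) *v (A *v z))) = s *\<^sub>R (\<sigma> (s *\<^sub>R z) *v z)"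
      by (simp only: matvec.scaleR_right matrix_vector_mul_assoc matrix_mul_assoc)
  qed
  finally show ?thesis by (simp add: radial_primitive_def)
qed

end

section \<open>Moser's argument\<close>

lemma continuous_on_det:
  fixes M :: "'p::t2_space \<Rightarrow> complex ^ 'k::finite ^ 'k"
  assumes "continuous_on S M" shows "continuous_on S (\<lambda>x. det (M x))"
proof -
  have "continuous_on S (\<lambda>x. M x $ i $ j)" for i j
    using assms by (intro continuous_intros)
  then show ?thesis
    unfolding det_def
    by (intro continuous_on_sum continuous_on_mult continuous_on_const continuous_on_prod)
qed

lemma matvec_cancel:
  fixes A :: "complex ^ 'k::finite ^ 'k"
  assumes "det A \<noteq> 0" shows "A *v x = A *v y \<longleftrightarrow> x = y"
  using cramer[OF assms, of x "A *v y"] cramer[OF assms, of y "A *v y"] by auto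

text \<open>Uniform continuity on the compact tube around the time axis gives a radius that does not
  depend on time.\<close>

lemma near_axis_bound:
  fixes f :: "real \<times> 'a::euclidean_space \<Rightarrow> real"
  assumes cont: "continuous_on ({0..1} \<times> ball 0 R) f" and "R > 0"
    and c: "\<And>t. t \<in> {0..1} \<Longrightarrow> f (t, 0) = c" and "e > 0"
  obtains r where "0 < r" "r \<le> R" "\<And>t z. t \<in> {0..1} \<Longrightarrow> z \<in> ball 0 r \<Longrightarrow> \<bar>f (t, z) - c\<bar> < e"
proof -
  let ?K = "{0..1} \<times> cball (0::'a) (R / 2)"
  have "continuous_on ?K f"
    by (rule continuous_on_subset[OF cont]) (use \<open>R > 0\<close> in auto)
  then have "uniformly_continuous_on ?K f"
    by (rule compact_uniformly_continuous) (intro compact_Times compact_Icc compact_cball)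
  then obtain d where d: "d > 0"
    "\<And>p q. p \<in> ?K \<Longrightarrow> q \<in> ?K \<Longrightarrow> dist q p < d \<Longrightarrow> dist (f q) (f p) < e"
    using \<open>e > 0\<close> unfolding uniformly_continuous_on_def by metis
  show thesis
  proof
    show "0 < min d (R / 2)" "min d (R / 2) \<le> R" using d \<open>R > 0\<close> by auto
    fix t :: real and z assume "t \<in> {0..1}" "z \<in> ball (0::'a) (min d (R / 2))"
    then have "dist (f (t, z)) (f (t, 0)) < e"
      using \<open>R > 0\<close> by (intro d(2)) (auto simp: dist_Pair_Pair)
    then show "\<bar>f (t, z) - c\<bar> < e" using c \<open>t \<in> {0..1}\<close> by (simp add: dist_real_def)
  qed
qed

lemma holomorphic_fd_expand:
  fixes f :: "complex ^ 'm::finite \<Rightarrow> complex ^ 'k::finite"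
  assumes "holomorphic_vec U f" "z \<in> U"
  shows "fd f z v = (\<Sum>i\<in>UNIV. v $ i *s fd f z (axis i 1))"
proof -
  have lin: "linear (fd f z)"
    using holomorphic_vec_has_derivative[OF assms] has_derivative_bounded_linear bounded_linear.linear by blast
  have "fd f z v = fd f z (\<Sum>i\<in>UNIV. v $ i *s axis i 1)"
    by (simp add: basis_expansion)
  also have "\<dots> = (\<Sum>i\<in>UNIV. v $ i *s fd f z (axis i 1))"
    by (simp add: linear_sum[OF lin] holomorphic_vec_fd_vscale[OF assms])
  finally show ?thesis .
qed

context
  fixes M0 M1 :: "complex ^ 'm::finite \<Rightarrow> complex ^ 'm ^ 'm" and R :: real
  assumes M0: "closed_form (ball 0 R) M0" and M1: "closed_form (ball 0 R) M1"
    and same: "M0 0 = M1 0" and nondeg: "det (M0 0) \<noteq> 0" and R_pos: "R > 0"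
begin

definition gap :: "complex ^ 'm \<Rightarrow> complex ^ 'm ^ 'm" where
  "gap z = M1 z + (-1) *\<^sub>R M0 z"

definition interp :: "real \<Rightarrow> complex ^ 'm \<Rightarrow> complex ^ 'm ^ 'm" where
  "interp t z = M0 z + t *\<^sub>R gap z"

text \<open>Cramer's rule for the vector field solving \<^term>\<open>interp t z *v X = - radial_primitive gap z\<close>.\<close>

definition moser_field :: "real \<Rightarrow> complex ^ 'm \<Rightarrow> complex ^ 'm" where
  "moser_field t z = (\<chi> k. det (\<chi> i j. if j = k then (- radial_primitive gap z) $ i
     else interp t z $ i $ j) / det (interp t z))"

lemma gap_closed: "closed_form (ball 0 R) gap"
  unfolding gap_def[abs_def] by (rule closed_form_lincomb(1)[OF M1 M0])

lemma gap_0: "gap 0 = 0"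
  by (simp add: gap_def same)

lemma interp_closed: "closed_form (ball 0 R) (interp t)"
  unfolding interp_def[abs_def] by (rule closed_form_lincomb(1)[OF M0 gap_closed])

lemma interp_fd: "z \<in> ball 0 R \<Longrightarrow> fd (interp t) z v = fd M0 z v + t *\<^sub>R fd gap z v"
  unfolding interp_def[abs_def] by (rule closed_form_lincomb(2)[OF M0 gap_closed])

lemma interp_0 [simp]: "interp t 0 = M0 0"
  by (simp add: interp_def gap_0)

lemma interp_continuous: "continuous_on ({0..1} \<times> ball 0 R) (\<lambda>(t, z). interp t z)"
  unfolding interp_def case_prod_beta
  by (intro continuous_intros
      continuous_on_compose2[OF holomorphic_mat_continuous_on[OF closed_form_mat[OF M0]]]
      continuous_on_compose2[OF holomorphic_mat_continuous_on[OF closed_form_mat[OF gap_closed]]]) auto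

lemma moser_field_iff:
  assumes "det (interp t z) \<noteq> 0"
  shows "interp t z *v x = - radial_primitive gap z \<longleftrightarrow> x = moser_field t z"
  unfolding moser_field_def cramer[OF assms] ..

lemma moser_field_0: "moser_field t 0 = 0"
  using moser_field_iff[of t 0 0] nondeg
  by (simp add: radial_primitive_0[OF gap_closed] matvec.zero_right)

text \<open>Along the time axis the determinant is the constant \<open>det (M0 0)\<close>, so its
  modulus itself can serve as the tolerance in \<open>near_axis_bound\<close>.\<close>

lemma det_interp_nonzero:
  obtains r where "0 < r" "r \<le> R" "\<And>t z. t \<in> {0..1} \<Longrightarrow> z \<in> ball 0 r \<Longrightarrow> det (interp t z) \<noteq> 0"
proof -
  have "continuous_on ({0..1} \<times> ball 0 R) (\<lambda>p. cmod (det (case p of (t, z) \<Rightarrow> interp t z)))"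
    by (intro continuous_intros continuous_on_det interp_continuous)
  from near_axis_bound[OF this R_pos, of "cmod (det (M0 0))" "cmod (det (M0 0))"]
  obtain r where "0 < r" "r \<le> R"
    "\<And>t z. t \<in> {0..1} \<Longrightarrow> z \<in> ball 0 r \<Longrightarrow> \<bar>cmod (det (interp t z)) - cmod (det (M0 0))\<bar> < cmod (det (M0 0))"
    using nondeg by auto
  then show thesis by (intro that[of r]) fastforce+
qed

context
  fixes r :: real
  assumes r: "0 < r" "r \<le> R"
    and det: "\<And>t z. t \<in> {0..1} \<Longrightarrow> z \<in> ball 0 r \<Longrightarrow> det (interp t z) \<noteq> 0"
begin

lemma ball_r_subset: "ball 0 r \<subseteq> (ball 0 R :: (complex ^ 'm) set)"
  using r by auto

lemma moser_field_eq:
  "t \<in> {0..1} \<Longrightarrow> z \<in> ball 0 r \<Longrightarrow> interp t z *v moser_field t z = - radial_primitive gap z"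
  using moser_field_iff det by blast

lemma moser_field_hol:
  assumes t: "t \<in> {0..1}" shows "holomorphic_vec (ball 0 r) (moser_field t)"
proof -
  have I: "holomorphic_fun (ball 0 r) (\<lambda>z. interp t z $ i $ j)" for i j
    using holomorphic_mat_subset[OF closed_form_mat[OF interp_closed] ball_r_subset]
    by (simp add: holomorphic_mat_iff)
  have B: "holomorphic_fun (ball 0 r) (\<lambda>z. - radial_primitive gap z $ i)" for i
    using holomorphic_vec_subset[OF radial_primitive_hol[OF gap_closed] ball_r_subset]
    by (simp add: holomorphic_vec_def holomorphic_fun_minus)
  have entry: "holomorphic_fun (ball 0 r)
      (\<lambda>z. if j = k then (- radial_primitive gap z) $ i else interp t z $ i $ j)" for i j k
    using I B by (cases "j = k") auto
  show ?thesis
    unfolding holomorphic_vec_def moser_field_def vec_lambda_beta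
    by (intro conjI allI holomorphic_fun_divide holomorphic_fun_det)
      (simp_all only: vec_lambda_beta entry I det[OF t] open_ball not_False_eq_True)
qed

lemma moser_field_continuous: "continuous_on ({0..1} \<times> ball 0 r) (\<lambda>(t, z). moser_field t z)"
proof -
  have I: "continuous_on ({0..1} \<times> ball 0 r) (\<lambda>p. interp (fst p) (snd p))"
    using continuous_on_subset[OF interp_continuous, of "{0..1} \<times> ball 0 r"] ball_r_subset
    by (auto simp: case_prod_beta)
  have "continuous_on (ball 0 r) (radial_primitive gap)"
    by (rule continuous_on_subset[OF holomorphic_vec_continuous_on[OF radial_primitive_hol[OF gap_closed]]])
      (rule ball_r_subset)
  then have B: "continuous_on ({0..1} \<times> ball 0 r) (\<lambda>p. radial_primitive gap (snd p))"
    by (rule continuous_on_compose2) (auto intro!: continuous_intros)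
  have entry: "continuous_on ({0..1} \<times> ball 0 r)
      (\<lambda>p. if j = k then (- radial_primitive gap (snd p)) $ i else interp (fst p) (snd p) $ i $ j)" for i j k
    using I B by (cases "j = k") (auto intro!: continuous_intros)
  show ?thesis
    unfolding moser_field_def case_prod_beta
    by (intro continuous_on_vec_lambda continuous_intros continuous_on_det entry I)
      (auto simp: det)
qed

text \<open>Differentiate the defining linear equation at the origin: the field vanishes there, so
  the derivative of the matrix drops out, and the derivative of the right side is 0.\<close>

lemma moser_field_fd_0:
  assumes t: "t \<in> {0..1}" shows "fd (moser_field t) 0 u = 0"
proof -
  have 0: "0 \<in> ball 0 r" "(0 :: complex ^ 'm) \<in> ball 0 R" using r by auto
  have "((\<lambda>z. interp t z *v moser_field t z) has_derivative
     (\<lambda>u. interp t 0 *v fd (moser_field t) 0 u + fd (interp t) 0 u *v moser_field t 0)) (at 0)"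
    by (intro derivative_intros holomorphic_mat_has_derivative[OF closed_form_mat[OF interp_closed] 0(2)]
        holomorphic_vec_has_derivative[OF moser_field_hol[OF t] 0(1)])
  from has_derivative_cong_open[OF this open_ball 0(1) moser_field_eq[OF t]]
  have "((\<lambda>z. - radial_primitive gap z) has_derivative (\<lambda>u. M0 0 *v fd (moser_field t) 0 u)) (at 0)"
    by (simp add: moser_field_0 matvec.zero_right)
  moreover have "((\<lambda>z. - radial_primitive gap z) has_derivative (\<lambda>u. - fd (radial_primitive gap) 0 u)) (at 0)"
    by (intro derivative_intros holomorphic_vec_has_derivative[OF radial_primitive_hol[OF gap_closed] 0(2)])
  ultimately have "M0 0 *v fd (moser_field t) 0 u = - fd (radial_primitive gap) 0 u"
    using has_derivative_unique by metis
  then have "M0 0 *v fd (moser_field t) 0 u = 0"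
    by (simp add: radial_primitive_fd_0[OF gap_closed gap_0 R_pos])
  moreover have "M0 0 *v 0 = 0" by (simp add: matvec.zero_right)
  ultimately show ?thesis using matvec_cancel[OF nondeg] by metis
qed

text \<open>The space derivative vanishes along the time axis, hence is small near it; 1/4 is the
  constant which the Picard iteration requires.\<close>

lemma moser_field_lipschitz:
  obtains r' where "0 < r'" "r' \<le> r"
    "\<And>t z w. t \<in> {0..1} \<Longrightarrow> z \<in> ball 0 r' \<Longrightarrow> w \<in> ball 0 r' \<Longrightarrow>
      norm (moser_field t z - moser_field t w) \<le> norm (z - w) / 4"
proof -
  let ?f = "\<lambda>p. \<Sum>b\<in>Basis. norm (case p of (t, z) \<Rightarrow> fd (moser_field t) z b)"
  have "continuous_on ({0..1} \<times> ball 0 r) ?f"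
    by (intro continuous_intros continuous_on_fd_vec moser_field_continuous moser_field_hol open_ball)
  from near_axis_bound[OF this r(1), of 0 "1/4"]
  obtain r' where r': "0 < r'" "r' \<le> r"
    and b: "\<And>t z. t \<in> {0..1} \<Longrightarrow> z \<in> ball 0 r' \<Longrightarrow> \<bar>?f (t, z) - 0\<bar> < 1 / 4"
    by (auto simp: moser_field_fd_0)
  show thesis
  proof (rule that[OF r'])
    fix t :: real and z w :: "complex ^ 'm"
    assume t: "t \<in> {0..1}" and zw: "z \<in> ball 0 r'" "w \<in> ball 0 r'"
    have d: "(moser_field t has_derivative fd (moser_field t) x) (at x)" if "x \<in> ball 0 r'" for x
      by (rule holomorphic_vec_has_derivative[OF moser_field_hol[OF t]]) (use that r' in auto)
    have "norm (moser_field t z - moser_field t w) \<le> 1 / 4 * norm (z - w)"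
    proof (rule differentiable_bound[OF convex_ball _ _ zw])
      fix x :: "complex ^ 'm" assume x: "x \<in> ball 0 r'"
      show "(moser_field t has_derivative fd (moser_field t) x) (at x within ball 0 r')"
        by (rule has_derivative_at_withinI[OF d[OF x]])
      have "onorm (fd (moser_field t) x) \<le> ?f (t, x)"
        using onorm_componentwise[OF has_derivative_bounded_linear[OF d[OF x]]] by simp
      also have "\<dots> \<le> 1 / 4" using b[OF t x] by linarith
      finally show "onorm (fd (moser_field t) x) \<le> 1 / 4" .
    qed
    then show "norm (moser_field t z - moser_field t w) \<le> norm (z - w) / 4" by simp
  qed
qed

text \<open>By invariance of the forms and of the primitive, \<open>A *v moser_field t w\<close>
  solves the linear system that determines the field at \<open>A *v w\<close>.\<close>

lemma moser_field_equivariant: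
  assumes A0: "\<And>w. w \<in> ball 0 R \<Longrightarrow> A *v w \<in> ball 0 R \<Longrightarrow> transpose A ** M0 (A *v w) ** A = M0 w"
    and A1: "\<And>w. w \<in> ball 0 R \<Longrightarrow> A *v w \<in> ball 0 R \<Longrightarrow> transpose A ** M1 (A *v w) ** A = M1 w"
    and t: "t \<in> {0..1}" and w: "w \<in> ball 0 r" "A *v w \<in> ball 0 r"
  shows "moser_field t (A *v w) = A *v moser_field t w"
proof -
  have mul: "transpose A ** (P + s *\<^sub>R Q) ** A = transpose A ** P ** A + s *\<^sub>R (transpose A ** Q ** A)"
    for P Q :: "complex ^ 'm ^ 'm" and s
    by (rule bil_eqI) (simp only: bil_mult[symmetric] matvec.add_left matvec.scaleR_left
        dotc.add_right dotc.scaleR_right)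
  have gapA: "transpose A ** gap (A *v w) ** A = gap w" if "w \<in> ball 0 R" "A *v w \<in> ball 0 R" for w
    unfolding gap_def mul by (simp only: A0[OF that] A1[OF that])
  have wR: "w \<in> ball 0 R" "A *v w \<in> ball 0 R" using w ball_r_subset by auto
  have "transpose A ** interp t (A *v w) ** A = interp t w"
    unfolding interp_def mul by (simp only: A0[OF wR] gapA[OF wR])
  then have "transpose A *v (interp t (A *v w) *v (A *v moser_field t w)) = interp t w *v moser_field t w"
    by (simp only: matrix_vector_mul_assoc matrix_mul_assoc)
  also have "\<dots> = - radial_primitive gap w" by (rule moser_field_eq[OF t w(1)])
  also have "\<dots> = transpose A *v (- radial_primitive gap (A *v w))"
    using radial_primitive_equivariant[OF gap_closed gapA wR] by (simp only: matvec.minus_right)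
  finally have eq: "transpose A *v (interp t (A *v w) *v (A *v moser_field t w))
      = transpose A *v (- radial_primitive gap (A *v w))" .
  \<comment> \<open>\<open>A\<close> is an arbitrary matrix here; invariance of the nondegenerate
    form at the origin is what makes it invertible.\<close>
  have "transpose A ** M0 0 ** A = M0 0"
    using A0[of 0] R_pos by (simp add: matvec.zero_right)
  then have "det (transpose A) * det (M0 0) * det A = det (M0 0)" by (metis det_mul)
  then have "det (transpose A) \<noteq> 0" using nondeg by auto
  then have "interp t (A *v w) *v (A *v moser_field t w) = - radial_primitive gap (A *v w)"
    using eq matvec_cancel by blast
  then show ?thesis using moser_field_iff[OF det[OF t w(2)]] by metis
qed

text \<open>The Lie derivative of the interpolating form along the Moser field cancels its derivative in time.\<close>

lemma moser_lie_identity: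
  assumes t: "t \<in> {0..1}" and z: "z \<in> ball 0 r"
  defines "X \<equiv> moser_field t z" and "DX \<equiv> fd (moser_field t) z"
  shows "bil (fd (interp t) z X) u v + bil (gap z) u v + bil (interp t z) (DX u) v
    + bil (interp t z) u (DX v) = 0"
proof -
  have zR: "z \<in> ball 0 R" using z ball_r_subset by auto
  \<comment> \<open>The product rule applied to the defining equation expresses
    \<open>interp t z *v DX u\<close> through the primitive and the derivative of the form, so the
    quotient of determinants never has to be differentiated.\<close>
  have "((\<lambda>z. interp t z *v moser_field t z) has_derivative
     (\<lambda>u. interp t z *v DX u + fd (interp t) z u *v X)) (at z)"
    unfolding X_def DX_def
    by (intro derivative_intros holomorphic_mat_has_derivative[OF closed_form_mat[OF interp_closed] zR]
        holomorphic_vec_has_derivative[OF moser_field_hol[OF t] z])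
  from has_derivative_cong_open[OF this open_ball z moser_field_eq[OF t]]
  have "((\<lambda>z. - radial_primitive gap z) has_derivative
     (\<lambda>u. interp t z *v DX u + fd (interp t) z u *v X)) (at z)" by blast
  moreover have "((\<lambda>z. - radial_primitive gap z) has_derivative (\<lambda>u. - fd (radial_primitive gap) z u)) (at z)"
    by (intro derivative_intros holomorphic_vec_has_derivative[OF radial_primitive_hol[OF gap_closed] zR])
  ultimately have "(\<lambda>u. interp t z *v DX u + fd (interp t) z u *v X) = (\<lambda>u. - fd (radial_primitive gap) z u)"
    by (rule has_derivative_unique)
  from fun_cong[OF this]
  have lin: "interp t z *v DX u = - fd (radial_primitive gap) z u - fd (interp t) z u *v X" for u
    by (simp add: eq_diff_eq)
  note sk = closed_form_skew[OF interp_closed zR]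
  have 1: "bil (interp t z) (DX u) v = dotc (fd (radial_primitive gap) z u) v + bil (fd (interp t) z u) v X"
    using skewD[OF sk, of t "DX u" v] dotc_commute[of "fd (interp t) z u *v X" v] unfolding lin
    by (simp add: dotc.diff_left dotc.minus_left algebra_simps)
  have 2: "bil (interp t z) u (DX v) = - dotc (fd (radial_primitive gap) z v) u - bil (fd (interp t) z v) u X"
    unfolding lin using dotc_commute[of u "fd (radial_primitive gap) z v"]
    by (simp add: dotc.diff_right dotc.minus_right)
  show ?thesis
    unfolding 1 2
    using radial_primitive_closed[OF gap_closed zR, of u v]
      closed_form_closed[OF interp_closed zR, where u = u and v = v and w = X, of t]
    by (simp add: algebra_simps)
qed

end

text \<open>The pullback of \<open>interp t\<close> along the flow at time \<open>t\<close> has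
  derivative 0 on \<open>{0..1}\<close>, and its values at the two ends are the two sides of the
  pullback identity. The Lipschitz bound is part of the result because injectivity is derived from
  it.\<close>

lemma moser:
  obtains r \<phi> where "0 < r" "r \<le> R" "holomorphic_vec (ball 0 r) \<phi>" "\<phi> 0 = 0"
    "\<And>z. z \<in> ball 0 r \<Longrightarrow> \<phi> z \<in> ball 0 R"
    "\<And>z. z \<in> ball 0 r \<Longrightarrow> det (M0 z) \<noteq> 0"
    "\<And>z w. z \<in> ball 0 r \<Longrightarrow> w \<in> ball 0 r \<Longrightarrow> norm ((\<phi> z - z) - (\<phi> w - w)) \<le> norm (z - w) / 2"
    "\<And>z u v. z \<in> ball 0 r \<Longrightarrow> bil (M1 (\<phi> z)) (fd \<phi> z u) (fd \<phi> z v) = bil (M0 z) u v"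
    "\<And>A z. (\<And>w. w \<in> ball 0 R \<Longrightarrow> A *v w \<in> ball 0 R \<Longrightarrow> transpose A ** M0 (A *v w) ** A = M0 w) \<Longrightarrow>
       (\<And>w. w \<in> ball 0 R \<Longrightarrow> A *v w \<in> ball 0 R \<Longrightarrow> transpose A ** M1 (A *v w) ** A = M1 w) \<Longrightarrow>
       z \<in> ball 0 r \<Longrightarrow> A *v z \<in> ball 0 r \<Longrightarrow> \<phi> (A *v z) = A *v \<phi> z"
proof -
  obtain r1 where r1: "0 < r1" "r1 \<le> R"
    "\<And>t z. t \<in> {0..1} \<Longrightarrow> z \<in> ball 0 r1 \<Longrightarrow> det (interp t z) \<noteq> 0"
    using det_interp_nonzero by blast
  obtain r2 where r2: "0 < r2" "r2 \<le> r1"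
    and lip: "\<And>t z w. t \<in> {0..1} \<Longrightarrow> z \<in> ball 0 r2 \<Longrightarrow> w \<in> ball 0 r2 \<Longrightarrow>
      norm (moser_field t z - moser_field t w) \<le> norm (z - w) / 4"
    using moser_field_lipschitz[OF r1] by blast
  have sub: "ball 0 r2 \<subseteq> ball 0 r1" "ball 0 r2 \<subseteq> (ball 0 R :: (complex ^ 'm) set)"
    using r1 r2 by auto
  let ?X = moser_field
  have Xc: "continuous_on ({0..1} \<times> ball 0 r2) (\<lambda>(t, z). ?X t z)"
    by (rule continuous_on_subset[OF moser_field_continuous[OF r1]]) (use sub in auto)
  have Xh: "\<And>t. t \<in> {0..1} \<Longrightarrow> holomorphic_vec (ball 0 r2) (?X t)"
    using holomorphic_vec_subset[OF moser_field_hol[OF r1] sub(1)] by blast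
  note asm = Xc Xh moser_field_0 lip r2(1)
  define \<phi> where "\<phi> = picard_lim ?X"
  let ?H = "ball 0 (r2 / 2) :: (complex ^ 'm) set"
  have fl_ball: "\<phi> t z \<in> ball 0 r2" if "t \<in> {0..1}" "z \<in> ?H" for t z
    unfolding \<phi>_def by (rule flow_ball[OF asm that])
  have fl_hol: "holomorphic_vec ?H (\<phi> t)" if "t \<in> {0..1}" for t
    unfolding \<phi>_def by (rule flow_hol[OF asm that])
  have fl_cont: "continuous_on ({0..1} \<times> ?H) (\<lambda>(t, z). \<phi> t z)"
    unfolding \<phi>_def by (rule flow_continuous[OF asm])
  have fl_eq: "\<phi> t z = z + integral {0..t} (\<lambda>s. ?X s (\<phi> s z))" if "t \<in> {0..1}" "z \<in> ?H" for t z
    unfolding \<phi>_def by (rule flow_equation[OF asm that])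
  have fl_fd: "fd (\<phi> t) z v = v + integral {0..t} (\<lambda>s. fd (?X s) (\<phi> s z) (fd (\<phi> s) z v))"
    if "t \<in> {0..1}" "z \<in> ?H" for t z v
    unfolding \<phi>_def by (rule flow_fd_equation[OF asm that])
  have main: "bil (M1 (\<phi> 1 z)) (fd (\<phi> 1) z u) (fd (\<phi> 1) z v) = bil (M0 z) u v" if z: "z \<in> ?H" for z u v
  proof -
    let ?U = "\<lambda>t v. fd (\<phi> t) z v"
    have pc: "continuous_on {0..1} (\<lambda>t. \<phi> t z)"
      by (rule continuous_on_slice[OF fl_cont z]) simp
    have Uc: "continuous_on {0..1} (\<lambda>t. ?U t v)" for v
      by (rule continuous_on_slice[OF continuous_on_fd_vec[OF fl_cont fl_hol open_ball] z]) simp_all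
    have Xpc: "continuous_on {0..1} (\<lambda>t. ?X t (\<phi> t z))"
      by (rule continuous_on_compose2[OF Xc, of "{0..1}" "\<lambda>t. (t, \<phi> t z)", simplified])
        (use fl_ball z in \<open>auto intro!: continuous_intros pc\<close>)
    have "continuous_on {0..1} (\<lambda>t. fd (?X t) (\<phi> t z) w)" for w
      by (rule continuous_on_compose2[OF continuous_on_fd_vec[OF Xc Xh open_ball], of "{0..1}" "\<lambda>t. (t, \<phi> t z)", simplified])
        (use fl_ball z in \<open>auto intro!: continuous_intros pc\<close>)
    \<comment> \<open>The direction \<open>?U t v\<close> moves with \<open>t\<close>; its expansion
      in coordinates leaves derivatives in fixed directions, which are known to be
      continuous.\<close>
    then have "continuous_on {0..1} (\<lambda>t. \<Sum>i\<in>UNIV. ?U t v $ i *s fd (?X t) (\<phi> t z) (axis i 1))" for v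
      by (intro continuous_intros Uc)
    then have DXc: "continuous_on {0..1} (\<lambda>t. fd (?X t) (\<phi> t z) (?U t v))" for v
      by (rule continuous_on_eq) (use holomorphic_fd_expand[OF Xh fl_ball] z in auto)
    have dp: "((\<lambda>t. \<phi> t z) has_derivative (\<lambda>h. h *\<^sub>R ?X t (\<phi> t z))) (at t within {0..1})"
      if t: "t \<in> {0..1}" for t
    proof -
      have "((\<lambda>t. z + integral {0..t} (\<lambda>s. ?X s (\<phi> s z))) has_derivative (\<lambda>h. 0 + h *\<^sub>R ?X t (\<phi> t z)))
          (at t within {0..1})"
        using integral_has_vector_derivative[OF Xpc t]
        unfolding has_vector_derivative_def by (intro has_derivative_add has_derivative_const)
      then show ?thesis
        by (rule has_derivative_transform[OF t, rotated 1, OF has_derivative_eq_rhs]) (use fl_eq z in auto)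
    qed
    have dU: "((\<lambda>t. ?U t v) has_derivative (\<lambda>h. h *\<^sub>R fd (?X t) (\<phi> t z) (?U t v))) (at t within {0..1})"
      if t: "t \<in> {0..1}" for t v
    proof -
      have "((\<lambda>t. v + integral {0..t} (\<lambda>s. fd (?X s) (\<phi> s z) (?U s v))) has_derivative
          (\<lambda>h. 0 + h *\<^sub>R fd (?X t) (\<phi> t z) (?U t v))) (at t within {0..1})"
        using integral_has_vector_derivative[OF DXc t]
        unfolding has_vector_derivative_def by (intro has_derivative_add has_derivative_const)
      then show ?thesis
        by (rule has_derivative_transform[OF t, rotated 1, OF has_derivative_eq_rhs]) (use fl_fd z in auto)
    qed
    have "((\<lambda>t. bil (interp t (\<phi> t z)) (?U t u) (?U t v)) has_derivative (\<lambda>h. 0)) (at t within {0..1})"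
      if t: "t \<in> {0..1}" for t
    proof -
      have w: "\<phi> t z \<in> ball 0 r1" "\<phi> t z \<in> ball 0 R" using subsetD[OF sub(1) fl_ball[OF t z]] subsetD[OF sub(2) fl_ball[OF t z]] by simp_all
      note dM = holomorphic_mat_has_derivative[OF closed_form_mat[OF M0] w(2)]
        and dg = holomorphic_mat_has_derivative[OF closed_form_mat[OF gap_closed] w(2)]
      have sc: "fd M0 (\<phi> t z) (h *\<^sub>R x) = h *\<^sub>R fd M0 (\<phi> t z) x"
        "fd gap (\<phi> t z) (h *\<^sub>R x) = h *\<^sub>R fd gap (\<phi> t z) x" for h x
        by (rule linear_scale[OF bounded_linear.linear[OF has_derivative_bounded_linear[OF dM]]],
            rule linear_scale[OF bounded_linear.linear[OF has_derivative_bounded_linear[OF dg]]])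
      have "((\<lambda>t. M0 (\<phi> t z) + t *\<^sub>R gap (\<phi> t z)) has_derivative
          (\<lambda>h. h *\<^sub>R (fd (interp t) (\<phi> t z) (?X t (\<phi> t z)) + gap (\<phi> t z)))) (at t within {0..1})"
        using has_derivative_compose[OF dp[OF t] dM] has_derivative_compose[OF dp[OF t] dg]
        by (auto intro!: derivative_eq_intros simp: sc interp_fd[OF w(2)] algebra_simps)
      then have "((\<lambda>t. interp t (\<phi> t z)) has_derivative
          (\<lambda>h. h *\<^sub>R (fd (interp t) (\<phi> t z) (?X t (\<phi> t z)) + gap (\<phi> t z)))) (at t within {0..1})"
        by (simp add: interp_def[abs_def])
      from has_derivative_dotc[OF dU[OF t] has_derivative_matvec[OF this dU[OF t]]]
      have "((\<lambda>t. bil (interp t (\<phi> t z)) (?U t u) (?U t v)) has_derivative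
        (\<lambda>h. h *\<^sub>R (bil (fd (interp t) (\<phi> t z) (?X t (\<phi> t z))) (?U t u) (?U t v) + bil (gap (\<phi> t z)) (?U t u) (?U t v)
          + bil (interp t (\<phi> t z)) (fd (?X t) (\<phi> t z) (?U t u)) (?U t v)
          + bil (interp t (\<phi> t z)) (?U t u) (fd (?X t) (\<phi> t z) (?U t v))))) (at t within {0..1})"
        by (rule has_derivative_eq_rhs)
          (simp add: fun_eq_iff matvec.scaleR_left matvec.scaleR_right matvec.add_left dotc.add_right
            dotc.scaleR_left dotc.scaleR_right scaleR_add_right)
      then show ?thesis
        by (simp only: moser_lie_identity[OF r1 t w(1)] scaleR_zero_right)
    qed
    then have "bil (interp 1 (\<phi> 1 z)) (?U 1 u) (?U 1 v) = bil (interp 0 (\<phi> 0 z)) (?U 0 u) (?U 0 v)"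
      by (intro has_derivative_zero_unique[where s = "{0..1::real}"
            and f = "\<lambda>t. bil (interp t (\<phi> t z)) (?U t u) (?U t v)"]) auto
    moreover have "\<phi> 0 z = z" "?U 0 w = w" for w
      using fl_eq[OF _ z, of 0] fl_fd[OF _ z, of 0 w] by simp_all
    ultimately show ?thesis by (simp add: interp_def gap_def)
  qed
  show thesis
  proof (rule that[of "r2 / 2" "\<phi> 1"])
    show "0 < r2 / 2" "r2 / 2 \<le> R" using r1 r2 by auto
    show "holomorphic_vec ?H (\<phi> 1)" by (rule fl_hol) simp
    have "norm (\<phi> 1 0 - 0) \<le> norm (0 :: complex ^ 'm)"
      unfolding \<phi>_def by (rule flow_near[OF asm]) (use r2 in auto)
    then show "\<phi> 1 0 = 0" by simp
    show "\<phi> 1 z \<in> ball 0 R" if "z \<in> ?H" for z using fl_ball[OF _ that, of 1] sub by auto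
    show "det (M0 z) \<noteq> 0" if "z \<in> ?H" for z
      using r1(3)[of 0 z] that r2 by (simp add: interp_def)
    have one: "(1 :: real) \<in> {0..1}" by simp
    show "norm ((\<phi> 1 z - z) - (\<phi> 1 w - w)) \<le> norm (z - w) / 2" if "z \<in> ?H" "w \<in> ?H" for z w
      unfolding \<phi>_def by (rule flow_lip[OF asm one that])
    show "\<phi> 1 (A *v z) = A *v \<phi> 1 z"
      if A0: "\<And>w. w \<in> ball 0 R \<Longrightarrow> A *v w \<in> ball 0 R \<Longrightarrow> transpose A ** M0 (A *v w) ** A = M0 w"
        and A1: "\<And>w. w \<in> ball 0 R \<Longrightarrow> A *v w \<in> ball 0 R \<Longrightarrow> transpose A ** M1 (A *v w) ** A = M1 w"
        and "z \<in> ?H" "A *v z \<in> ?H" for A z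
      unfolding \<phi>_def
    proof (rule flow_equivariant[OF asm _ one that(3,4)])
      fix t :: real and w assume "t \<in> {0..1}" "w \<in> ball 0 r2" "A *v w \<in> ball 0 r2"
      then show "?X t (A *v w) = A *v ?X t w"
        using moser_field_equivariant[OF r1 A0 A1, of t w] sub by blast
    qed
  qed (rule main)
qed

end

section \<open>Square roots of matrices\<close>

lemma matrix_mult_add_left: "(B + C) ** A = B ** A + C ** A"
  for A :: "'a::semiring_1 ^ 'p::finite ^ 'n::finite"
  by (vector matrix_matrix_mult_def sum.distrib distrib_right)

lemma mat_mult_left: "(mat c ** A) $ i $ j = c * A $ i $ j" for A :: "complex ^ 'n::finite ^ 'n"
  by (simp add: matrix_matrix_mult_def mat_def if_distrib[of "\<lambda>x. x * _"] cong: if_cong)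

lemma mat_mult_right: "(A ** mat c) $ i $ j = c * A $ i $ j" for A :: "complex ^ 'n::finite ^ 'n"
  by (simp add: matrix_matrix_mult_def mat_def if_distrib[of "\<lambda>x. _ * x"] mult.commute cong: if_cong)

lemma mat_commute: "A ** mat c = mat c ** A" for A :: "complex ^ 'n::finite ^ 'n"
  by (simp add: vec_eq_iff mat_mult_left mat_mult_right)

lemma mat_add: "mat (a + b) = (mat a + mat b :: complex ^ 'n ^ 'n)"
  by (simp add: vec_eq_iff mat_def)

lemma mat_mult: "mat (a * b) = (mat a ** mat b :: complex ^ 'n::finite ^ 'n)"
  by (simp add: vec_eq_iff mat_mult_left) (simp add: mat_def)

section \<open>Polynomials in a matrix\<close>

definition matpoly :: "complex poly \<Rightarrow> complex ^ 'n ^ 'n \<Rightarrow> complex ^ 'n ^ 'n::finite" where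
  "matpoly p A = fold_coeffs (\<lambda>a M. mat a + A ** M) p 0"

lemma matpoly_0 [simp]: "matpoly 0 A = 0"
  by (simp add: matpoly_def)

lemma matpoly_pCons [simp]: "matpoly (pCons a p) A = mat a + A ** matpoly p A"
  by (cases "a = 0 \<and> p = 0") (auto simp: matpoly_def fold_coeffs_pCons_not_0_0_eq
      fold_coeffs_pCons_coeff_not_0_eq mat_0)

lemma matpoly_add: "matpoly (p + q) A = matpoly p A + matpoly q A"
  by (induction p q rule: poly_induct2) (simp_all add: mat_add matrix_add_ldistrib)

lemma matpoly_smult: "matpoly (smult c p) A = mat c ** matpoly p A"
proof (induction p)
  case (pCons a p)
  have "A ** (mat c ** matpoly p A) = mat c ** (A ** matpoly p A)"
    by (simp add: matrix_mul_assoc mat_commute)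
  then show ?case by (simp add: pCons mat_mult matrix_add_ldistrib)
qed simp

lemma matpoly_mult: "matpoly (p * q) A = matpoly p A ** matpoly q A"
  by (induction p)
    (simp_all add: matpoly_add matpoly_smult matrix_mult_add_left matrix_mul_assoc mat_0)

lemma matpoly_commute:
  assumes "B ** A = A ** B" shows "B ** matpoly p A = matpoly p A ** B"
proof (induction p)
  case (pCons a p)
  have "B ** (A ** matpoly p A) = A ** matpoly p A ** B"
    by (metis assms matrix_mul_assoc pCons.IH)
  then show ?case by (simp add: matrix_add_ldistrib matrix_mult_add_left mat_commute)
qed simp

text \<open>Self-adjointness with respect to the bilinear form of \<open>K\<close> passes from a
  matrix to its polynomials. Thanks to this a square root can be used as a congruence.\<close>

lemma matpoly_transpose:
  assumes "transpose A ** K = K ** A" shows "transpose (matpoly p A) ** K = K ** matpoly p A"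
proof (induction p)
  case (pCons a p)
  have "transpose (A ** matpoly p A) ** K = K ** (A ** matpoly p A)"
    using matpoly_commute[of A A p] assms pCons.IH
    by (metis matrix_mul_assoc matrix_transpose_mul)
  then show ?case
    by (simp add: transpose_add matrix_add_ldistrib matrix_mult_add_left mat_commute)
qed (simp add: transpose_def vec_eq_iff matrix_matrix_mult_def)

lemma matpoly_scaleR: "mat (of_real r) ** A = r *\<^sub>R A" for A :: "complex ^ 'n::finite ^ 'n"
  by (simp add: vec_eq_iff mat_mult_left complex_scaleR)

lemma matpoly_sum: "matpoly (\<Sum>i\<in>I. f i) A = (\<Sum>i\<in>I. matpoly (f i) A)"
  by (induction I rule: infinite_finite_induct) (simp_all add: matpoly_add)

text \<open>There are \<open>N + 1\<close> powers up to the exponent \<open>N\<close>, the real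
  dimension of the matrix space, so they satisfy a real linear relation. Repeated powers are treated
  apart because linear dependence is a property of a set and does not see repetitions.\<close>

lemma annihilating_poly: "\<exists>p. p \<noteq> 0 \<and> matpoly p A = (0 :: complex ^ 'n::finite ^ 'n)"
proof -
  define f where "f i = matpoly (monom 1 i) A" for i :: nat
  let ?N = "DIM(complex ^ 'n ^ 'n)"
  show ?thesis
  proof (cases "inj_on f {..?N}")
    case True
    then have "card (f ` {..?N}) = ?N + 1" by (simp add: card_image)
    then have "dependent (f ` {..?N})" by (intro dependent_biggerset) simp
    then obtain u where u: "(\<Sum>v\<in>f ` {..?N}. u v *\<^sub>R v) = 0" "\<exists>v\<in>f ` {..?N}. u v \<noteq> 0"
      by (subst (asm) dependent_finite) auto
    define p where "p = (\<Sum>i\<le>?N. smult (complex_of_real (u (f i))) (monom 1 i))"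
    have "matpoly p A = (\<Sum>i\<le>?N. u (f i) *\<^sub>R f i)"
      by (simp only: p_def matpoly_sum matpoly_smult matpoly_scaleR f_def)
    also have "\<dots> = 0" using u(1) unfolding sum.reindex[OF True] o_def .
    finally have "matpoly p A = 0" .
    moreover obtain i where i: "i \<le> ?N" "u (f i) \<noteq> 0" using u(2) by auto
    then have "coeff p i = of_real (u (f i))"
      by (simp add: p_def coeff_sum if_distrib[of "\<lambda>x. _ * x"] cong: if_cong)
    then have "p \<noteq> 0" using i by auto
    ultimately show ?thesis by blast
  next
    case False
    then obtain i j where "i \<noteq> j" "f i = f j" unfolding inj_on_def by blast
    then have "coeff (monom 1 i + smult (-1) (monom 1 j)) i = (1 :: complex)"
      by simp
    then have "monom 1 i + smult (-1) (monom 1 j) \<noteq> (0 :: complex poly)" by (metis coeff_0 zero_neq_one)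
    moreover have "matpoly (monom 1 i + smult (-1) (monom 1 j)) A = 0"
      using \<open>f i = f j\<close> matpoly_scaleR[of "-1" "f j"]
      by (simp only: matpoly_add matpoly_smult f_def) simp
    ultimately show ?thesis by blast
  qed
qed

text \<open>As \<open>A\<close> is invertible, factors of the variable can be cancelled from an
  annihilating polynomial until its constant term is nonzero.\<close>

lemma annihilating_poly_nonzero:
  fixes A :: "complex ^ 'n::finite ^ 'n"
  assumes "det A \<noteq> 0"
  shows "\<exists>p. poly p 0 \<noteq> 0 \<and> matpoly p A = 0"
proof -
  have "p \<noteq> 0 \<Longrightarrow> matpoly p A = 0 \<Longrightarrow> \<exists>p. poly p 0 \<noteq> 0 \<and> matpoly p A = 0" for p :: "complex poly"
  proof (induction p)
    case (pCons a p)
    show ?case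
    proof (cases "a = 0")
      case True
      with pCons.prems have "A ** matpoly p A = 0" "p \<noteq> 0" by (auto simp: mat_0)
      then have "A *v (matpoly p A *v x) = A *v 0" for x
        by (simp add: matrix_vector_mul_assoc matvec.zero_left matvec.zero_right)
      then have "matpoly p A *v x = 0" for x
        using matvec_cancel[OF assms] by blast
      then have "matpoly p A = 0" by (simp add: matrix_eq matvec.zero_left)
      with pCons.IH \<open>p \<noteq> 0\<close> show ?thesis by blast
    next
      case False
      with pCons.prems show ?thesis by (intro exI[of _ "pCons a p"]) simp
    qed
  qed simp
  with annihilating_poly show ?thesis by blast
qed

text \<open>One root \<^term>\<open>a\<close> at a time: \<^term>\<open>q + smult c P\<close> is again a square root of the variable modulo
  \<^term>\<open>P\<close>, and \<^term>\<open>c\<close> is chosen as a root of a quadratic equation to gain the factor of \<^term>\<open>a\<close>.\<close>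

lemma sqrt_modulo_poly:
  fixes P :: "complex poly"
  assumes "poly P 0 \<noteq> 0"
  shows "\<exists>q r. q * q - [:0, 1:] = P * r"
  using assms
proof (induction "degree P" arbitrary: P)
  case 0
  then obtain c where "P = [:c:]" "c \<noteq> 0" by (metis degree_0_id poly_const_conv poly_pCons mult_zero_left add_0_right)
  then have "0 * 0 - [:0, 1:] = P * smult (1 / c) (- [:0, 1:])" by simp
  then show ?case by blast
next
  case (Suc n)
  then have "\<not> constant (poly P)" by (simp add: constant_degree)
  then obtain a where "poly P a = 0" using fundamental_theorem_of_algebra by blast
  then obtain P' where P: "P = [:- a, 1:] * P'" by (auto simp: poly_eq_0_iff_dvd elim: dvdE)
  have "P' \<noteq> 0" using Suc.hyps P by auto
  then have "degree P = Suc (degree P')" unfolding P by (subst degree_mult_eq) auto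
  with Suc.hyps have "n = degree P'" by simp
  moreover have "a \<noteq> 0" "poly P' 0 \<noteq> 0" using Suc.prems P by auto
  ultimately obtain q r where qr: "q * q - [:0, 1:] = P' * r" using Suc.hyps(1) by blast
  have qra: "poly q a * poly q a - a = poly P' a * poly r a"
    using arg_cong[OF qr, of "\<lambda>p. poly p a"] by simp
  have "\<exists>c. poly r a + 2 * c * poly q a + c * c * poly P' a = 0"
  proof (cases "poly P' a = 0")
    case True
    \<comment> \<open>The equation for \<open>c\<close> degenerates to a linear one; it stays
      solvable because the square of \<open>poly q a\<close> is then the nonzero root
      \<open>a\<close>.\<close>
    then have "poly q a \<noteq> 0" using qra \<open>a \<noteq> 0\<close> by auto
    then show ?thesis using True by (intro exI[of _ "- poly r a / (2 * poly q a)"]) simp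
  next
    case False
    \<comment> \<open>A square root of the discriminant, which by \<open>qra\<close> equals
      \<open>a\<close>. With \<open>c = (d - poly q a) / poly P' a\<close> the corrected polynomial
      takes the value \<open>d\<close> at \<open>a\<close>.\<close>
    define d where "d = csqrt (poly q a * poly q a - poly P' a * poly r a)"
    have "d * d = poly q a * poly q a - poly P' a * poly r a"
      by (simp add: d_def flip: power2_eq_square)
    then have "poly P' a * poly r a + 2 * (d - poly q a) * poly q a + (d - poly q a) * (d - poly q a) = 0"
      by (simp add: algebra_simps)
    moreover have "poly r a + 2 * ((d - poly q a) / poly P' a) * poly q a
        + ((d - poly q a) / poly P' a) * ((d - poly q a) / poly P' a) * poly P' a
      = (poly P' a * poly r a + 2 * (d - poly q a) * poly q a + (d - poly q a) * (d - poly q a)) / poly P' a"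
      using False by (simp add: add_divide_distrib)
    ultimately have "poly r a + 2 * ((d - poly q a) / poly P' a) * poly q a
        + ((d - poly q a) / poly P' a) * ((d - poly q a) / poly P' a) * poly P' a = 0"
      by simp
    then show ?thesis by blast
  qed
  then obtain c where c: "poly r a + 2 * c * poly q a + c * c * poly P' a = 0" by blast
  define s where "s = r + smult (2 * c) q + smult (c * c) P'"
  have "poly s a = 0" using c by (simp add: s_def)
  then obtain s' where s': "s = [:- a, 1:] * s'" by (auto simp: poly_eq_0_iff_dvd elim: dvdE)
  have "(q + smult c P') * (q + smult c P') - [:0, 1:] = P' * s"
  proof -
    \<comment> \<open>Scalar multiples are rewritten as products with a constant polynomial, so that
      the ring laws alone do the computation.\<close>
    define k where "k = [:c:]"
    have 1: "smult c X = k * X" for X by (simp add: k_def)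
    have 2: "smult (2 * c) X = k * X + k * X" for X by (simp only: mult_2 smult_add_left 1)
    have 3: "smult (c * c) X = k * (k * X)" for X by (simp only: smult_smult[symmetric] 1)
    have "(q + k * P') * (q + k * P') - [:0, 1:]
        = (q * q - [:0, 1:]) + P' * ((k * q + k * q) + k * (k * P'))"
      by (simp only: ring_distribs mult_ac) simp
    also have "\<dots> = P' * (r + (k * q + k * q) + k * (k * P'))"
      unfolding qr by (simp only: ring_distribs add_ac)
    finally show ?thesis unfolding s_def 1 2 3 .
  qed
  also have "\<dots> = P * s'" unfolding s' P by (simp only: mult_ac)
  finally show ?case by blast
qed

lemma matrix_sqrt:
  fixes A :: "complex ^ 'n::finite ^ 'n"
  assumes "det A \<noteq> 0"
  obtains q where "matpoly q A ** matpoly q A = A"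
proof -
  obtain P where P: "poly P 0 \<noteq> 0" "matpoly P A = 0" using annihilating_poly_nonzero[OF assms] by blast
  then obtain q r where "q * q - [:0, 1:] = P * r" using sqrt_modulo_poly by blast
  then have "q * q = [:0, 1:] + P * r" by (simp add: algebra_simps)
  then have "matpoly (q * q) A = matpoly ([:0, 1:] + P * r) A" by simp
  then have "matpoly q A ** matpoly q A = A"
    by (simp add: matpoly_mult matpoly_add P mat_0)
  then show thesis by (rule that)
qed

text \<open>The comparing endomorphism \<open>A\<close> with \<open>L ** A = K\<close> is
  self-adjoint for \<open>L\<close> because both matrices are skew. A polynomial square root
  \<open>B\<close> therefore moves across \<open>L\<close>:
  \<open>transpose B ** L ** B = L ** B ** B = L ** A = K\<close>. A matrix preserving both forms
  commutes with \<open>A\<close>, hence with \<open>B\<close>.\<close>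

lemma equivariant_linear_equivalence:
  fixes K L :: "complex ^ 'n::finite ^ 'n"
  assumes "skew K" "skew L" "det K \<noteq> 0" "det L \<noteq> 0"
  obtains B where "transpose B ** L ** B = K" "det B \<noteq> 0"
    "\<And>g. transpose g ** K ** g = K \<Longrightarrow> transpose g ** L ** g = L \<Longrightarrow> g ** B = B ** g"
proof -
  obtain L' where L': "L ** L' = mat 1"
    using \<open>det L \<noteq> 0\<close> invertible_det_nz unfolding invertible_def by blast
  define A where "A = L' ** K"
  have LA: "L ** A = K" by (simp add: A_def matrix_mul_assoc L')
  then have detA: "det A \<noteq> 0" using \<open>det K \<noteq> 0\<close> by (metis det_mul mult_zero_right)
  then obtain q where q: "matpoly q A ** matpoly q A = A" using matrix_sqrt by blast
  define B where "B = matpoly q A"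
  have neg: "M ** - N = - (M ** N)" for M N :: "complex ^ 'n ^ 'n"
    by (simp add: vec_eq_iff matrix_matrix_mult_def sum_negf)
  have "transpose A ** transpose L = transpose K" by (metis LA matrix_transpose_mul)
  then have "- (transpose A ** L) = - K" using assms(1,2) by (simp add: skew_def neg)
  then have "transpose A ** L = L ** A" using LA by simp
  then have BL: "transpose B ** L = L ** B" unfolding B_def by (rule matpoly_transpose)
  show thesis
  proof (rule that[of B])
    have "L ** B ** B = L ** A" unfolding matrix_mul_assoc[symmetric] by (simp only: B_def q)
    then show "transpose B ** L ** B = K" by (simp only: BL LA)
    show "det B \<noteq> 0" using detA q by (metis B_def det_mul mult_zero_right)
    fix g :: "complex ^ 'n ^ 'n" assume g: "transpose g ** K ** g = K" "transpose g ** L ** g = L"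
    have "det (transpose g ** L) * det g = det L" using g(2) by (metis det_mul)
    then have nz: "det (transpose g ** L) \<noteq> 0" using \<open>det L \<noteq> 0\<close> by auto
    have "(transpose g ** L) ** (g ** A) = K" using g(2) LA by (simp add: matrix_mul_assoc)
    moreover have "(transpose g ** L) ** (A ** g) = K"
      using g(1) LA by (metis matrix_mul_assoc)
    ultimately have "(transpose g ** L) *v ((g ** A) *v x) = (transpose g ** L) *v ((A ** g) *v x)" for x
      by (simp only: matrix_vector_mul_assoc)
    then have "g ** A = A ** g" using matvec_cancel[OF nz] by (simp add: matrix_eq)
    then show "g ** B = B ** g" unfolding B_def by (rule matpoly_commute)
  qed
qed

section \<open>Extension across the points with nontrivial stabilizer\<close>

lemma Sp_iff: "A \<in> carrier Sp \<longleftrightarrow> transpose A ** sympl_matrix ** A = sympl_matrix"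
  by (simp add: Sp_def)

lemma skew_sympl_matrix: "skew sympl_matrix"
  unfolding skew_def by (auto simp: vec_eq_iff transpose_def sympl_matrix_def split: sum.splits)

lemma sympl_matrix_nondegenerate:
  assumes "\<And>u. bil sympl_matrix w u = 0" shows "w = 0"
proof -
  have "dotc (sympl_matrix *v w) u = 0" for u
    using skewD[OF skew_sympl_matrix, of w u] assms[of u] by simp
  then have "sympl_matrix *v w = 0"
    by (intro dotc_eqI) (simp add: dotc_commute dotc.zero_left dotc.zero_right)
  then have "(sympl_matrix ** sympl_matrix) *v w = 0"
    by (simp add: matrix_vector_mul_assoc[symmetric] matvec.zero_right)
  then show ?thesis by (simp add: sympl_matrix_square matvec.minus_left)
qed

lemma negligible_proper_subspace:
  fixes S :: "'a::euclidean_space set"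
  assumes "subspace S" "S \<noteq> UNIV" shows "negligible S"
proof (rule negligible_lowdim)
  have "dim S \<noteq> DIM('a)" using assms dim_eq_full[of S] by (metis span_eq_iff)
  then show "dim S < DIM('a)" using dim_subset_UNIV[of S] by linarith
qed

lemma holomorphic_vec_fd_continuous:
  fixes f :: "complex ^ 'm::finite \<Rightarrow> complex ^ 'k::finite"
  assumes "holomorphic_vec U f" shows "continuous_on U (\<lambda>z. fd f z u)"
proof -
  \<comment> \<open>A one-point parameter set makes the version with parameters applicable.\<close>
  have "continuous_on ({0::real} \<times> U) (\<lambda>(t, z). fd f z u)"
    by (rule continuous_on_fd_vec)
      (auto simp: case_prod_beta assms holomorphic_vec_open[OF assms]
        intro!: continuous_on_compose2[OF holomorphic_vec_continuous_on[OF assms]] continuous_on_snd)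
  then show ?thesis
    by (intro continuous_on_compose2[where f = "\<lambda>z. (0, z)" and s = U
            and g = "\<lambda>(t, z). fd f z u", simplified])
      (auto intro!: continuous_intros)
qed

lemma holomorphic_mat_fd_continuous:
  fixes M :: "complex ^ 'm::finite \<Rightarrow> complex ^ 'k::finite ^ 'l::finite"
  assumes "holomorphic_mat U M" shows "continuous_on U (\<lambda>z. fd M z u)"
  unfolding continuous_on_vec_nth_iff[of U "\<lambda>z. fd M z u"]
proof
  fix i
  have "continuous_on U (\<lambda>z. fd (\<lambda>z. M z $ i) z u)"
    using assms by (simp add: holomorphic_mat_def holomorphic_vec_fd_continuous)
  then show "continuous_on U (\<lambda>z. fd M z u $ i)"
  proof (rule continuous_on_eq)
    fix z assume "z \<in> U"
    then have "((\<lambda>z. M z $ i) has_derivative (\<lambda>h. fd M z h $ i)) (at z)"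
      using holomorphic_mat_has_derivative[OF assms] has_derivative_vec_iff by blast
    then show "fd (\<lambda>z. M z $ i) z u = fd M z u $ i" by (simp add: fd_eq)
  qed
qed

section \<open>Finite symplectic groups and points with trivial stabilizer\<close>

locale finite_Sp =
  fixes G :: "(complex ^ ('n::finite + 'n) ^ ('n + 'n)) set"
  assumes subgroup: "subgroup G Sp" and finite: "finite G"
begin

lemma one_mem: "mat 1 \<in> G"
  using subgroup.one_closed[OF subgroup] by (simp add: Sp_def)

lemma mult_mem: "A \<in> G \<Longrightarrow> B \<in> G \<Longrightarrow> A ** B \<in> G"
  using subgroup.m_closed[OF subgroup] by (simp add: Sp_def)

lemma sympl: "A \<in> G \<Longrightarrow> transpose A ** sympl_matrix ** A = sympl_matrix"
  using subgroup.mem_carrier[OF subgroup] by (simp add: Sp_iff)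

lemma inverse_mem:
  assumes "A \<in> G" obtains B where "B \<in> G" "B ** A = mat 1" "A ** B = mat 1"
proof -
  have A: "A \<in> carrier Sp" by (rule subgroup.mem_carrier[OF subgroup assms])
  let ?B = "inv\<^bsub>Sp\<^esub> A"
  have "?B \<in> G" using subgroup.m_inv_closed[OF subgroup assms] .
  moreover have "?B \<otimes>\<^bsub>Sp\<^esub> A = \<one>\<^bsub>Sp\<^esub>" "A \<otimes>\<^bsub>Sp\<^esub> ?B = \<one>\<^bsub>Sp\<^esub>"
    using group.l_inv[OF group_Sp A] group.r_inv[OF group_Sp A] by auto
  ultimately show thesis by (intro that[of ?B]) (simp_all add: Sp_def)
qed

definition free :: "(complex ^ ('n + 'n)) set" where
  "free = {z. \<forall>A\<in>G. A *v z = z \<longrightarrow> A = mat 1}"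

lemma free_invariant:
  assumes "A \<in> G" "z \<in> free" shows "A *v z \<in> free"
  unfolding free_def
proof (intro CollectI ballI impI)
  fix B assume B: "B \<in> G" "B *v (A *v z) = A *v z"
  obtain A' where A': "A' \<in> G" "A' ** A = mat 1" "A ** A' = mat 1" using inverse_mem[OF assms(1)] by blast
  have "(A' ** B ** A) *v z = (A' ** A) *v z"
    using B(2) by (simp add: matrix_vector_mul_assoc[symmetric])
  then have "A' ** B ** A = mat 1"
    using assms(2) A' B(1) assms(1) mult_mem unfolding free_def by auto
  then have "A ** (A' ** B ** A) ** A' = A ** A'" by (simp add: A')
  then show "B = mat 1"
    using A'(3) by (simp add: matrix_mul_assoc) (metis A'(3) matrix_mul_assoc matrix_mul_rid)
qed

text \<open>The fixed space of a nontrivial element has complex codimension at least two: if it were a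
  hyperplane, the image of \<^term>\<open>A - mat 1\<close> would be the line orthogonal to it, which lies inside the
  hyperplane, so that \<^term>\<open>A\<close> would be unipotent of infinite order.\<close>

lemma fixed_space_plus_line:
  assumes A: "A \<in> G" "A \<noteq> mat 1"
  shows "{z + \<zeta> *s v |z \<zeta>. A *v z = z} \<noteq> UNIV"
proof
  assume all: "{z + \<zeta> *s v |z \<zeta>. A *v z = z} = UNIV"
  define w where "w = A *v v - v"
  have inv: "bil sympl_matrix (A *v x) (A *v y) = bil sympl_matrix x y" for x y
    unfolding bil_mult using sympl[OF A(1)] by simp
  \<comment> \<open>Since \<open>h\<close> is fixed, invariance says that \<open>A *v v\<close> and
    \<open>v\<close> pair equally with \<open>h\<close>; the displacement \<open>w\<close> is thus
    orthogonal to the fixed space.\<close>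
  have fix_w: "bil sympl_matrix w h = 0" if "A *v h = h" for h
    using inv[of v h] that by (simp add: w_def dotc.diff_left)
  obtain h \<zeta> where h: "A *v h = h" "w = h + \<zeta> *s v" using all by blast
  have "w = 0"
  proof (cases "\<zeta> = 0")
    case True
    then have Aw: "A *v w = w" using h by simp
    have Av: "A *v v = v + w" by (simp add: w_def)
    \<comment> \<open>These are the images of \<open>v\<close> under the powers of \<open>A\<close>;
      they lie in a finite orbit, so two of them coincide and \<open>w\<close> must vanish.\<close>
    define x where "x k = v + of_nat k *s w" for k :: nat
    have "\<exists>B\<in>G. B *v v = x k" for k
    proof (induction k)
      case 0
      show ?case using one_mem by (intro bexI[of _ "mat 1"]) (simp_all add: x_def)
    next
      case (Suc k)
      then obtain B where B: "B \<in> G" "B *v v = x k" by blast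
      have "(A ** B) *v v = x (Suc k)"
        using B(2) Av Aw
        by (simp add: matrix_vector_mul_assoc[symmetric] x_def matrix_vector_right_distrib vscale_right
            vector_sadd_rdistrib algebra_simps)
      then show ?case using mult_mem[OF A(1) B(1)] by blast
    qed
    then have "x k \<in> (\<lambda>B. B *v v) ` G" for k unfolding image_iff by metis
    then have "range x \<subseteq> (\<lambda>B. B *v v) ` G" by blast
    then have "finite (range x)" using finite by (meson finite_imageI finite_subset)
    then obtain i j where ij: "i \<noteq> j" "x i = x j" using finite_imageD injI infinite_UNIV_nat by metis
    then have "(of_nat i - of_nat j :: complex) *s w = 0"
      by (simp add: x_def vector_sub_rdistrib)
    then show ?thesis using ij(1) by simp
  next
    case False
    \<comment> \<open>\<open>w\<close> is orthogonal to itself and to the fixed space, hence to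
      \<open>v\<close> as \<open>\<zeta>\<close> is nonzero, hence to every vector.\<close>
    have "bil sympl_matrix w w = 0" using skew_bil[OF skew_sympl_matrix, of w w] by simp
    moreover have "bil sympl_matrix w w = bil sympl_matrix w (h + \<zeta> *s v)"
      using arg_cong[OF h(2), of "bil sympl_matrix w"] .
    ultimately have "\<zeta> * bil sympl_matrix w v = 0"
      using fix_w[OF h(1)] by (simp only: matrix_vector_right_distrib vscale_right dotc.add_right dotc_vscale add_0)
    then have wv: "bil sympl_matrix w v = 0" using False by simp
    have "bil sympl_matrix w u = 0" for u
    proof -
      obtain h' \<zeta>' where "A *v h' = h'" "u = h' + \<zeta>' *s v" using all by blast
      then show ?thesis using fix_w[of h'] wv
        by (simp add: matrix_vector_right_distrib vscale_right dotc.add_right dotc_vscale)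
    qed
    then show ?thesis by (rule sympl_matrix_nondegenerate)
  qed
  then have "A *v v = v" by (simp add: w_def)
  have "A *v u = mat 1 *v u" for u
  proof -
    obtain h' \<zeta>' where "A *v h' = h'" "u = h' + \<zeta>' *s v" using all by blast
    then show ?thesis using \<open>A *v v = v\<close> by (simp add: matrix_vector_right_distrib vscale_right)
  qed
  then show False using A(2) by (simp add: matrix_eq)
qed

text \<open>Codimension two is used here: a nontrivial fixed space enlarged by the direction
  \<open>v\<close> is still a proper subspace. For almost every base point, the whole line in
  direction \<open>v\<close> therefore consists of points with trivial stabilizer.\<close>

lemma negligible_fixed_plus_line:
  "negligible (\<Union>A\<in>G - {mat 1}. {z + \<zeta> *s v |z \<zeta>. A *v z = z})"
proof (rule negligible_Union)
  fix T assume "T \<in> (\<lambda>A. {z + \<zeta> *s v |z \<zeta>. A *v z = z}) ` (G - {mat 1})"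
  then obtain A where A: "A \<in> G" "A \<noteq> mat 1" "T = {z + \<zeta> *s v |z \<zeta>. A *v z = z}" by blast
  have "subspace T"
    unfolding A(3) subspace_def
  proof (intro conjI ballI allI)
    show "0 \<in> {z + \<zeta> *s v |z \<zeta>. A *v z = z}"
      by (intro CollectI exI[of _ 0] conjI) (simp_all add: matvec.zero_right)
    fix x assume "x \<in> {z + \<zeta> *s v |z \<zeta>. A *v z = z}"
    then obtain z \<zeta> where x: "x = z + \<zeta> *s v" "A *v z = z" by blast
    show "c *\<^sub>R x \<in> {z + \<zeta> *s v |z \<zeta>. A *v z = z}" for c
      by (intro CollectI exI[of _ "c *\<^sub>R z"] exI[of _ "of_real c * \<zeta>"])
        (simp add: x vscale_right scaleR_add_right scaleR_eq_vscale)
    fix y assume "y \<in> {z + \<zeta> *s v |z \<zeta>. A *v z = z}"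
    then obtain z' \<zeta>' where y: "y = z' + \<zeta>' *s v" "A *v z' = z'" by blast
    show "x + y \<in> {z + \<zeta> *s v |z \<zeta>. A *v z = z}"
      by (intro CollectI exI[of _ "z + z'"] exI[of _ "\<zeta> + \<zeta>'"])
        (simp add: x y matrix_vector_right_distrib vector_sadd_rdistrib)
  qed
  then show "negligible T"
    using negligible_proper_subspace fixed_space_plus_line A by blast
qed (simp add: finite)

lemma not_free_subset: "- free \<subseteq> (\<Union>A\<in>G - {mat 1}. {z + \<zeta> *s v |z \<zeta>. A *v z = z})"
proof
  fix z assume "z \<in> - free"
  then obtain A where A: "A \<in> G - {mat 1}" "A *v z = z" by (auto simp: free_def)
  then have "z \<in> {z + \<zeta> *s v |z \<zeta>. A *v z = z}"
    by (intro CollectI exI[of _ z] exI[of _ 0]) simp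
  then show "z \<in> (\<Union>A\<in>G - {mat 1}. {z + \<zeta> *s v |z \<zeta>. A *v z = z})" using A(1) by blast
qed

lemma negligible_not_free: "negligible (- free)"
  by (rule negligible_subset[OF negligible_fixed_plus_line[of 0] not_free_subset])

lemma open_free: "open free"
proof -
  have "free = (\<Inter>A\<in>G - {mat 1}. {z. A *v z \<noteq> z})" by (auto simp: free_def)
  moreover have "open {z. A *v z \<noteq> z}" for A :: "complex ^ ('n + 'n) ^ ('n + 'n)"
    by (intro open_Collect_neq continuous_on_matvec continuous_on_const continuous_on_id)
  ultimately show ?thesis using finite by (auto intro!: open_INT)
qed

text \<open>The set where the functions differ is open and contained in a null set, hence
  empty.\<close>

lemma eq_by_density:
  fixes f g :: "complex ^ ('n + 'n) \<Rightarrow> 'b::t2_space"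
  assumes "open U" "continuous_on U f" "continuous_on U g"
    and N: "negligible N" and eq: "\<And>z. z \<in> U \<Longrightarrow> z \<notin> N \<Longrightarrow> f z = g z" and z: "z \<in> U"
  shows "f z = g z"
proof (rule ccontr)
  assume "f z \<noteq> g z"
  have "open {x \<in> U. f x \<noteq> g x}"
  proof -
    have "open {p :: 'b \<times> 'b. fst p \<noteq> snd p}"
      by (intro open_Collect_neq continuous_intros)
    from continuous_open_preimage[OF continuous_on_Pair[OF assms(2,3)] assms(1) this]
    show ?thesis by (simp add: vimage_def Int_def)
  qed
  moreover have "{x \<in> U. f x \<noteq> g x} \<subseteq> N" using eq by blast
  ultimately have "negligible {x \<in> U. f x \<noteq> g x}" "open {x \<in> U. f x \<noteq> g x}"
    using negligible_subset[OF N] by blast+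
  then have "{x \<in> U. f x \<noteq> g x} = {}" using open_not_negligible by blast
  then show False using \<open>f z \<noteq> g z\<close> z by blast
qed

lemma generic_direction: "\<exists>v. v \<noteq> 0 \<and> v \<in> free"
proof -
  have "negligible (- free \<union> {0})" using negligible_not_free by simp
  then have "- free \<union> {0} \<noteq> UNIV" by (metis non_negligible_UNIV)
  then show ?thesis by blast
qed

text \<open>Nonzero multiples of a free vector \<open>v\<close> are free, and so, by compactness, is
  every small translate of a circle in the line of \<open>v\<close>. The mean of \<open>f\<close>
  over this circle is holomorphic in the translation even where \<open>f\<close> is undefined. The
  radius \<open>r\<close> is chosen before \<open>f\<close>, so that all coefficients and the
  inverse determinant extend to the same ball.\<close>

lemma Hartogs:
  assumes "R > 0"
  obtains r where "0 < r" "r \<le> R"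
    "\<And>f. holomorphic_fun (ball 0 R \<inter> free) f \<Longrightarrow>
      \<exists>g. holomorphic_fun (ball 0 r) g \<and> (\<forall>z\<in>ball 0 r \<inter> free. g z = f z)"
proof -
  obtain v where v: "v \<noteq> 0" "v \<in> free" using generic_direction by blast
  \<comment> \<open>The circle has norm \<open>R / 2\<close>; as \<open>r\<close> is at most
    \<open>R / 2\<close> too, its translates stay in the ball of radius \<open>R\<close>.\<close>
  define \<rho> where "\<rho> = R / (2 * norm v)"
  have "\<rho> > 0" using assms v by (simp add: \<rho>_def)
  let ?C = "circlepath 0 \<rho>"
  define K where "K = (\<lambda>\<theta>. ?C \<theta> *s v) ` {0..1}"
  have "compact K"
    unfolding K_def by (intro compact_continuous_image continuous_intros continuous_circlepath compact_Icc)
  have free_scale: "\<zeta> *s v \<in> free" if "\<zeta> \<noteq> 0" for \<zeta>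
    unfolding free_def
  proof (intro CollectI ballI impI)
    fix A assume "A \<in> G" "A *v (\<zeta> *s v) = \<zeta> *s v"
    then have "\<zeta> *s (A *v v) = \<zeta> *s v" by (simp add: vscale_right)
    then have "A *v v = v" using that by simp
    then show "A = mat 1" using v(2) \<open>A \<in> G\<close> by (simp add: free_def)
  qed
  then have "K \<inter> - free = {}" using circlepath_nonzero[OF \<open>\<rho> > 0\<close>] by (auto simp: K_def)
  moreover have "closed (- free)" using open_free by (simp add: closed_Compl)
  ultimately obtain d where d: "d > 0" "\<And>x y. x \<in> K \<Longrightarrow> y \<in> - free \<Longrightarrow> d \<le> dist x y"
    using separate_compact_closed[OF \<open>compact K\<close>] by metis
  define r where "r = min d (R / 2)"
  have r: "0 < r" "r \<le> R" "r \<le> d" using d(1) assms by (auto simp: r_def)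
  have disc: "z + \<zeta> *s v \<in> ball 0 R" if "z \<in> ball 0 r" "cmod \<zeta> \<le> \<rho>" for z \<zeta>
  proof -
    have "norm (\<zeta> *s v) \<le> R / 2"
      using that(2) v(1) by (simp add: norm_vscale \<rho>_def field_simps)
    moreover have "norm z < R / 2" using that(1) by (simp add: r_def)
    ultimately have "norm (z + \<zeta> *s v) < R" using norm_triangle_ineq[of z "\<zeta> *s v"] by linarith
    then show ?thesis by simp
  qed
  have circ: "z + ?C \<theta> *s v \<in> ball 0 R \<inter> free" if "z \<in> ball 0 r" "\<theta> \<in> {0..1}" for z \<theta>
  proof
    show "z + ?C \<theta> *s v \<in> ball 0 R"
      using disc[OF that(1)] norm_circlepath[of \<rho> \<theta>] \<open>\<rho> > 0\<close> by simp
    have "dist (?C \<theta> *s v) (z + ?C \<theta> *s v) < d" using that r by (simp add: dist_norm)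
    then show "z + ?C \<theta> *s v \<in> free" using d(2)[of "?C \<theta> *s v"] that(2) by (force simp: K_def)
  qed
  show thesis
  proof (rule that[OF r(1,2)])
    fix f assume f: "holomorphic_fun (ball 0 R \<inter> free) f"
    define g where "g z = integral {0..1} (\<lambda>\<theta>. f (z + ?C \<theta> *s v))" for z
    have g: "holomorphic_fun (ball 0 r) g"
      unfolding g_def
    proof (rule holomorphic_fun_integral_param)
      have "continuous_on ({0..1} \<times> ball 0 r) (\<lambda>p. f (snd p + ?C (fst p) *s v))"
        by (rule continuous_on_compose2[OF holomorphic_fun_continuous_on[OF f]])
          (use circ in \<open>auto intro!: continuous_intros continuous_on_compose2[OF continuous_circlepath]\<close>)
      then show "continuous_on ({0..1} \<times> ball 0 r) (\<lambda>(\<theta>, z). f (z + ?C \<theta> *s v))"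
        by (simp add: case_prod_beta)
      fix \<theta> :: real assume "\<theta> \<in> {0..1}"
      then show "holomorphic_fun (ball 0 r) (\<lambda>z. f (z + ?C \<theta> *s v))"
        using circ by (intro holomorphic_fun_compose[OF f])
          (auto simp: holomorphic_vec_def intro!: holomorphic_fun_add)
    qed simp
    let ?N = "\<Union>A\<in>G - {mat 1}. {z + \<zeta> *s v |z \<zeta>. A *v z = z}"
    have line: "z + \<zeta> *s v \<in> free" if "z \<notin> ?N" for z \<zeta>
      unfolding free_def
    proof (intro CollectI ballI impI, rule ccontr)
      fix A assume A: "A \<in> G" "A *v (z + \<zeta> *s v) = z + \<zeta> *s v" "A \<noteq> mat 1"
      have "z = (z + \<zeta> *s v) + (- \<zeta>) *s v" by simp
      then show False using that A by blast
    qed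
    \<comment> \<open>Here the entire disc bounded by the circle avoids nontrivial stabilizers, so
      Cauchy's formula identifies the mean with \<open>f z\<close>.\<close>
    have eq: "g z = f z" if "z \<in> ball 0 r \<inter> free" "z \<notin> ?N" for z
      using Cauchy_line(1)[OF f \<open>\<rho> > 0\<close>, of z v] disc line[OF that(2)] that(1)
      by (simp add: g_def)
    have "g z = f z" if "z \<in> ball 0 r \<inter> free" for z
    proof (rule eq_by_density[OF _ _ _ negligible_fixed_plus_line eq that])
      show "open (ball 0 r \<inter> free)" using open_free by (simp add: open_Int)
      show "continuous_on (ball 0 r \<inter> free) g"
        using holomorphic_fun_continuous_on[OF g] continuous_on_subset by blast
      show "continuous_on (ball 0 r \<inter> free) f"
        by (rule continuous_on_subset[OF holomorphic_fun_continuous_on[OF f]]) (use r in auto)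
    qed
    with g show "\<exists>g. holomorphic_fun (ball 0 r) g \<and> (\<forall>z\<in>ball 0 r \<inter> free. g z = f z)" by blast
  qed
qed

text \<open>Skewness, closedness and invariance are identities between continuous functions which
  hold at the free points, and these are dense.\<close>

lemma extend_form:
  assumes "R > 0" and M: "closed_form (ball 0 R \<inter> free) M"
    and det: "\<And>z. z \<in> ball 0 R \<inter> free \<Longrightarrow> det (M z) \<noteq> 0"
    and inv: "\<And>A z. A \<in> G \<Longrightarrow> z \<in> ball 0 R \<inter> free \<Longrightarrow> A *v z \<in> ball 0 R \<Longrightarrow>
      transpose A ** M (A *v z) ** A = M z"
  obtains r N where "0 < r" "r \<le> R" "closed_form (ball 0 r) N" "det (N 0) \<noteq> 0"
    "\<And>z. z \<in> ball 0 r \<inter> free \<Longrightarrow> N z = M z"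
    "\<And>A z. A \<in> G \<Longrightarrow> z \<in> ball 0 r \<Longrightarrow> A *v z \<in> ball 0 r \<Longrightarrow> transpose A ** N (A *v z) ** A = N z"
proof -
  obtain r where r: "0 < r" "r \<le> R"
    and ext: "\<And>f. holomorphic_fun (ball 0 R \<inter> free) f \<Longrightarrow>
      \<exists>g. holomorphic_fun (ball 0 r) g \<and> (\<forall>z\<in>ball 0 r \<inter> free. g z = f z)"
    using Hartogs[OF \<open>R > 0\<close>] by blast
  let ?B = "ball 0 r :: (complex ^ ('n + 'n)) set"
  have M_entry: "holomorphic_fun (ball 0 R \<inter> free) (\<lambda>z. M z $ i $ j)" for i j
    using closed_form_mat[OF M] by (simp add: holomorphic_mat_iff)
  have opR: "open (ball 0 R \<inter> free)" using open_free by (simp add: open_Int)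
  have "\<forall>i j. \<exists>g. holomorphic_fun ?B g \<and> (\<forall>z\<in>?B \<inter> free. g z = M z $ i $ j)"
    using ext[OF M_entry] by blast
  then obtain g where g: "\<And>i j. holomorphic_fun ?B (g i j)" "\<And>i j z. z \<in> ?B \<inter> free \<Longrightarrow> g i j z = M z $ i $ j"
    by metis
  define N where "N z = (\<chi> i j. g i j z)" for z
  have N_eq: "N z = M z" if "z \<in> ?B \<inter> free" for z using g(2)[OF that] by (simp add: N_def vec_eq_iff)
  have N_hol: "holomorphic_mat ?B N" using g(1) by (simp add: holomorphic_mat_iff N_def)
  have sub: "?B \<inter> free \<subseteq> ball 0 R \<inter> free" using r by auto
  have fd_N: "fd N z = fd M z" if "z \<in> ?B \<inter> free" for z
    by (rule fd_cong_open[of "?B \<inter> free"]) (use that N_eq open_free in \<open>auto simp: open_Int\<close>)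
  have N_cont: "continuous_on ?B N" by (rule holomorphic_mat_continuous_on[OF N_hol])
  have tr_cont: "continuous_on U (\<lambda>z. transpose (f z))"
    if "continuous_on U f" for U and f :: "complex ^ ('n + 'n) \<Rightarrow> complex ^ ('n + 'n) ^ ('n + 'n)"
    unfolding transpose_def by (intro continuous_intros continuous_on_vec_lambda that)
  show thesis
  proof (rule that[OF r])
    show "closed_form ?B N"
      unfolding closed_form_def
    proof (intro conjI ballI allI N_hol)
      fix z assume z: "z \<in> ?B"
      show "skew (N z)"
        unfolding skew_def
      proof (rule eq_by_density[OF open_ball _ _ negligible_not_free _ z])
        show "continuous_on ?B (\<lambda>z. transpose (N z))" "continuous_on ?B (\<lambda>z. - N z)"
          by (intro tr_cont N_cont continuous_intros)+
        show "transpose (N z) = - N z" if "z \<in> ?B" "z \<notin> - free" for z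
          using closed_form_skew[OF M, of z] sub that N_eq[of z] unfolding skew_def by auto
      qed
      fix u v w
      show "bil (fd N z u) v w - bil (fd N z v) u w + bil (fd N z w) u v = 0"
      proof (rule eq_by_density[OF open_ball _ _ negligible_not_free _ z])
        show "continuous_on ?B (\<lambda>z. bil (fd N z u) v w - bil (fd N z v) u w + bil (fd N z w) u v)"
          by (intro continuous_intros holomorphic_mat_fd_continuous N_hol)
        show "bil (fd N z u) v w - bil (fd N z v) u w + bil (fd N z w) u v = 0" if "z \<in> ?B" "z \<notin> - free" for z
          using closed_form_closed[OF M, of z] sub that fd_N[of z] by auto
      qed simp
    qed
    show "N z = M z" if "z \<in> ?B \<inter> free" for z by (rule N_eq[OF that])
    have "holomorphic_fun (ball 0 R \<inter> free) (\<lambda>z. inverse (det (M z)))"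
      by (intro holomorphic_fun_inverse holomorphic_fun_det opR M_entry det)
    then obtain h where h: "holomorphic_fun ?B h" "\<And>z. z \<in> ?B \<inter> free \<Longrightarrow> h z = inverse (det (M z))"
      using ext by blast
    have "h 0 * det (N 0) = 1"
    proof (rule eq_by_density[OF open_ball _ _ negligible_not_free])
      show "continuous_on ?B (\<lambda>z. h z * det (N z))"
        by (intro continuous_intros holomorphic_fun_continuous_on[OF h(1)] continuous_on_det N_cont)
      show "h z * det (N z) = 1" if "z \<in> ?B" "z \<notin> - free" for z
        using h(2)[of z] N_eq[of z] that det[of z] sub by auto
    qed (use r in auto)
    then show "det (N 0) \<noteq> 0" by auto
    fix A z assume A: "A \<in> G" and z: "z \<in> ?B" "A *v z \<in> ?B"
    \<comment> \<open>The ball need not be invariant under \<open>A\<close>, so the comparison takes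
      place on those points whose image stays inside.\<close>
    let ?U = "?B \<inter> (*v) A -` ?B"
    have "open ?U" by (intro open_Int open_ball open_vimage continuous_intros)
    have comp: "continuous_on ?U (\<lambda>z. N (A *v z))"
      by (rule continuous_on_compose2[OF N_cont]) (auto intro!: continuous_intros)
    have bilc: "bil (transpose A ** N (A *v z) ** A) u v = bil (N z) u v" for u v
      unfolding bil_mult[symmetric]
    proof (rule eq_by_density[OF \<open>open ?U\<close> _ _ negligible_not_free,
          where f = "\<lambda>z. bil (N (A *v z)) (A *v u) (A *v v)" and g = "\<lambda>z. bil (N z) u v"])
      show "continuous_on ?U (\<lambda>z. bil (N (A *v z)) (A *v u) (A *v v))"
        by (intro continuous_intros comp)
      show "continuous_on ?U (\<lambda>z. bil (N z) u v)"
        by (intro continuous_intros continuous_on_subset[OF N_cont]) auto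
      fix z assume *: "z \<in> ?U" "z \<notin> - free"
      then have "N (A *v z) = M (A *v z)" "N z = M z" using N_eq free_invariant[OF A] by auto
      then show "bil (N (A *v z)) (A *v u) (A *v v) = bil (N z) u v"
        unfolding bil_mult using inv[OF A, of z] * r by auto
    qed (use z in auto)
    show "transpose A ** N (A *v z) ** A = N z" by (rule bil_eqI[OF bilc])
  qed
qed

end

section \<open>Charts and forms on the quotient\<close>

lemma cvec_linear_expand:
  fixes D :: "complex ^ 'm::finite \<Rightarrow> complex"
  assumes "Vector_Spaces.linear (*s) (*) D"
  shows "D v = (\<Sum>i\<in>UNIV. v $ i * D (axis i 1))"
proof -
  have add: "D (x + y) = D x + D y" and scale: "D (c *s x) = c * D x" for x y c
    using assms unfolding linear_cvec_iff by auto
  have "D 0 = 0" using scale[of 0 0] by simp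
  then have "D (\<Sum>i\<in>I. v $ i *s axis i 1) = (\<Sum>i\<in>I. v $ i * D (axis i 1))" for I
    by (induction I rule: infinite_finite_induct) (simp_all add: add scale)
  from this[of UNIV] show ?thesis by (simp add: basis_expansion)
qed

lemma bilinear_expand:
  fixes f :: "complex ^ 'm::finite \<Rightarrow> complex ^ 'm \<Rightarrow> complex"
  assumes "\<And>u. Vector_Spaces.linear (*s) (*) (\<lambda>v. f u v)" "\<And>v. Vector_Spaces.linear (*s) (*) (\<lambda>u. f u v)"
  shows "f u v = (\<Sum>i\<in>UNIV. \<Sum>j\<in>UNIV. u $ i * v $ j * f (axis i 1) (axis j 1))"
proof -
  have "f u v = (\<Sum>i\<in>UNIV. u $ i * f (axis i 1) v)"
    by (rule cvec_linear_expand[OF assms(2)])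
  also have "\<dots> = (\<Sum>i\<in>UNIV. u $ i * (\<Sum>j\<in>UNIV. v $ j * f (axis i 1) (axis j 1)))"
    by (simp only: cvec_linear_expand[OF assms(1), of _ v])
  finally show ?thesis by (simp add: sum_distrib_left mult.assoc)
qed

lemma bil_expand: "bil M u v = (\<Sum>i\<in>UNIV. \<Sum>j\<in>UNIV. u $ i * v $ j * M $ i $ j)"
  by (simp add: dotc_def matrix_vector_mult_def sum_distrib_left mult_ac)

lemma skewI:
  assumes "\<And>u. bil M u u = 0" shows "skew M"
proof -
  have "bil M u v = - bil M v u" for u v
    using assms[of "u + v"] assms[of u] assms[of v]
    by (simp add: matrix_vector_right_distrib dotc.add_left dotc.add_right eq_neg_iff_add_eq_0 algebra_simps)
  then have M: "M $ i $ j = - M $ j $ i" for i j using bil_axis by metis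
  show ?thesis
    unfolding skew_def vec_eq_iff
  proof (intro allI)
    show "transpose M $ i $ j = (- M) $ i $ j" for i j
      using M[of j i] by (simp add: transpose_def)
  qed
qed

lemma det_nonzeroI:
  fixes M :: "complex ^ 'm::finite ^ 'm"
  assumes "\<And>u. (\<And>v. bil M v u = 0) \<Longrightarrow> u = 0" shows "det M \<noteq> 0"
proof -
  have "\<forall>x. M *v x = 0 \<longrightarrow> x = 0" using assms by (metis dotc.zero_right)
  then show ?thesis
    using matrix_left_invertible_ker[of M] invertible_det_nz[of M] matrix_left_right_inverse
    unfolding invertible_def by blast
qed

lemma det_nonzeroD:
  fixes M :: "complex ^ 'm::finite ^ 'm"
  assumes "det M \<noteq> 0" "\<And>v. bil M v u = 0" shows "u = 0"
proof -
  have "M *v u = M *v 0" using dotc_eqI[of "M *v u" 0] assms(2) by (simp add: dotc.zero_right matvec.zero_right)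
  then show ?thesis using matvec_cancel[OF assms(1)] by blast
qed

context finite_Sp
begin

abbreviation pr :: "complex ^ ('n + 'n) \<Rightarrow> (complex ^ ('n + 'n)) set" where
  "pr \<equiv> orbit G"

abbreviation X where "X \<equiv> quotient_space G"

lemma pr_eq_iff: "pr x = pr y \<longleftrightarrow> (\<exists>A\<in>G. y = A *v x)"
proof
  assume "pr x = pr y"
  moreover have "y \<in> pr y" unfolding orbit_def using one_mem by (force intro: image_eqI[of _ _ "mat 1"])
  ultimately show "\<exists>A\<in>G. y = A *v x" by (auto simp: orbit_def)
next
  assume "\<exists>A\<in>G. y = A *v x"
  then obtain A where A: "A \<in> G" "y = A *v x" by blast
  obtain B where B: "B \<in> G" "B ** A = mat 1" "A ** B = mat 1" using inverse_mem[OF A(1)] by blast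
  have "C *v x = (C ** B) *v y" for C
    using B(2) by (simp add: A(2) matrix_vector_mul_assoc matrix_mul_assoc[symmetric])
  then have "pr x \<subseteq> pr y" unfolding orbit_def using mult_mem B(1) by blast
  moreover have "pr y \<subseteq> pr x"
    unfolding orbit_def A(2) using mult_mem A(1) by (auto simp: matrix_vector_mul_assoc)
  ultimately show "pr x = pr y" by blast
qed

lemma pr_mult [simp]: "A \<in> G \<Longrightarrow> pr (A *v z) = pr z"
  using pr_eq_iff by metis

lemma openin_X: "openin (topol X) U \<longleftrightarrow> U \<subseteq> range pr \<and> open (pr -` U)"
  by (simp add: quotient_space_def openin_quotient_topol)

lemma sheaf_X: "sheaf X U f \<longleftrightarrow> openin (topol X) U \<and> holomorphic_fun (pr -` U) (f \<circ> pr)"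
  by (simp add: quotient_space_def)

lemma vimage_pr_image: "pr -` pr ` S = (\<Union>A\<in>G. (*v) A -` S)"
proof (rule Set.set_eqI)
  show "z \<in> pr -` pr ` S \<longleftrightarrow> z \<in> (\<Union>A\<in>G. (*v) A -` S)" for z
    by (simp only: vimage_eq image_iff UN_iff pr_eq_iff) blast
qed

lemma open_vimage_matvec: "open S \<Longrightarrow> open ((*v) A -` S)" for A :: "complex ^ 'k::finite ^ 'l::finite"
  by (rule open_vimage, assumption) (intro continuous_intros)

lemma openin_pr_image: "open S \<Longrightarrow> openin (topol X) (pr ` S)"
  unfolding openin_X vimage_pr_image using open_vimage_matvec by auto

text \<open>For each nontrivial group element \<open>z\<close> and its image are separated by open
  sets; the finitely many resulting neighbourhoods intersect in one that meets each orbit at most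
  once.\<close>

lemma free_nbhd:
  assumes "z \<in> free" "open S" "z \<in> S"
  obtains B where "open B" "z \<in> B" "B \<subseteq> S" "inj_on pr B"
proof -
  have "\<forall>A\<in>G - {mat 1}. \<exists>B. open B \<and> z \<in> B \<and> (\<forall>y\<in>B. A *v y \<notin> B)"
  proof
    fix A assume "A \<in> G - {mat 1}"
    then have "A *v z \<noteq> z" using assms(1) by (auto simp: free_def)
    then obtain P Q where PQ: "open P" "open Q" "z \<in> P" "A *v z \<in> Q" "P \<inter> Q = {}"
      using hausdorff[of z "A *v z"] by metis
    then have "open (P \<inter> (*v) A -` Q)" using open_vimage_matvec by blast
    then show "\<exists>B. open B \<and> z \<in> B \<and> (\<forall>y\<in>B. A *v y \<notin> B)"
      using PQ by (intro exI[of _ "P \<inter> (*v) A -` Q"]) auto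
  qed
  then obtain F where F: "\<And>A. A \<in> G - {mat 1} \<Longrightarrow> open (F A) \<and> z \<in> F A \<and> (\<forall>y\<in>F A. A *v y \<notin> F A)"
    by metis
  let ?B = "S \<inter> (\<Inter>A\<in>G - {mat 1}. F A)"
  show thesis
  proof (rule that[of ?B])
    show "open ?B" using F finite assms(2) by (intro open_Int open_INT) auto
    show "inj_on pr ?B"
    proof (rule inj_onI)
      fix x y assume xy: "x \<in> ?B" "y \<in> ?B" "pr x = pr y"
      obtain A where A: "A \<in> G" "y = A *v x"
        using xy(3) unfolding pr_eq_iff by (elim bexE)
      show "x = y"
      proof (cases "A = mat 1")
        case True
        then show ?thesis using A(2) by simp
      next
        case False
        then have "x \<in> F A" "A *v x \<in> F A" "\<forall>y\<in>F A. A *v y \<notin> F A"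
          using xy A F[of A] by auto
        then show ?thesis by blast
      qed
    qed
  qed (use F assms in auto)
qed

lemma openin_affine [simp]: "openin (topol affine_cspace) S \<longleftrightarrow> open S"
  by (simp add: affine_cspace_def)

lemma sheaf_affine [simp]: "sheaf affine_cspace = holomorphic_fun"
  by (simp add: affine_cspace_def)

lemma standard_chart:
  assumes B: "open B" "inj_on pr B"
  shows "chart X (pr ` B) (the_inv_into B pr)" and "the_inv_into B pr ` pr ` B = B"
proof -
  let ?U = "pr ` B" and ?c = "the_inv_into B pr"
  have c: "?c (pr z) = z" if "z \<in> B" for z using the_inv_into_f_f[OF B(2) that] .
  then show cU: "?c ` ?U = B" by force
  have inj: "inj_on ?c ?U" by (rule inj_on_the_inv_into[OF B(2)])
  have inv: "the_inv_into ?U ?c z = pr z" if "z \<in> B" for z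
    using the_inv_into_f_f[OF inj, of "pr z"] c[OF that] that by simp
  have pre: "?U \<inter> ?c -` W = pr ` W" if "W \<subseteq> B" for W
    using that c by force
  have U: "openin (topol X) ?U" by (rule openin_pr_image[OF B(1)])
  show "chart X ?U ?c"
    unfolding chart_def biholomorphic_map_def cU
  proof (intro conjI)
    show "bij_betw ?c ?U B" using inj cU by (simp add: bij_betw_def)
    show "holomorphic_map X ?U affine_cspace B ?c"
      unfolding holomorphic_map_def
    proof (intro conjI allI impI U)
      show "openin (topol affine_cspace) B" using B(1) by simp
      have "continuous_map (subtopology (topol X) ?U) euclidean ?c"
        unfolding continuous_map_def
      proof (intro conjI allI impI)
        fix W :: "(complex ^ ('n + 'n)) set" assume "openin euclidean W"
        then have "openin (topol X) (pr ` (B \<inter> W))" using B(1) by (intro openin_pr_image) auto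
        moreover have "{x \<in> topspace (subtopology (topol X) ?U). ?c x \<in> W} = pr ` (B \<inter> W)"
          using openin_subset[OF U] c by auto
        ultimately show "openin (subtopology (topol X) ?U) {x \<in> topspace (subtopology (topol X) ?U). ?c x \<in> W}"
          using openin_open_subtopology[OF U] by auto
      qed auto
      then show "continuous_map (subtopology (topol X) ?U) (subtopology (topol affine_cspace) B) ?c"
        using c by (auto simp: affine_cspace_def continuous_map_in_subtopology)
      fix W f assume W: "openin (topol affine_cspace) W" "W \<subseteq> B" "sheaf affine_cspace W f"
      have "holomorphic_fun (pr -` pr ` W) (f \<circ> ?c \<circ> pr)"
      proof (rule holomorphic_fun_Union)
        fix z assume "z \<in> pr -` pr ` W"
        then obtain A where A: "A \<in> G" "A *v z \<in> W" unfolding vimage_pr_image by blast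
        have op: "open ((*v) A -` W)" using W(1) open_vimage_matvec by auto
        have "holomorphic_fun ((*v) A -` W) (\<lambda>z. f (A *v z))"
          by (rule holomorphic_fun_compose[OF _ holomorphic_vec_matvec[OF op]]) (use W in auto)
        moreover have "f (A *v y) = (f \<circ> ?c \<circ> pr) y" if "y \<in> (*v) A -` W" for y
          using c[of "A *v y"] that W(2) A(1) by auto
        ultimately have "holomorphic_fun ((*v) A -` W) (f \<circ> ?c \<circ> pr)"
          by (rule holomorphic_fun_cong)
        then show "\<exists>V. z \<in> V \<and> V \<subseteq> pr -` pr ` W \<and> holomorphic_fun V (f \<circ> ?c \<circ> pr)"
          using A by (intro exI[of _ "(*v) A -` W"]) (auto simp: vimage_pr_image)
      qed
      then show "sheaf X (?U \<inter> ?c -` W) (f \<circ> ?c)"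
        unfolding pre[OF W(2)] sheaf_X using W(1) openin_pr_image by simp
    qed
    show "holomorphic_map affine_cspace B X ?U (the_inv_into ?U ?c)"
      unfolding holomorphic_map_def
    proof (intro conjI allI impI U)
      show "openin (topol affine_cspace) B" using B(1) by simp
      have pr_cont: "continuous_map (subtopology euclidean B) (topol X) pr"
        using quotient_imp_continuous_map[OF quotient_map_orbit[of G]]
        by (simp add: quotient_space_def continuous_map_from_subtopology)
      have "continuous_map (subtopology euclidean B) (topol X) (the_inv_into ?U ?c)"
        by (rule continuous_map_eq[OF pr_cont]) (simp add: inv)
      then show "continuous_map (subtopology (topol affine_cspace) B) (subtopology (topol X) ?U) (the_inv_into ?U ?c)"
        using inv by (auto simp: affine_cspace_def continuous_map_in_subtopology)
      fix W f assume W: "openin (topol X) W" "W \<subseteq> ?U" "sheaf X W f"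
      have eq: "B \<inter> the_inv_into ?U ?c -` W = B \<inter> pr -` W" using inv by auto
      have op: "open (B \<inter> pr -` W)" using W(1) B(1) unfolding openin_X by auto
      have "holomorphic_fun (B \<inter> pr -` W) (f \<circ> pr)"
        by (rule holomorphic_fun_subset[OF _ _ op]) (use W(3) sheaf_X in auto)
      then have "holomorphic_fun (B \<inter> pr -` W) (f \<circ> the_inv_into ?U ?c)"
        by (rule holomorphic_fun_cong) (use inv in auto)
      then show "sheaf affine_cspace (B \<inter> the_inv_into ?U ?c -` W) (f \<circ> the_inv_into ?U ?c)"
        by (simp add: eq)
    qed
  qed
qed

section \<open>Arbitrary charts of the quotient and lifts of forms\<close>

lemma chart_openin: "chart X U a \<Longrightarrow> openin (topol X) U"
  and chart_image_open: "chart X U a \<Longrightarrow> open (a ` U)"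
  and chart_inj: "chart X U a \<Longrightarrow> inj_on a U"
  by (auto simp: chart_def biholomorphic_map_def holomorphic_map_def bij_betw_def)

lemma chart_vimage_open: "chart X U a \<Longrightarrow> open (pr -` U)"
  using chart_openin openin_X by blast

lemma chart_inv: "chart X U a \<Longrightarrow> x \<in> U \<Longrightarrow> the_inv_into U a (a x) = x"
  using chart_inj the_inv_into_f_f by metis

text \<open>The coordinate functions are holomorphic on the image of the chart, so their pullbacks
  are sections of the quotient sheaf, that is, have holomorphic lifts.\<close>

lemma chart_lift_hol:
  fixes a :: "_ \<Rightarrow> complex ^ 'm::finite"
  assumes "chart X U a" shows "holomorphic_vec (pr -` U) (a \<circ> pr)"
  unfolding holomorphic_vec_def
proof (intro conjI allI)
  show "open (pr -` U)" by (rule chart_vimage_open[OF assms])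
  fix i
  have "holomorphic_map X U affine_cspace (a ` U) a"
    using assms by (simp add: chart_def biholomorphic_map_def)
  then have "sheaf X (U \<inter> a -` a ` U) ((\<lambda>z. z $ i) \<circ> a)"
    unfolding holomorphic_map_def using chart_image_open[OF assms] by auto
  moreover have "U \<inter> a -` a ` U = U" by auto
  ultimately show "holomorphic_fun (pr -` U) (\<lambda>z. (a \<circ> pr) z $ i)"
    by (simp add: sheaf_X o_def)
qed

text \<open>A map with holomorphic lift has components in the quotient sheaf, which the inverse of
  the chart pulls back to holomorphic functions. Transition maps between arbitrary charts are
  handled in this way.\<close>

lemma chart_push_hol:
  fixes a :: "_ \<Rightarrow> complex ^ 'm::finite"
  assumes a: "chart X U a" and W: "openin (topol X) W" "W \<subseteq> U"
    and k: "holomorphic_vec (pr -` W) (k \<circ> pr)"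
  shows "holomorphic_vec (a ` W) (k \<circ> the_inv_into U a)"
proof -
  have eq: "a ` U \<inter> the_inv_into U a -` W = a ` W"
    using W(2) chart_inv[OF a] by (force simp: subset_iff)
  have "holomorphic_map affine_cspace (a ` U) X U (the_inv_into U a)"
    using a by (simp add: chart_def biholomorphic_map_def)
  then have "holomorphic_fun (a ` W) (f \<circ> the_inv_into U a)" if "sheaf X W f" for f
    unfolding holomorphic_map_def using W that eq by auto
  then have h: "holomorphic_fun (a ` W) (\<lambda>p. (k \<circ> the_inv_into U a) p $ i)" for i
    using k W(1) holomorphic_vec_nth[OF k, of i]
    by (simp add: sheaf_X o_def)
  then show ?thesis using holomorphic_fun_open by (auto simp: holomorphic_vec_def)
qed

text \<open>The matrix, at \<^term>\<open>z\<close>, of the pullback of a two-form along the orbit map; it carries no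
  meaning if no chart of \<^term>\<open>W\<close> contains the orbit of \<^term>\<open>z\<close>.\<close>

definition lift_form ::
  "((complex ^ ('n + 'n)) set, 'n + 'n) two_form \<Rightarrow> (complex ^ ('n + 'n)) set set \<Rightarrow>
   complex ^ ('n + 'n) \<Rightarrow> complex ^ ('n + 'n) ^ ('n + 'n)" where
  "lift_form \<omega> W z = (let (U, a) = SOME (U, a). chart X U a \<and> U \<subseteq> W \<and> pr z \<in> U
     in \<chi> i j. \<omega> U a (a (pr z)) (fd (a \<circ> pr) z (axis i 1)) (fd (a \<circ> pr) z (axis j 1)))"

context
  fixes \<omega> :: "((complex ^ ('n + 'n)) set, 'n + 'n) two_form" and W :: "(complex ^ ('n + 'n)) set set"
  assumes two_form: "holomorphic_two_form X W \<omega>"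
begin

lemma form_linear:
  assumes "chart X U a" "U \<subseteq> W" "p \<in> a ` U"
  shows "Vector_Spaces.linear (*s) (*) (\<lambda>v. \<omega> U a p u v)"
    and "Vector_Spaces.linear (*s) (*) (\<lambda>u. \<omega> U a p u v)"
    and "\<omega> U a p u u = 0"
  using two_form assms unfolding holomorphic_two_form_def by blast+

lemma form_hol:
  assumes "chart X U a" "U \<subseteq> W" shows "holomorphic_fun (a ` U) (\<lambda>z. \<omega> U a z u v)"
  using two_form assms unfolding holomorphic_two_form_def by blast

lemma form_change:
  assumes "chart X U a" "U \<subseteq> W" "chart X U' a'" "U' \<subseteq> W" "x \<in> U" "x \<in> U'"
  shows "\<omega> U a (a x) = pullback_at id U a a' x (\<omega> U' a' (a' x))"
proof -
  note * = two_form[unfolded holomorphic_two_form_def, THEN conjunct2]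
  show ?thesis by (rule *[rule_format, OF assms(1-4)]) (use assms(5,6) in blast)
qed

text \<open>The transition map composed with the lift of one chart is the lift of the other, so the
  chain rule turns the compatibility of the local expressions into independence of the
  chart.\<close>

lemma form_change_lift:
  assumes a: "chart X U a" "U \<subseteq> W" and a': "chart X U' a'" "U' \<subseteq> W" and z: "pr z \<in> U" "pr z \<in> U'"
  shows "\<omega> U a (a (pr z)) (fd (a \<circ> pr) z u) (fd (a \<circ> pr) z v)
    = \<omega> U' a' (a' (pr z)) (fd (a' \<circ> pr) z u) (fd (a' \<circ> pr) z v)"
proof -
  let ?t = "a' \<circ> the_inv_into U a" and ?W = "U \<inter> U'"
  have W: "openin (topol X) ?W" using chart_openin a(1) a'(1) by blast
  then have opW: "open (pr -` ?W)" using openin_X by blast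
  have "holomorphic_vec (a ` ?W) ?t"
    by (rule chart_push_hol[OF a(1) W _ holomorphic_vec_subset[OF chart_lift_hol[OF a'(1)] _ opW]]) auto
  then have t: "(?t has_derivative fd ?t (a (pr z))) (at ((a \<circ> pr) z))"
    by (auto intro!: holomorphic_vec_has_derivative simp: z)
  have T: "((a \<circ> pr) has_derivative fd (a \<circ> pr) z) (at z)"
    using holomorphic_vec_has_derivative[OF chart_lift_hol[OF a(1)]] z by simp
  have "((a' \<circ> pr) has_derivative (fd ?t (a (pr z)) \<circ> fd (a \<circ> pr) z)) (at z)"
    by (rule has_derivative_cong_open[OF diff_chain_at[OF T t] opW]) (use z chart_inv[OF a(1)] in auto)
  then have "fd (a' \<circ> pr) z = fd ?t (a (pr z)) \<circ> fd (a \<circ> pr) z" by (rule fd_eq)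
  then show ?thesis
    unfolding form_change[OF a a' z] pullback_at_def Let_def by (simp add: id_def o_def)
qed

text \<open>Eliminates the arbitrary choice in \<open>lift_form\<close>: bilinearity passes from
  basis vectors to all vectors, and \<open>form_change_lift\<close> from the selected chart to any
  other.\<close>

lemma bil_lift_form:
  assumes a: "chart X U a" "U \<subseteq> W" and z: "pr z \<in> U"
  shows "bil (lift_form \<omega> W z) u v = \<omega> U a (a (pr z)) (fd (a \<circ> pr) z u) (fd (a \<circ> pr) z v)"
proof -
  obtain V b where Vb: "(SOME (U, a). chart X U (a :: _ \<Rightarrow> complex ^ ('n + 'n)) \<and> U \<subseteq> W \<and> pr z \<in> U) = (V, b)"
    by (rule prod.exhaust)
  have "\<exists>p. case p of (U, a) \<Rightarrow> chart X U (a :: _ \<Rightarrow> complex ^ ('n + 'n)) \<and> U \<subseteq> W \<and> pr z \<in> U"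
    by (intro exI[of _ "(U, a)"]) (use assms in simp)
  from someI_ex[OF this]
  have "case (V, b) of (U, a) \<Rightarrow> chart X U a \<and> U \<subseteq> W \<and> pr z \<in> U"
    unfolding Vb .
  then have b: "chart X V b" "V \<subseteq> W" "pr z \<in> V" by auto
  let ?T = "fd (b \<circ> pr) z" and ?w = "\<omega> V b (b (pr z))"
  have T: "?T u = (\<Sum>i\<in>UNIV. u $ i *s ?T (axis i 1))" for u
    using holomorphic_fd_expand[OF chart_lift_hol[OF b(1)]] b(3) by simp
  have lin: "(?T (x + y) = ?T x + ?T y) \<and> (?T (c *s x) = c *s ?T x)" for x y c
    using holomorphic_vec_has_derivative[OF chart_lift_hol[OF b(1)], of z]
      holomorphic_vec_fd_vscale[OF chart_lift_hol[OF b(1)], of z] b(3)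
    by (simp add: has_derivative_bounded_linear bounded_linear.linear linear_add)
  have w: "Vector_Spaces.linear (*s) (*) (\<lambda>v. ?w u v)" "Vector_Spaces.linear (*s) (*) (\<lambda>u. ?w u v)" for u v
    using form_linear(1,2)[OF b(1,2)] b(3) by blast+
  have "?w (?T u) (?T v) = (\<Sum>i\<in>UNIV. \<Sum>j\<in>UNIV. u $ i * v $ j * ?w (?T (axis i 1)) (?T (axis j 1)))"
    by (rule bilinear_expand[of "\<lambda>u v. ?w (?T u) (?T v)"])
      (use w lin in \<open>simp_all add: linear_cvec_iff\<close>)
  also have "\<dots> = bil (lift_form \<omega> W z) u v"
    unfolding bil_expand by (simp add: lift_form_def Vb)
  finally show ?thesis using form_change_lift[OF a b(1,2) z b(3)] by simp
qed

text \<open>As \<open>a \<circ> pr\<close> is constant on orbits, its derivative at \<open>z\<close>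
  is its derivative at \<open>A *v z\<close> composed with \<open>A\<close>.\<close>

lemma lift_form_invariant:
  fixes a :: "_ \<Rightarrow> complex ^ ('n + 'n)"
  assumes a: "chart X U a" "U \<subseteq> W" and z: "pr z \<in> U" and A: "A \<in> G"
  shows "transpose A ** lift_form \<omega> W (A *v z) ** A = lift_form \<omega> W z"
proof (rule bil_eqI)
  fix u v
  have T: "((a \<circ> pr) has_derivative fd (a \<circ> pr) (A *v z)) (at (A *v z))"
    using holomorphic_vec_has_derivative[OF chart_lift_hol[OF a(1)]] z A by simp
  have "((*v) A has_derivative (*v) A) (at z)"
    by (intro bounded_linear_imp_has_derivative matvec.bounded_linear_right)
  from diff_chain_at[OF this T]
  have "((a \<circ> pr) has_derivative (fd (a \<circ> pr) (A *v z) \<circ> (*v) A)) (at z)"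
    using A by (simp add: o_def)
  then have "fd (a \<circ> pr) z = fd (a \<circ> pr) (A *v z) \<circ> (*v) A" by (rule fd_eq)
  then show "bil (transpose A ** lift_form \<omega> W (A *v z) ** A) u v = bil (lift_form \<omega> W z) u v"
    using bil_lift_form[OF a, of "A *v z" "A *v u" "A *v v"] bil_lift_form[OF a z, of u v] A z
    by (simp add: bil_mult[symmetric])
qed

lemma lift_form_standard:
  assumes B: "open B" "inj_on pr B" "pr ` B \<subseteq> W" and z: "z \<in> B"
  shows "bil (lift_form \<omega> W z) u v = \<omega> (pr ` B) (the_inv_into B pr) z u v"
proof -
  let ?c = "the_inv_into B pr"
  have c: "?c (pr y) = y" if "y \<in> B" for y using the_inv_into_f_f[OF B(2) that] .
  have "((\<lambda>y. y) has_derivative (\<lambda>y. y)) (at z)" by simp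
  then have "((?c \<circ> pr) has_derivative (\<lambda>y. y)) (at z)"
    by (rule has_derivative_cong_open[OF _ B(1) z]) (simp add: c)
  then have "fd (?c \<circ> pr) z = (\<lambda>y. y)" by (rule fd_eq)
  then show ?thesis
    using bil_lift_form[OF standard_chart(1)[OF B(1,2)] B(3), of z u v] z by (simp add: c)
qed

end

text \<open>Near a free point the lift is just the expression of \<open>\<omega>\<close> in a
  standard chart, from which regularity, closedness and nondegeneracy are read off.\<close>

lemma lift_form_free:
  assumes \<omega>: "germ_symplectic_form X p W \<omega>"
  shows "closed_form (free \<inter> pr -` W) (lift_form \<omega> W)"
    and "\<And>z. z \<in> free \<inter> pr -` W \<Longrightarrow> det (lift_form \<omega> W z) \<noteq> 0"
    and "\<And>z A. z \<in> free \<inter> pr -` W \<Longrightarrow> A \<in> G \<Longrightarrow>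
      transpose A ** lift_form \<omega> W (A *v z) ** A = lift_form \<omega> W z"
proof -
  let ?M = "lift_form \<omega> W"
  have tf: "holomorphic_two_form X W \<omega>" and dc: "d_closed X W \<omega>" and nd: "nondegenerate X W \<omega>"
    and W: "openin (topol X) W"
    using \<omega> by (auto simp: germ_symplectic_form_def)
  have opW: "open (pr -` W)" using W openin_X by blast
  have local: "\<exists>B. open B \<and> z \<in> B \<and> B \<subseteq> free \<inter> pr -` W \<and> inj_on pr B" if "z \<in> free \<inter> pr -` W" for z
    using free_nbhd[of z "free \<inter> pr -` W"] that open_free opW by (metis IntD1 open_Int)
  have loc: "bil (?M y) u v = \<omega> (pr ` B) (the_inv_into B pr) y u v"
    "chart X (pr ` B) (the_inv_into B pr)" "the_inv_into B pr ` pr ` B = B" "pr ` B \<subseteq> W"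
    if "open B" "B \<subseteq> free \<inter> pr -` W" "inj_on pr B" "y \<in> B" for B y u v
  proof -
    show W: "pr ` B \<subseteq> W" using that(2) by blast
    show "bil (?M y) u v = \<omega> (pr ` B) (the_inv_into B pr) y u v"
      by (rule lift_form_standard[OF tf that(1,3) W that(4)])
    show "chart X (pr ` B) (the_inv_into B pr)" "the_inv_into B pr ` pr ` B = B"
      by (rule standard_chart[OF that(1,3)])+
  qed
  have entry_hol: "holomorphic_fun B (\<lambda>y. bil (?M y) u v)"
    if "open B" "z \<in> B" "B \<subseteq> free \<inter> pr -` W" "inj_on pr B" for B z u v
    using holomorphic_fun_cong[OF form_hol[OF tf loc(2)[OF that(1,3,4,2)] loc(4)[OF that(1,3,4,2)], of u v]]
      loc(1,3)[OF that(1,3,4)] that(2) by metis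
  have hol: "holomorphic_mat (free \<inter> pr -` W) ?M"
    unfolding holomorphic_mat_iff
  proof (intro conjI allI)
    show "open (free \<inter> pr -` W)" using open_free opW by blast
    fix i j
    show "holomorphic_fun (free \<inter> pr -` W) (\<lambda>z. ?M z $ i $ j)"
    proof (rule holomorphic_fun_Union)
      fix z assume "z \<in> free \<inter> pr -` W"
      from local[OF this] obtain B where B: "open B" "z \<in> B" "B \<subseteq> free \<inter> pr -` W" "inj_on pr B" by blast
      from entry_hol[OF B, of "axis i 1" "axis j 1"]
      show "\<exists>V. z \<in> V \<and> V \<subseteq> free \<inter> pr -` W \<and> holomorphic_fun V (\<lambda>z. ?M z $ i $ j)"
        using B unfolding bil_axis by blast
    qed
  qed
  have skw: "skew (?M z)" if z: "z \<in> free \<inter> pr -` W" for z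
  proof (rule skewI)
    fix u
    obtain B where B: "open B" "z \<in> B" "B \<subseteq> free \<inter> pr -` W" "inj_on pr B" using local[OF z] by blast
    show "bil (?M z) u u = 0"
      using loc[OF B(1,3,4,2)] form_linear(3)[OF tf, of "pr ` B" "the_inv_into B pr" z u] B(2) by simp
  qed
  show "closed_form (free \<inter> pr -` W) ?M"
    unfolding closed_form_def
  proof (intro conjI ballI allI hol skw)
    fix z u v w assume z: "z \<in> free \<inter> pr -` W"
    obtain B where B: "open B" "z \<in> B" "B \<subseteq> free \<inter> pr -` W" "inj_on pr B" using local[OF z] by blast
    let ?w = "\<lambda>y u v. \<omega> (pr ` B) (the_inv_into B pr) y u v"
    have fd: "fd (\<lambda>y. ?w y s t) z x = bil (fd ?M z x) s t" for s t x
    proof -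
      have "((\<lambda>y. bil (?M y) s t) has_derivative (\<lambda>x. bil (fd ?M z x) s t)) (at z)"
        using holomorphic_mat_has_derivative[OF hol z]
        by (auto intro!: derivative_eq_intros simp: matvec.zero_right dotc.zero_left)
      then have "((\<lambda>y. ?w y s t) has_derivative (\<lambda>x. bil (fd ?M z x) s t)) (at z)"
        by (rule has_derivative_cong_open[OF _ B(1,2)]) (rule loc(1)[OF B(1,3,4)])
      then show ?thesis by (simp add: fd_eq)
    qed
    show "bil (fd ?M z u) v w - bil (fd ?M z v) u w + bil (fd ?M z w) u v = 0"
      using dc loc(2-4)[OF B(1,3,4,2)] B(2) unfolding d_closed_def fd[symmetric] by metis
  qed
  show "det (?M z) \<noteq> 0" if z: "z \<in> free \<inter> pr -` W" for z
  proof (rule det_nonzeroI)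
    fix u assume "\<And>v. bil (?M z) v u = 0"
    then have 0: "\<And>v. bil (?M z) u v = 0" using skew_bil[OF skw[OF z]] by (metis neg_equal_0_iff_equal)
    obtain B where B: "open B" "z \<in> B" "B \<subseteq> free \<inter> pr -` W" "inj_on pr B" using local[OF z] by blast
    note l = loc[OF B(1,3,4,2)]
    have "\<forall>z\<in>the_inv_into B pr ` pr ` B. \<forall>u. (\<forall>v. \<omega> (pr ` B) (the_inv_into B pr) z u v = 0) \<longrightarrow> u = 0"
      using nd l(2,4) unfolding nondegenerate_def by blast
    then show "u = 0" using 0 B(2) unfolding l(3) l(1) by blast
  qed
  show "transpose A ** ?M (A *v z) ** A = ?M z" if z: "z \<in> free \<inter> pr -` W" and A: "A \<in> G" for z A
  proof -
    obtain B where B: "open B" "z \<in> B" "B \<subseteq> free \<inter> pr -` W" "inj_on pr B" using local[OF z] by blast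
    show ?thesis
      by (rule lift_form_invariant[OF tf loc(2,4)[OF B(1,3,4,2)] _ A]) (use B in auto)
  qed
qed

end

section \<open>Descending equivariant maps\<close>

text \<open>Openness of the image comes from invariance of domain and the derivative from the real
  inverse function theorem; the inverse of a complex homogeneous linear map is again complex
  homogeneous.\<close>

lemma holomorphic_vec_the_inv:
  fixes \<psi> :: "complex ^ 'm::finite \<Rightarrow> complex ^ 'm"
  assumes \<psi>: "holomorphic_vec S \<psi>" "inj_on \<psi> S"
    and inj: "\<And>z u. z \<in> S \<Longrightarrow> fd \<psi> z u = 0 \<Longrightarrow> u = 0"
  shows "holomorphic_vec (\<psi> ` S) (the_inv_into S \<psi>)"
  unfolding holomorphic_vec_iff
proof (intro conjI ballI)
  have "open S" using \<psi>(1) by (rule holomorphic_vec_open)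
  show "open (\<psi> ` S)"
    by (rule invariance_of_domain[OF holomorphic_vec_continuous_on[OF \<psi>(1)] \<open>open S\<close> \<psi>(2)])
  fix w assume "w \<in> \<psi> ` S"
  then obtain z where z: "z \<in> S" "w = \<psi> z" by blast
  note d = holomorphic_vec_has_derivative[OF \<psi>(1) z(1)]
  have lin: "linear (fd \<psi> z)" using d has_derivative_bounded_linear bounded_linear.linear by blast
  then have "inj (fd \<psi> z)" using inj[OF z(1)] by (simp add: linear_injective_0)
  then obtain g where g: "linear g" "\<And>x. g (fd \<psi> z x) = x" "\<And>x. fd \<psi> z (g x) = x"
    using linear_injective_isomorphism[OF lin] by blast
  have "(the_inv_into S \<psi> has_derivative g) (at (\<psi> z))"
    by (rule has_derivative_inverse_strong[OF \<open>open S\<close> z(1) holomorphic_vec_continuous_on[OF \<psi>(1)] _ d])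
      (use \<psi>(2) g in \<open>auto simp: the_inv_into_f_f\<close>)
  moreover have "g (c *s v) = c *s g v" for c v
    using g(2)[of "c *s g v"] by (simp add: holomorphic_vec_fd_vscale[OF \<psi>(1) z(1)] g(3))
  ultimately show "\<exists>D. (the_inv_into S \<psi> has_derivative D) (at w) \<and> (\<forall>c v. D (c *s v) = c *s D v)"
    unfolding z(2) by blast
qed

text \<open>A linear map has constant derivative, so closedness at \<open>z\<close> is closedness of
  \<open>M\<close> at \<open>B *v z\<close>, tested on the images of the three vectors.\<close>

lemma closed_form_pullback_linear:
  fixes B :: "complex ^ 'm::finite ^ 'm"
  assumes M: "closed_form V M" and U: "open U" "(*v) B ` U \<subseteq> V"
  shows "closed_form U (\<lambda>z. transpose B ** M (B *v z) ** B)"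
  unfolding closed_form_def
proof (intro conjI ballI allI)
  let ?N = "\<lambda>z. transpose B ** M (B *v z) ** B"
  have MB: "holomorphic_mat U (\<lambda>z. M (B *v z))"
    by (rule holomorphic_mat_compose[OF closed_form_mat[OF M] holomorphic_vec_matvec[OF U(1)] U(2)])
  then have entry: "holomorphic_fun U (\<lambda>z. M (B *v z) $ i $ j)" for i j by (simp add: holomorphic_mat_iff)
  have "?N z $ i $ j = (\<Sum>k\<in>UNIV. \<Sum>l\<in>UNIV. (B *v axis i 1) $ k * (B *v axis j 1) $ l * M (B *v z) $ k $ l)"
    for z i j
    unfolding bil_axis[where M = "?N z" and i = i and j = j, symmetric] bil_mult[symmetric] by (rule bil_expand)
  then have "holomorphic_fun U (\<lambda>z. ?N z $ i $ j)" for i j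
    by (simp only:) (intro holomorphic_fun_sum holomorphic_fun_mult entry U(1); simp add: U(1))
  then show "holomorphic_mat U ?N" using U(1) by (simp add: holomorphic_mat_iff)
  fix z assume z: "z \<in> U"
  then have Bz: "B *v z \<in> V" using U(2) by blast
  show "skew (?N z)"
  proof (rule skewI)
    show "bil (?N z) u u = 0" for u
      unfolding bil_mult[symmetric] using skew_bil[OF closed_form_skew[OF M Bz], of "B *v u" "B *v u"] by simp
  qed
  have "linear (\<lambda>P. transpose B ** P ** B)"
    by (rule linearI; rule bil_eqI)
      (simp_all only: bil_mult[symmetric] matvec.add_left matvec.scaleR_left dotc.add_right dotc.scaleR_right)
  then have bl: "bounded_linear (\<lambda>P. transpose B ** P ** B)" by (simp add: linear_conv_bounded_linear)
  have "((*v) B has_derivative (*v) B) (at z)"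
    by (intro bounded_linear_imp_has_derivative matvec.bounded_linear_right)
  from bounded_linear.has_derivative[OF bl
      diff_chain_at[OF this holomorphic_mat_has_derivative[OF closed_form_mat[OF M] Bz]]]
  have "fd ?N z = (\<lambda>u. transpose B ** fd M (B *v z) (B *v u) ** B)"
    by (intro fd_eq) (simp add: o_def)
  then show "bil (fd ?N z u) v w - bil (fd ?N z v) u w + bil (fd ?N z w) u v = 0" for u v w
    using closed_form_closed[OF M Bz, where u = "B *v u" and v = "B *v v" and w = "B *v w"]
    by (simp only: bil_mult[symmetric])
qed

context finite_Sp
begin

text \<open>Because \<open>S\<close> is saturated, the preimage upstairs of \<open>pr\<close> S
  \<inter> \<Phi> -\<open>W\<close> is \<open>S \<inter> g -\<close> (pr -\<open>W)\<close>;
  continuity and the sheaf condition thus become statements about \<open>g\<close>.\<close>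

lemma descended_map_holomorphic:
  assumes g: "holomorphic_vec S g" and sat: "pr -` pr ` S = S" and V: "openin (topol X) V"
    and \<Phi>: "\<And>z. z \<in> S \<Longrightarrow> \<Phi> (pr z) = pr (g z)" "\<And>z. z \<in> S \<Longrightarrow> pr (g z) \<in> V"
  shows "holomorphic_map X (pr ` S) X V \<Phi>"
  unfolding holomorphic_map_def
proof (intro conjI allI impI V)
  have "open S" by (rule holomorphic_vec_open[OF g])
  show U: "openin (topol X) (pr ` S)" by (rule openin_pr_image[OF \<open>open S\<close>])
  have pre: "pr -` (pr ` S \<inter> \<Phi> -` W) = S \<inter> g -` (pr -` W)" for W
    using \<Phi>(1) sat by auto
  have op: "open (S \<inter> g -` (pr -` W))" if "openin (topol X) W" for W
    using continuous_open_preimage[OF holomorphic_vec_continuous_on[OF g] \<open>open S\<close>] that openin_X by blast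
  have opU: "openin (topol X) (pr ` S \<inter> \<Phi> -` W)" if "openin (topol X) W" for W
    unfolding openin_X pre using op[OF that] by auto
  show "continuous_map (subtopology (topol X) (pr ` S)) (subtopology (topol X) V) \<Phi>"
    unfolding continuous_map_in_subtopology
  proof
    show "\<Phi> \<in> topspace (subtopology (topol X) (pr ` S)) \<rightarrow> V" using \<Phi> by auto
    show "continuous_map (subtopology (topol X) (pr ` S)) (topol X) \<Phi>"
      unfolding continuous_map_def
    proof (intro conjI allI impI)
      show "\<Phi> \<in> topspace (subtopology (topol X) (pr ` S)) \<rightarrow> topspace (topol X)"
        using \<Phi> openin_subset[OF V] by auto
      fix W assume "openin (topol X) W"
      moreover have "{x \<in> topspace (subtopology (topol X) (pr ` S)). \<Phi> x \<in> W} = pr ` S \<inter> \<Phi> -` W"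
        using openin_subset[OF U] by auto
      ultimately show "openin (subtopology (topol X) (pr ` S))
          {x \<in> topspace (subtopology (topol X) (pr ` S)). \<Phi> x \<in> W}"
        using opU openin_open_subtopology[OF U] by auto
    qed
  qed
  fix W f assume W: "openin (topol X) W" "sheaf X W f"
  have "holomorphic_fun (S \<inter> g -` (pr -` W)) (\<lambda>z. (f \<circ> pr) (g z))"
  proof (rule holomorphic_fun_compose[where f = "f \<circ> pr" and V = "pr -` W"])
    show "holomorphic_fun (pr -` W) (f \<circ> pr)" using W(2) by (simp add: sheaf_X)
    show "holomorphic_vec (S \<inter> g -` (pr -` W)) g" by (rule holomorphic_vec_subset[OF g _ op[OF W(1)]]) auto
  qed auto
  then have "holomorphic_fun (S \<inter> g -` (pr -` W)) (f \<circ> \<Phi> \<circ> pr)"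
    by (rule holomorphic_fun_cong) (use \<Phi>(1) in auto)
  then show "sheaf X (pr ` S \<inter> \<Phi> -` W) (f \<circ> \<Phi>)"
    unfolding sheaf_X pre using opU[OF W(1)] by simp
qed

text \<open>Symplectic matrices need not preserve balls; intersecting the finitely many preimages of
  a ball restores invariance.\<close>

lemma invariant_nbhd:
  assumes "r > 0"
  defines "S \<equiv> (\<Inter>A\<in>G. (*v) A -` ball 0 r)"
  shows "open S" "0 \<in> S" "S \<subseteq> ball 0 r" "\<And>A z. A \<in> G \<Longrightarrow> z \<in> S \<Longrightarrow> A *v z \<in> S"
proof -
  show "open S" unfolding S_def using finite open_vimage_matvec by (intro open_INT) auto
  show "0 \<in> S" using \<open>r > 0\<close> by (simp add: S_def matvec.zero_right)
  show "S \<subseteq> ball 0 r" unfolding S_def using one_mem by (auto dest!: bspec[of _ _ "mat 1"])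
  show "A *v z \<in> S" if "A \<in> G" "z \<in> S" for A z
    unfolding S_def
  proof (intro INT_I vimageI2)
    fix C assume "C \<in> G"
    then have "(C ** A) *v z \<in> ball 0 r" using that mult_mem[of C A] unfolding S_def by blast
    then show "C *v (A *v z) \<in> ball 0 r" by (simp add: matrix_vector_mul_assoc)
  qed
qed

lemma saturated:
  assumes "\<And>A z. A \<in> G \<Longrightarrow> z \<in> S \<Longrightarrow> A *v z \<in> S" shows "pr -` pr ` S = S"
proof
  show "pr -` pr ` S \<subseteq> S"
  proof
    fix z assume "z \<in> pr -` pr ` S"
    then obtain y where y: "y \<in> S" "pr y = pr z" by force
    then obtain A where "A \<in> G" "z = A *v y" using pr_eq_iff[of y z] by blast
    then show "z \<in> S" using assms y(1) by blast
  qed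
qed auto

text \<open>At points with trivial stabilizer the equality of forms follows from the chain rule; at the other
  points of a chart it follows by continuity.\<close>

lemma eq_pullback_descended:
  assumes \<omega>: "holomorphic_two_form X W \<omega>" and \<omega>': "holomorphic_two_form X W' \<omega>'"
    and sub: "pr ` S \<subseteq> W" "V \<subseteq> W'"
    and \<psi>: "holomorphic_vec S \<psi>" and sat: "pr -` pr ` S = S"
    and \<Phi>: "\<And>z. z \<in> S \<Longrightarrow> \<Phi> (pr z) = pr (\<psi> z)"
    and nondeg: "\<And>z. z \<in> S \<inter> free \<Longrightarrow> det (lift_form \<omega> W z) \<noteq> 0"
    and eq: "\<And>z u v. z \<in> S \<inter> free \<Longrightarrow>
      bil (lift_form \<omega>' W' (\<psi> z)) (fd \<psi> z u) (fd \<psi> z v) = bil (lift_form \<omega> W z) u v"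
  shows "eq_pullback X (pr ` S) X V \<Phi> \<omega> \<omega>'"
  unfolding eq_pullback_def
proof (intro allI impI ballI)
  fix A B and a b :: "_ \<Rightarrow> complex ^ ('n + 'n)" and x
  assume a: "chart X A a" and A: "A \<subseteq> pr ` S" and b: "chart X B b" and B: "B \<subseteq> V"
    and x: "x \<in> A" "\<Phi> x \<in> B"
  have AW: "A \<subseteq> W" "B \<subseteq> W'" using A B sub by auto
  \<comment> \<open>The part of the chart domain which \<open>\<Phi>\<close> sends into the other
    chart; all comparisons are made on its preimage \<open>E\<close> under the orbit map.\<close>
  define Q where "Q = A \<inter> \<Phi> -` B"
  have prA: "pr -` A \<subseteq> S" using vimage_mono[OF A, of pr] unfolding sat .
  have preQ: "pr -` Q = pr -` A \<inter> \<psi> -` (pr -` B)"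
  proof -
    have "pr z \<in> Q \<longleftrightarrow> pr z \<in> A \<and> pr (\<psi> z) \<in> B" for z
    proof (cases "pr z \<in> A")
      case True
      then have "\<Phi> (pr z) = pr (\<psi> z)" using \<Phi> prA by blast
      with True show ?thesis by (simp add: Q_def)
    qed (simp add: Q_def)
    then show ?thesis by blast
  qed
  have \<psi>A: "continuous_on (pr -` A) \<psi>"
    by (rule continuous_on_subset[OF holomorphic_vec_continuous_on[OF \<psi>] prA])
  define E where "E = pr -` Q"
  have opE: "open E"
    unfolding E_def preQ by (rule continuous_open_preimage[OF \<psi>A chart_vimage_open[OF a] chart_vimage_open[OF b]])
  have ES: "E \<subseteq> S" using prA unfolding E_def preQ by blast
  have Q: "openin (topol X) Q"
    unfolding openin_X using opE chart_openin[OF a] openin_X by (auto simp: Q_def E_def)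
  let ?t = "b \<circ> \<Phi> \<circ> the_inv_into A a"
  have "holomorphic_vec E (\<lambda>z. (b \<circ> pr) (\<psi> z))"
    by (rule holomorphic_vec_compose[OF chart_lift_hol[OF b] holomorphic_vec_subset[OF \<psi> ES opE]])
      (auto simp: E_def preQ)
  then have "holomorphic_vec (pr -` Q) ((b \<circ> \<Phi>) \<circ> pr)"
    unfolding E_def[symmetric] by (rule holomorphic_vec_cong) (use ES \<Phi> in auto)
  from chart_push_hol[OF a Q _ this]
  have t: "holomorphic_vec (a ` Q) ?t" by (simp add: Q_def)
  let ?p = "\<lambda>z. a (pr z)" and ?q = "\<lambda>z. b (pr (\<psi> z))"
  have pE: "?p z \<in> a ` Q" if "z \<in> E" for z using that by (auto simp: E_def)
  have prE: "pr z \<in> A" "pr (\<psi> z) \<in> B" if "z \<in> E" for z using that unfolding E_def preQ by auto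
  have cont_p: "continuous_on E ?p"
    using continuous_on_subset[OF holomorphic_vec_continuous_on[OF chart_lift_hol[OF a]], of E] prE
    by (auto simp: o_def)
  have cont_q: "continuous_on E ?q"
    using continuous_on_compose2[OF holomorphic_vec_continuous_on[OF chart_lift_hol[OF b]]
        continuous_on_subset[OF holomorphic_vec_continuous_on[OF \<psi>] ES]] prE
    by (auto simp: o_def)
  have free_eq: "\<omega> A a (?p z) u v = \<omega>' B b (?q z) (fd ?t (?p z) u) (fd ?t (?p z) v)"
    if z: "z \<in> E" "z \<in> free" for z u v
  proof -
    have zS: "z \<in> S \<inter> free" using z ES by blast
    let ?T = "fd (a \<circ> pr) z" and ?U = "fd (b \<circ> pr) (\<psi> z)"
    have T: "((a \<circ> pr) has_derivative ?T) (at z)"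
      using holomorphic_vec_has_derivative[OF chart_lift_hol[OF a]] prE[OF z(1)] by simp
    have U: "((b \<circ> pr) has_derivative ?U) (at (\<psi> z))"
      using holomorphic_vec_has_derivative[OF chart_lift_hol[OF b]] prE[OF z(1)] by simp
    have "(?t has_derivative fd ?t (?p z)) (at ((a \<circ> pr) z))"
      using holomorphic_vec_has_derivative[OF t pE[OF z(1)]] by simp
    from diff_chain_at[OF T this]
    have "(((b \<circ> pr) \<circ> \<psi>) has_derivative (fd ?t (?p z) \<circ> ?T)) (at z)"
      by (rule has_derivative_cong_open[OF _ opE z(1)])
        (use prE ES \<Phi> chart_inv[OF a] in auto)
    moreover have "(((b \<circ> pr) \<circ> \<psi>) has_derivative (?U \<circ> fd \<psi> z)) (at z)"
      by (rule diff_chain_at[OF holomorphic_vec_has_derivative[OF \<psi>] U]) (use zS in simp)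
    ultimately have "fd ?t (?p z) \<circ> ?T = ?U \<circ> fd \<psi> z" by (rule has_derivative_unique)
    then have chain: "fd ?t (?p z) (?T u) = ?U (fd \<psi> z u)" for u by (metis comp_apply)
    have T_eq: "\<omega> A a (?p z) (?T u) (?T v) = bil (lift_form \<omega> W z) u v" for u v
      using bil_lift_form[OF \<omega> a AW(1)] prE(1)[OF z(1)] by simp
    have R_eq: "\<omega>' B b (?q z) (fd ?t (?p z) (?T u)) (fd ?t (?p z) (?T v)) = bil (lift_form \<omega> W z) u v" for u v
      unfolding chain eq[OF zS, symmetric]
      using bil_lift_form[OF \<omega>' b AW(2)] prE(2)[OF z(1)] by simp
    \<comment> \<open>The forms have been compared only on vectors in the range of
      \<open>?T\<close>. A kernel vector of \<open>?T\<close> would lie in the kernel of the lifted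
      form, which is nondegenerate at free points, so the range is everything.\<close>
    have "surj ?T"
    proof -
      have lin: "linear ?T" using T has_derivative_bounded_linear bounded_linear.linear by blast
      have "u = 0" if "?T u = 0" for u
      proof (rule det_nonzeroD[OF nondeg[OF zS]])
        fix v
        have "Vector_Spaces.linear (*s) (*) (\<lambda>u'. \<omega> A a (?p z) (?T v) u')"
          by (rule form_linear(1)[OF \<omega> a AW(1)]) (use prE[OF z(1)] in auto)
        from cvec_linear_expand[OF this, of 0]
        show "bil (lift_form \<omega> W z) v u = 0"
          unfolding T_eq[symmetric] that by simp
      qed
      then show ?thesis using linear_injective_imp_surjective[OF lin] by (simp add: linear_injective_0[OF lin])
    qed
    then obtain u' v' where "u = ?T u'" "v = ?T v'" by (meson surjE)
    then show ?thesis using T_eq R_eq by simp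
  qed
  have cont_fd: "continuous_on E (\<lambda>z. fd ?t (?p z) u $ i)" for u i
    by (intro continuous_on_component continuous_on_compose2[OF holomorphic_vec_fd_continuous[OF t] cont_p])
      (use pE in auto)
  obtain z0 where x_eq: "x = pr z0" using x(1) A by blast
  have "z0 \<in> E" using x unfolding E_def Q_def x_eq by simp
  note z0 = this x_eq
  show "\<omega> A a (a x) = pullback_at \<Phi> A a b x (\<omega>' B b (b (\<Phi> x)))"
    unfolding pullback_at_def Let_def
  proof (intro ext)
    fix u v
    have lin': "Vector_Spaces.linear (*s) (*) (\<lambda>v. \<omega>' B b (?q z) u v)"
      "Vector_Spaces.linear (*s) (*) (\<lambda>u. \<omega>' B b (?q z) u v)" if "z \<in> E" for z u v
      by (rule form_linear[OF \<omega>' b AW(2)]; use prE[OF that] in blast)+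
    have "\<omega> A a (?p z0) u v = \<omega>' B b (?q z0) (fd ?t (?p z0) u) (fd ?t (?p z0) v)"
    proof (rule eq_by_density[OF opE _ _ negligible_not_free _ z0(1)])
      show "continuous_on E (\<lambda>z. \<omega> A a (?p z) u v)"
        by (rule continuous_on_compose2[OF holomorphic_fun_continuous_on[OF form_hol[OF \<omega> a AW(1)]] cont_p])
          (use prE in auto)
      \<comment> \<open>Point and arguments of the form vary together; bilinear expansion leaves the
        form only on fixed basis vectors, where continuity is known.\<close>
      have "continuous_on E (\<lambda>z. \<Sum>i\<in>UNIV. \<Sum>j\<in>UNIV. fd ?t (?p z) u $ i * fd ?t (?p z) v $ j
          * \<omega>' B b (?q z) (axis i 1) (axis j 1))"
        by (intro continuous_on_sum continuous_on_mult cont_fd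
            continuous_on_compose2[OF holomorphic_fun_continuous_on[OF form_hol[OF \<omega>' b AW(2)]] cont_q])
          (use prE in auto)
      then show "continuous_on E (\<lambda>z. \<omega>' B b (?q z) (fd ?t (?p z) u) (fd ?t (?p z) v))"
        by (rule continuous_on_eq) (rule bilinear_expand[OF lin', symmetric])
      show "\<omega> A a (?p z) u v = \<omega>' B b (?q z) (fd ?t (?p z) u) (fd ?t (?p z) v)"
        if "z \<in> E" "z \<notin> - free" for z using free_eq that by blast
    qed
    then show "\<omega> A a (a x) u v = \<omega>' B b (b (\<Phi> x)) (fd ?t (a x) u) (fd ?t (a x) v)"
      using z0 ES \<Phi> by auto
  qed
qed

lemma germ_equivalent_symplectic_forms:
  fixes \<omega> \<omega>' :: "((complex ^ ('n + 'n)) set, 'n + 'n) two_form"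
  assumes \<omega>: "germ_symplectic_form X (pr 0) W \<omega>" and \<omega>': "germ_symplectic_form X (pr 0) W' \<omega>'"
  shows "germ_equivalent X (pr 0) W \<omega> X (pr 0) W' \<omega>'"
proof -
  let ?M = "lift_form \<omega> W" and ?M' = "lift_form \<omega>' W'"
  note L = lift_form_free[OF \<omega>] and L' = lift_form_free[OF \<omega>']
  have "open (pr -` W \<inter> pr -` W')" "0 \<in> pr -` W \<inter> pr -` W'"
    using \<omega> \<omega>' openin_X by (auto simp: germ_symplectic_form_def)
  then obtain R where R: "R > 0" "ball 0 R \<subseteq> pr -` W \<inter> pr -` W'" by (meson openE)
  have opR: "open (ball 0 R \<inter> free)" using open_free by blast
  have subR: "ball 0 R \<inter> free \<subseteq> free \<inter> pr -` W" "ball 0 R \<inter> free \<subseteq> free \<inter> pr -` W'" using R(2) by auto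
  obtain r1 N where r1: "0 < r1" "r1 \<le> R" and N: "closed_form (ball 0 r1) N" "det (N 0) \<noteq> 0"
    and N_eq: "\<And>z. z \<in> ball 0 r1 \<inter> free \<Longrightarrow> N z = ?M z"
    and N_inv: "\<And>A z. A \<in> G \<Longrightarrow> z \<in> ball 0 r1 \<Longrightarrow> A *v z \<in> ball 0 r1 \<Longrightarrow> transpose A ** N (A *v z) ** A = N z"
    by (rule extend_form[OF R(1) closed_form_subset[OF L(1) subR(1) opR] L(2) L(3)]) (use subR in blast)+
  obtain r2 N' where r2: "0 < r2" "r2 \<le> R" and N': "closed_form (ball 0 r2) N'" "det (N' 0) \<noteq> 0"
    and N'_eq: "\<And>z. z \<in> ball 0 r2 \<inter> free \<Longrightarrow> N' z = ?M' z"
    and N'_inv: "\<And>A z. A \<in> G \<Longrightarrow> z \<in> ball 0 r2 \<Longrightarrow> A *v z \<in> ball 0 r2 \<Longrightarrow> transpose A ** N' (A *v z) ** A = N' z"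
    by (rule extend_form[OF R(1) closed_form_subset[OF L'(1) subR(2) opR] L'(2) L'(3)]) (use subR in blast)+
  have zero: "0 \<in> ball (0 :: complex ^ ('n + 'n)) r1" "0 \<in> ball (0 :: complex ^ ('n + 'n)) r2"
    using r1 r2 by auto
  obtain B where B: "transpose B ** N' 0 ** B = N 0" "det B \<noteq> 0"
    and B_comm: "\<And>g. transpose g ** N 0 ** g = N 0 \<Longrightarrow> transpose g ** N' 0 ** g = N' 0 \<Longrightarrow> g ** B = B ** g"
    using equivariant_linear_equivalence[OF closed_form_skew[OF N(1) zero(1)] closed_form_skew[OF N'(1) zero(2)] N(2) N'(2)]
    by blast
  have comm: "A ** B = B ** A" if "A \<in> G" for A
    by (rule B_comm) (use N_inv[OF that, of 0] N'_inv[OF that, of 0] zero in \<open>simp_all add: matvec.zero_right\<close>)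
  have comm_v: "A *v (B *v z) = B *v (A *v z)" if "A \<in> G" for A z
    by (simp add: matrix_vector_mul_assoc comm[OF that])
  have "open ((*v) B -` ball 0 r2)" "0 \<in> (*v) B -` ball 0 r2"
    using open_vimage_matvec r2 by (auto simp: matvec.zero_right)
  then obtain r3 where r3: "r3 > 0" "ball 0 r3 \<subseteq> (*v) B -` ball 0 r2" by (meson openE)
  \<comment> \<open>\<open>B\<close> need not preserve balls: \<open>r3\<close> keeps the image in
    the ball of \<open>N'\<close>, and \<open>r1\<close> keeps the point in the ball of
    \<open>N\<close>.\<close>
  define r where "r = min r1 r3"
  have r: "r > 0" "ball 0 r \<subseteq> ball (0 :: complex ^ ('n + 'n)) r1" using r1 r3 by (auto simp: r_def)
  have Bball: "B *v z \<in> ball 0 r2" if "z \<in> ball 0 r" for z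
    using that r3 by (auto simp: r_def)
  \<comment> \<open>Pulled back by \<open>B\<close>, the second form agrees with the first at the
    origin, as Moser's argument requires.\<close>
  define N'' where "N'' z = transpose B ** N' (B *v z) ** B" for z
  have N''_closed: "closed_form (ball 0 r) N''"
    unfolding N''_def by (rule closed_form_pullback_linear[OF N'(1)]) (use Bball in auto)
  have same: "N 0 = N'' 0" using B(1) by (simp add: N''_def matvec.zero_right)
  have N''_inv: "transpose A ** N'' (A *v w) ** A = N'' w"
    if A: "A \<in> G" and w: "w \<in> ball 0 r" "A *v w \<in> ball 0 r" for A w
  proof (rule bil_eqI)
    fix u v
    have "A *v (B *v w) \<in> ball 0 r2" using Bball[OF w(2)] comm_v[OF A] by simp
    from N'_inv[OF A Bball[OF w(1)] this]
    have "bil (N' (A *v (B *v w))) (A *v (B *v u)) (A *v (B *v v)) = bil (N' (B *v w)) (B *v u) (B *v v)"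
      by (simp only: bil_mult)
    then show "bil (transpose A ** N'' (A *v w) ** A) u v = bil (N'' w) u v"
      by (simp only: N''_def bil_mult[symmetric] comm_v[OF A])
  qed
  obtain \<rho> \<phi> where \<rho>: "0 < \<rho>" "\<rho> \<le> r" and \<phi>: "holomorphic_vec (ball 0 \<rho>) \<phi>" "\<phi> 0 = 0"
    and \<phi>_ball: "\<And>z. z \<in> ball 0 \<rho> \<Longrightarrow> \<phi> z \<in> ball 0 r"
    and N_det: "\<And>z. z \<in> ball 0 \<rho> \<Longrightarrow> det (N z) \<noteq> 0"
    and \<phi>_lip: "\<And>z w. z \<in> ball 0 \<rho> \<Longrightarrow> w \<in> ball 0 \<rho> \<Longrightarrow> norm ((\<phi> z - z) - (\<phi> w - w)) \<le> norm (z - w) / 2"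
    and \<phi>_form: "\<And>z u v. z \<in> ball 0 \<rho> \<Longrightarrow> bil (N'' (\<phi> z)) (fd \<phi> z u) (fd \<phi> z v) = bil (N z) u v"
    and \<phi>_equiv: "\<And>A z. (\<And>w. w \<in> ball 0 r \<Longrightarrow> A *v w \<in> ball 0 r \<Longrightarrow> transpose A ** N (A *v w) ** A = N w) \<Longrightarrow>
       (\<And>w. w \<in> ball 0 r \<Longrightarrow> A *v w \<in> ball 0 r \<Longrightarrow> transpose A ** N'' (A *v w) ** A = N'' w) \<Longrightarrow>
       z \<in> ball 0 \<rho> \<Longrightarrow> A *v z \<in> ball 0 \<rho> \<Longrightarrow> \<phi> (A *v z) = A *v \<phi> z"
    using moser[OF closed_form_subset[OF N(1) r(2) open_ball] N''_closed same N(2) r(1)] by blast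
  define S where "S = (\<Inter>A\<in>G. (*v) A -` ball (0 :: complex ^ ('n + 'n)) \<rho>)"
  note S = invariant_nbhd[OF \<rho>(1), folded S_def]
  \<comment> \<open>\<open>\<phi>\<close> pulls \<open>N''\<close> back to \<open>N\<close> and
    \<open>B\<close> pulls \<open>N'\<close> back to \<open>N''\<close>, so the composite pulls
    \<open>N'\<close> back to \<open>N\<close>.\<close>
  define \<psi> where "\<psi> z = B *v \<phi> z" for z
  have \<psi>_hol: "holomorphic_vec S \<psi>"
    unfolding \<psi>_def
    by (rule holomorphic_vec_compose[OF holomorphic_vec_matvec[OF open_UNIV] holomorphic_vec_subset[OF \<phi>(1) S(3,1)]]) simp
  have \<psi>_fd: "fd \<psi> z u = B *v fd \<phi> z u" if "z \<in> S" for z u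
  proof -
    have "(\<psi> has_derivative (\<lambda>u. B *v fd \<phi> z u)) (at z)"
      unfolding \<psi>_def[abs_def]
      by (intro bounded_linear.has_derivative[OF matvec.bounded_linear_right] holomorphic_vec_has_derivative[OF \<phi>(1)])
        (use that S in blast)
    then show ?thesis by (simp add: fd_eq)
  qed
  have \<psi>_form: "bil (N' (\<psi> z)) (fd \<psi> z u) (fd \<psi> z v) = bil (N z) u v" if "z \<in> S" for z u v
  proof -
    have "z \<in> ball 0 \<rho>" using that S(3) by blast
    from \<phi>_form[OF this, of u v] show ?thesis
      unfolding \<psi>_fd[OF that] \<psi>_def N''_def bil_mult[symmetric] .
  qed
  have \<psi>_equiv: "\<psi> (A *v z) = A *v \<psi> z" if A: "A \<in> G" and z: "z \<in> S" for A z
  proof -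
    have "\<phi> (A *v z) = A *v \<phi> z"
    proof (rule \<phi>_equiv)
      fix w assume w: "w \<in> ball 0 r" "A *v w \<in> ball 0 r"
      show "transpose A ** N (A *v w) ** A = N w" by (rule N_inv[OF A]) (use w r(2) in blast)+
      show "transpose A ** N'' (A *v w) ** A = N'' w" by (rule N''_inv[OF A w])
    next
      show "z \<in> ball 0 \<rho>" "A *v z \<in> ball 0 \<rho>" using S(3) S(4)[OF A z] z by blast+
    qed
    then show ?thesis by (simp add: \<psi>_def comm_v[OF A])
  qed
  have \<psi>_inj: "inj_on \<psi> S"
  proof (rule inj_onI)
    fix z w assume zw: "z \<in> S" "w \<in> S" "\<psi> z = \<psi> w"
    then have "\<phi> z = \<phi> w" using matvec_cancel[OF B(2)] by (simp add: \<psi>_def)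
    moreover have "norm ((\<phi> z - z) - (\<phi> w - w)) \<le> norm (z - w) / 2"
      by (rule \<phi>_lip) (use zw S(3) in blast)+
    \<comment> \<open>For equal images the difference of the displacements is \<open>w - z\<close>,
      so any constant below 1 forces the points to coincide.\<close>
    ultimately have "norm (z - w) \<le> norm (z - w) / 2" by (simp add: norm_minus_commute)
    then show "z = w" by simp
  qed
  \<comment> \<open>A kernel vector of the derivative would be a kernel vector of the pulled-back
    form \<open>N z\<close>.\<close>
  have \<psi>_fd_inj: "u = 0" if z: "z \<in> S" and u: "fd \<psi> z u = 0" for z u
  proof (rule det_nonzeroD)
    show "det (N z) \<noteq> 0" using N_det S(3) z by blast
    show "bil (N z) v u = 0" for v
      using \<psi>_form[OF z, of v u] u by (simp add: matvec.zero_right dotc.zero_right)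
  qed
  define \<xi> where "\<xi> = the_inv_into S \<psi>"
  have \<xi>_hol: "holomorphic_vec (\<psi> ` S) \<xi>"
    unfolding \<xi>_def by (rule holomorphic_vec_the_inv[OF \<psi>_hol \<psi>_inj \<psi>_fd_inj])
  have \<xi>: "\<xi> (\<psi> z) = z" if "z \<in> S" for z
    unfolding \<xi>_def by (rule the_inv_into_f_f[OF \<psi>_inj that])
  have satS: "pr -` pr ` S = S" by (rule saturated[OF S(4)])
  have sat\<psi>S: "pr -` pr ` \<psi> ` S = \<psi> ` S"
  proof (rule saturated)
    fix A w assume "A \<in> G" "w \<in> \<psi> ` S"
    then obtain z where "z \<in> S" "w = \<psi> z" by blast
    then have "A *v w = \<psi> (A *v z)" "A *v z \<in> S" using \<psi>_equiv S(4) \<open>A \<in> G\<close> by auto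
    then show "A *v w \<in> \<psi> ` S" by blast
  qed
  \<comment> \<open>The representative is chosen in \<open>S\<close>, where equivariance makes the
    resulting orbit independent of the choice.\<close>
  define \<Phi> where "\<Phi> x = pr (\<psi> (SOME z. z \<in> S \<and> pr z = x))" for x
  have \<Phi>: "\<Phi> (pr z) = pr (\<psi> z)" if z: "z \<in> S" for z
  proof -
    let ?y = "SOME y. y \<in> S \<and> pr y = pr z"
    have y: "?y \<in> S \<and> pr ?y = pr z" by (rule someI[of _ z]) (simp add: z)
    then obtain A where "A \<in> G" "?y = A *v z" using pr_eq_iff[of z ?y] by auto
    then have "\<psi> ?y = A *v \<psi> z" using \<psi>_equiv[OF _ z] by simp
    then show ?thesis unfolding \<Phi>_def using \<open>A \<in> G\<close> by simp
  qed
  have inj\<Phi>: "inj_on \<Phi> (pr ` S)"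
  proof (rule inj_onI)
    fix x y assume "x \<in> pr ` S" "y \<in> pr ` S" "\<Phi> x = \<Phi> y"
    then obtain z w where zw: "z \<in> S" "x = pr z" "w \<in> S" "y = pr w" "pr (\<psi> z) = pr (\<psi> w)"
      using \<Phi> by auto
    then obtain A where A: "A \<in> G" "\<psi> w = A *v \<psi> z" using pr_eq_iff[of "\<psi> z" "\<psi> w"] by blast
    then have "\<psi> w = \<psi> (A *v z)" using \<psi>_equiv zw by simp
    then have "w = A *v z" using inj_onD[OF \<psi>_inj] zw S(4) A by blast
    then show "x = y" using zw A by simp
  qed
  have img: "\<Phi> ` pr ` S = pr ` \<psi> ` S" using \<Phi> by (auto simp: image_iff)
  have inv\<Phi>: "the_inv_into (pr ` S) \<Phi> (pr w) = pr (\<xi> w)" if "w \<in> \<psi> ` S" for w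
  proof -
    obtain z where "z \<in> S" "w = \<psi> z" using \<open>w \<in> \<psi> ` S\<close> by blast
    then show ?thesis using the_inv_into_f_f[OF inj\<Phi>, of "pr z"] \<Phi> \<xi> by simp
  qed
  have bih: "biholomorphic_map X (pr ` S) X (pr ` \<psi> ` S) \<Phi>"
    unfolding biholomorphic_map_def
  proof (intro conjI)
    show "bij_betw \<Phi> (pr ` S) (pr ` \<psi> ` S)" using inj\<Phi> img by (simp add: bij_betw_def)
    show "holomorphic_map X (pr ` S) X (pr ` \<psi> ` S) \<Phi>"
      by (rule descended_map_holomorphic[OF \<psi>_hol satS openin_pr_image[OF holomorphic_vec_open[OF \<xi>_hol]] \<Phi>]) auto
    show "holomorphic_map X (pr ` \<psi> ` S) X (pr ` S) (the_inv_into (pr ` S) \<Phi>)"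
      by (rule descended_map_holomorphic[OF \<xi>_hol sat\<psi>S openin_pr_image[OF S(1)] inv\<Phi>]) (use \<xi> in auto)
  qed
  have \<psi>_ball: "\<psi> z \<in> ball 0 r2" if "z \<in> S" for z
    unfolding \<psi>_def by (rule Bball[OF \<phi>_ball]) (use that S(3) in blast)
  have "S \<subseteq> ball 0 r1" using S(3) \<rho>(2) r(2) subset_ball[OF \<rho>(2)] by blast
  then have SR: "S \<subseteq> ball 0 R" "\<psi> ` S \<subseteq> ball 0 R"
    using subset_ball[OF r1(2)] subset_ball[OF r2(2)] \<psi>_ball by blast+
  then have subW: "pr ` S \<subseteq> W" "pr ` \<psi> ` S \<subseteq> W'" using R(2) by blast+
  \<comment> \<open>\<open>N'\<close> is known to equal the lift of \<open>\<omega>'\<close> only at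
    free points, so free points must have free images; an injective equivariant map preserves
    stabilizers.\<close>
  have free_\<psi>: "\<psi> z \<in> free" if z: "z \<in> S \<inter> free" for z
    unfolding free_def
  proof (intro CollectI ballI impI)
    fix A assume A: "A \<in> G" "A *v \<psi> z = \<psi> z"
    then have "\<psi> (A *v z) = \<psi> z" using \<psi>_equiv z by simp
    then have "A *v z = z" using inj_onD[OF \<psi>_inj] S(4) A(1) z by blast
    then show "A = mat 1" using z A(1) by (simp add: free_def)
  qed
  have "eq_pullback X (pr ` S) X (pr ` \<psi> ` S) \<Phi> \<omega> \<omega>'"
  proof (rule eq_pullback_descended[OF _ _ subW \<psi>_hol satS \<Phi>])
    show "holomorphic_two_form X W \<omega>" "holomorphic_two_form X W' \<omega>'"
      using \<omega> \<omega>' by (auto simp: germ_symplectic_form_def)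
    fix z assume z: "z \<in> S \<inter> free"
    then have "z \<in> ball 0 r1 \<inter> free" using \<open>S \<subseteq> ball 0 r1\<close> by blast
    note Nz = N_eq[OF this]
    show "det (?M z) \<noteq> 0" using N_det[of z] z S(3) unfolding Nz by blast
    have "\<psi> z \<in> ball 0 r2 \<inter> free" using \<psi>_ball free_\<psi>[OF z] z by blast
    note N'z = N'_eq[OF this]
    show "bil (?M' (\<psi> z)) (fd \<psi> z u) (fd \<psi> z v) = bil (?M z) u v" for u v
      using \<psi>_form[of z u v] z unfolding Nz N'z by blast
  qed
  moreover have "\<Phi> (pr 0) = pr 0" using \<Phi>[OF S(2)] \<phi>(2) by (simp add: \<psi>_def matvec.zero_right)
  moreover have "pr 0 \<in> pr ` S" using S(2) by blast
  moreover from calculation have "pr 0 \<in> pr ` \<psi> ` S" using img by (metis imageI)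
  ultimately show ?thesis
    unfolding germ_equivalent_def using bih subW by blast
qed

end

theorem mainTheorem4:
  fixes G :: "(complex ^ ('n + 'n) ^ ('n::finite + 'n)) set"
    and \<omega> \<omega>' :: "((complex ^ ('n + 'n)) set, 'n + 'n) two_form"
    and W W' :: "(complex ^ ('n + 'n)) set set"
  assumes "subgroup G Sp" and "finite G"
    and "germ_symplectic_form (quotient_space G) (orbit G 0) W \<omega>"
    and "germ_symplectic_form (quotient_space G) (orbit G 0) W' \<omega>'"
  shows "germ_equivalent (quotient_space G) (orbit G 0) W \<omega> (quotient_space G) (orbit G 0) W' \<omega>'"
proof -
  interpret finite_Sp G using assms(1,2) by (rule finite_Sp.intro)
  show ?thesis using assms(3,4) by (rule germ_equivalent_symplectic_forms)
qed

end
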